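(* Let $(S,\|\cdot\|)$ be a random normed module over $K$ with base $(\Omega,\mathcal{E},P)$, $1<p<+\infty$, and $\mathcal{F}$ a sub-$\sigma$-algebra of $\mathcal{E}$. Then the following statements are equivalent: (1) $(S,\|\cdot\|)$ is random reflexive; (2) $L^{p}(S)$ is a reflexive Banach space; (3) $L^{p}_{\mathcal{F}}(S)$ is random reflexive.
   Context: $(\Omega,\mathcal E,P)$ is a probability space and $K=\mathbb{R}$ or $\mathbb{C}$. For a $\sigma$-algebra $\mathcal G$ on $\Omega$ (here $\mathcal G=\mathcal E$ or $\mathcal F$), $L^{0}(\mathcal{G},K)$ is the algebra of equivalence classes (under a.s. equality) of $K$-valued $\mathcal{G}$-measurable functions; $L^0(\mathcal G,\bar{\mathbb R})$ (extended real-valued functions) is a complete lattice under a.s. pointwise order, with infimum $\wedge$; $L^0_+(\mathcal G,\mathbb R)$ is the set of nonnegative elements of $L^0(\mathcal G,\mathbb R)$. A random normed module over $K$ with base $(\Omega,\mathcal G,P)$ is a left $L^0(\mathcal G,K)$-module $S$ with an $L^0$-norm $\|\cdot\|:S\to L^0_+(\mathcal G,\mathbb R)$, i.e. $\|\xi x\|=|\xi|\|x\|$, $\|x+y\|\le\|x\|+\|y\|$, and $\|x\|=0$ iff $x=\theta$. Its random conjugate space $S^*$ is the $L^0(\mathcal G,K)$-module of module homomorphisms $f:S\to L^0(\mathcal G,K)$ for which there is $\xi\in L^0_+(\mathcal G,\mathbb R)$ with $|f(x)|\le\xi\|x\|$ for all $x\in S$ (equivalently, the continuous ones, for either the $(\varepsilon,\lambda)$-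 or the locally $L^0$-convex topology), with $L^0$-norm $\|f\|^*=\wedge\{\xi\in L^0_+(\mathcal G,\mathbb R):|f(x)|\le\xi\|x\|\ \forall x\in S\}$; it is again a random normed module with base $(\Omega,\mathcal G,P)$. $S^{**}=(S^* )^*$, and $S$ is random reflexive if the canonical embedding $J:S\to S^{**}$, $(Jx)(f)=f(x)$, is surjective. For $1\le p<\infty$, $L^p(S)=\{x\in S:\|x\|_p<\infty\}$ is normed by $\|x\|_p=(\int_\Omega\|x\|^p\,dP)^{1/p}$. $L^p_{\mathcal F}(S)=\{x\in S:|||x|||_p\in L^0_+(\mathcal F,\mathbb R)\}$ where $|||x|||_p=(E[\|x\|^p\,|\,\mathcal F])^{1/p}$ (conditional expectation, possibly with value $+\infty$); $(L^p_{\mathcal F}(S),|||\cdot|||_p)$ is a random normed module over $K$ with base $(\Omega,\mathcal F,P)$. *)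

theory Defs
  imports "HOL-Probability.Probability" "HOL-Algebra.Module" "HOL-Algebra.Complete_Lattice"
begin

section \<open>Equivalence classes of measurable functions\<close>

definition L0_rel :: "'w measure \<Rightarrow> (('w \<Rightarrow> 'b::topological_space) \<times> ('w \<Rightarrow> 'b)) set" where
  "L0_rel G = {(f, g). f \<in> borel_measurable G \<and> g \<in> borel_measurable G \<and> (AE w in G. f w = g w)}"

definition L0 :: "'w measure \<Rightarrow> ('w \<Rightarrow> 'b::topological_space) set set" where
  "L0 G = borel_measurable G // L0_rel G"

definition L0_class :: "'w measure \<Rightarrow> ('w \<Rightarrow> 'b::topological_space) \<Rightarrow> ('w \<Rightarrow> 'b) set" where
  "L0_class G f = L0_rel G `` {f}"

text \<open>All operations on classes below act on an arbitrarily chosen representative; on members of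
  \<^const>\<open>L0\<close> the result does not depend on the choice.\<close>

definition L0_rep :: "('w \<Rightarrow> 'b) set \<Rightarrow> 'w \<Rightarrow> 'b" where
  "L0_rep X = (SOME f. f \<in> X)"

definition L0_ring :: "'w measure \<Rightarrow> ('w \<Rightarrow> 'k::real_normed_field) set ring" where
  "L0_ring G =
    \<lparr>carrier = L0 G,
     monoid.mult = (\<lambda>X Y. L0_class G (\<lambda>w. L0_rep X w * L0_rep Y w)),
     one = L0_class G (\<lambda>w. 1),
     zero = L0_class G (\<lambda>w. 0),
     add = (\<lambda>X Y. L0_class G (\<lambda>w. L0_rep X w + L0_rep Y w))\<rparr>"

definition L0_le :: "'w measure \<Rightarrow> ('w \<Rightarrow> 'b::ord) set \<Rightarrow> ('w \<Rightarrow> 'b) set \<Rightarrow> bool" where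
  "L0_le G X Y \<longleftrightarrow> (AE w in G. L0_rep X w \<le> L0_rep Y w)"

definition L0_nonneg :: "'w measure \<Rightarrow> ('w \<Rightarrow> real) set set" where
  "L0_nonneg G = {X \<in> L0 G. L0_le G (L0_class G (\<lambda>w. 0)) X}"

definition L0_abs :: "'w measure \<Rightarrow> ('w \<Rightarrow> 'k::real_normed_field) set \<Rightarrow> ('w \<Rightarrow> real) set" where
  "L0_abs G X = L0_class G (\<lambda>w. norm (L0_rep X w))"

definition L0_ext_lattice :: "'w measure \<Rightarrow> ('w \<Rightarrow> ereal) set gorder" where
  "L0_ext_lattice G = \<lparr>carrier = L0 G, eq = (=), le = L0_le G\<rparr>"

text \<open>The infimum of a set of real-valued classes is formed in the complete lattice of
  extended-real-valued classes. The result is read back as a real-valued class, which loses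
  nothing when the infimum is finite almost surely, as it is for a nonempty set of nonnegative
  classes.\<close>

definition L0_Inf :: "'w measure \<Rightarrow> ('w \<Rightarrow> real) set set \<Rightarrow> ('w \<Rightarrow> real) set" where
  "L0_Inf G A = L0_class G (\<lambda>w. real_of_ereal (L0_rep
     (Lattice.inf (L0_ext_lattice G) ((\<lambda>X. L0_class G (\<lambda>w. ereal (L0_rep X w))) ` A)) w))"


section \<open>Random normed modules\<close>

text \<open>The scalar field \<open>K\<close>, real or complex, is rendered by the sort
  \<open>{real_normed_field, euclidean_space}\<close>. Both \<^typ>\<open>real\<close> and \<^typ>\<open>complex\<close> have this sort, and
  by Frobenius's theorem every type of this sort is isomorphic, as a normed field, to one of them.\<close>

text \<open>The fields \<^const>\<open>monoid.mult\<close> and \<^const>\<open>one\<close> that a module record inherits from the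
  ring record play no role.\<close>

record ('w, 'k, 'a) rn_module = "(('w \<Rightarrow> 'k) set, 'a) module" +
  rnorm :: "'a \<Rightarrow> ('w \<Rightarrow> real) set"

locale random_normed_module =
  prob_space G + Module.module "L0_ring G" S
  for G :: "'w measure" and S :: "('w, 'k::{real_normed_field, euclidean_space}, 'a) rn_module"
    (structure) +
  assumes rnorm_nonneg: "x \<in> carrier S \<Longrightarrow> rnorm S x \<in> L0_nonneg G"
    and rnorm_smult: "\<lbrakk>\<xi> \<in> L0 G; x \<in> carrier S\<rbrakk> \<Longrightarrow>
      rnorm S (\<xi> \<odot>\<^bsub>S\<^esub> x) = L0_abs G \<xi> \<otimes>\<^bsub>L0_ring G\<^esub> rnorm S x"
    and rnorm_triangle: "\<lbrakk>x \<in> carrier S; y \<in> carrier S\<rbrakk> \<Longrightarrow>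
      L0_le G (rnorm S (x \<oplus>\<^bsub>S\<^esub> y)) (rnorm S x \<oplus>\<^bsub>L0_ring G\<^esub> rnorm S y)"
    and rnorm_eq_zero_iff: "x \<in> carrier S \<Longrightarrow>
      rnorm S x = \<zero>\<^bsub>L0_ring G\<^esub> \<longleftrightarrow> x = \<zero>\<^bsub>S\<^esub>"

definition random_bounds ::
    "'w measure \<Rightarrow> ('w, 'k::real_normed_field, 'a) rn_module \<Rightarrow> ('a \<Rightarrow> ('w \<Rightarrow> 'k) set) \<Rightarrow>
     ('w \<Rightarrow> real) set set" where
  "random_bounds G S f = {\<xi> \<in> L0_nonneg G. \<forall>x \<in> carrier S.
     L0_le G (L0_abs G (f x)) (\<xi> \<otimes>\<^bsub>L0_ring G\<^esub> rnorm S x)}"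

text \<open>Functionals on a carrier set are extensional functions, so that equality of functionals is
  equality on the carrier.\<close>

definition random_conjugate ::
    "'w measure \<Rightarrow> ('w, 'k::real_normed_field, 'a) rn_module \<Rightarrow>
     ('w, 'k, 'a \<Rightarrow> ('w \<Rightarrow> 'k) set) rn_module" where
  "random_conjugate G S =
    \<lparr>carrier = {f \<in> carrier S \<rightarrow>\<^sub>E L0 G.
        (\<forall>x \<in> carrier S. \<forall>y \<in> carrier S. f (x \<oplus>\<^bsub>S\<^esub> y) = f x \<oplus>\<^bsub>L0_ring G\<^esub> f y) \<and>
        (\<forall>\<xi> \<in> L0 G. \<forall>x \<in> carrier S. f (\<xi> \<odot>\<^bsub>S\<^esub> x) = \<xi> \<otimes>\<^bsub>L0_ring G\<^esub> f x) \<and>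
        random_bounds G S f \<noteq> {}},
     monoid.mult = undefined,
     one = undefined,
     zero = (\<lambda>x \<in> carrier S. \<zero>\<^bsub>L0_ring G\<^esub>),
     add = (\<lambda>f g. \<lambda>x \<in> carrier S. f x \<oplus>\<^bsub>L0_ring G\<^esub> g x),
     smult = (\<lambda>\<xi> f. \<lambda>x \<in> carrier S. \<xi> \<otimes>\<^bsub>L0_ring G\<^esub> f x),
     rnorm = (\<lambda>f. L0_Inf G (random_bounds G S f))\<rparr>"

definition random_embedding ::
    "'w measure \<Rightarrow> ('w, 'k::real_normed_field, 'a) rn_module \<Rightarrow> 'a \<Rightarrow>
     ('a \<Rightarrow> ('w \<Rightarrow> 'k) set) \<Rightarrow> ('w \<Rightarrow> 'k) set" where
  "random_embedding G S x = (\<lambda>f \<in> carrier (random_conjugate G S). f x)"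

definition random_reflexive ::
    "'w measure \<Rightarrow> ('w, 'k::{real_normed_field, euclidean_space}, 'a) rn_module \<Rightarrow> bool" where
  "random_reflexive G S \<longleftrightarrow> random_normed_module G S \<and>
     random_embedding G S ` carrier S = carrier (random_conjugate G (random_conjugate G S))"


section \<open>Normed spaces on a carrier set\<close>

definition scalar_ring :: "'k::real_normed_field ring" where
  "scalar_ring = \<lparr>carrier = UNIV, monoid.mult = (*), one = 1, zero = 0, add = (+)\<rparr>"

record ('k, 'a) n_space = "('k, 'a) module" +
  nnorm :: "'a \<Rightarrow> real"

locale normed_space =
  Module.module "scalar_ring :: 'k ring" X
  for X :: "('k::{real_normed_field, euclidean_space}, 'a) n_space" (structure) +
  assumes nnorm_nonneg: "x \<in> carrier X \<Longrightarrow> 0 \<le> nnorm X x"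
    and nnorm_smult: "x \<in> carrier X \<Longrightarrow> nnorm X (c \<odot>\<^bsub>X\<^esub> x) = norm c * nnorm X x"
    and nnorm_triangle: "\<lbrakk>x \<in> carrier X; y \<in> carrier X\<rbrakk> \<Longrightarrow>
      nnorm X (x \<oplus>\<^bsub>X\<^esub> y) \<le> nnorm X x + nnorm X y"
    and nnorm_eq_zero_iff: "x \<in> carrier X \<Longrightarrow> nnorm X x = 0 \<longleftrightarrow> x = \<zero>\<^bsub>X\<^esub>"

text \<open>The locale \<^locale>\<open>Metric_space\<close> asks for a distance that is symmetric and nonnegative on the
  whole type, hence the value 0 off the carrier.\<close>

definition ndist :: "('k, 'a) n_space \<Rightarrow> 'a \<Rightarrow> 'a \<Rightarrow> real" where
  "ndist X x y = (if x \<in> carrier X \<and> y \<in> carrier X then nnorm X (x \<ominus>\<^bsub>X\<^esub> y) else 0)"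

locale banach_space = normed_space +
  assumes complete: "Metric_space.mcomplete (carrier X) (ndist X)"

definition conjugate_space ::
    "('k::real_normed_field, 'a) n_space \<Rightarrow> ('k, 'a \<Rightarrow> 'k) n_space" where
  "conjugate_space X =
    \<lparr>carrier = {f \<in> extensional (carrier X).
        (\<forall>x \<in> carrier X. \<forall>y \<in> carrier X. f (x \<oplus>\<^bsub>X\<^esub> y) = f x + f y) \<and>
        (\<forall>c. \<forall>x \<in> carrier X. f (c \<odot>\<^bsub>X\<^esub> x) = c * f x) \<and>
        (\<exists>C. \<forall>x \<in> carrier X. norm (f x) \<le> C * nnorm X x)},
     monoid.mult = undefined,
     one = undefined,
     zero = (\<lambda>x \<in> carrier X. 0),
     add = (\<lambda>f g. \<lambda>x \<in> carrier X. f x + g x),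
     smult = (\<lambda>c f. \<lambda>x \<in> carrier X. c * f x),
     nnorm = (\<lambda>f. SUP x \<in> {x \<in> carrier X. nnorm X x \<le> 1}. norm (f x))\<rparr>"

definition canonical_embedding ::
    "('k::real_normed_field, 'a) n_space \<Rightarrow> 'a \<Rightarrow> ('a \<Rightarrow> 'k) \<Rightarrow> 'k" where
  "canonical_embedding X x = (\<lambda>f \<in> carrier (conjugate_space X). f x)"

definition reflexive_banach_space ::
    "('k::{real_normed_field, euclidean_space}, 'a) n_space \<Rightarrow> bool" where
  "reflexive_banach_space X \<longleftrightarrow> banach_space X \<and>
     canonical_embedding X ` carrier X = carrier (conjugate_space (conjugate_space X))"


section \<open>The spaces generated by a random normed module\<close>

definition ennreal_powr :: "ennreal \<Rightarrow> real \<Rightarrow> ennreal" where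
  "ennreal_powr t a = (if t = \<top> then \<top> else ennreal (enn2real t powr a))"

definition Lp_norm ::
    "'w measure \<Rightarrow> real \<Rightarrow> ('w, 'k, 'a) rn_module \<Rightarrow> 'a \<Rightarrow> ennreal" where
  "Lp_norm M p S x =
     ennreal_powr (\<integral>\<^sup>+ w. ennreal (L0_rep (rnorm S x) w powr p) \<partial>M) (1 / p)"

definition Lp_space ::
    "'w measure \<Rightarrow> real \<Rightarrow> ('w, 'k::real_normed_field, 'a) rn_module \<Rightarrow> ('k, 'a) n_space" where
  "Lp_space M p S =
    \<lparr>carrier = {x \<in> carrier S. Lp_norm M p S x < \<top>},
     monoid.mult = undefined,
     one = undefined,
     zero = \<zero>\<^bsub>S\<^esub>,
     add = (\<lambda>x y. x \<oplus>\<^bsub>S\<^esub> y),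
     smult = (\<lambda>c x. L0_class M (\<lambda>w. c) \<odot>\<^bsub>S\<^esub> x),
     nnorm = (\<lambda>x. enn2real (Lp_norm M p S x))\<rparr>"

definition cond_Lp_norm ::
    "'w measure \<Rightarrow> 'w measure \<Rightarrow> real \<Rightarrow> ('w, 'k, 'a) rn_module \<Rightarrow> 'a \<Rightarrow> 'w \<Rightarrow> ennreal" where
  "cond_Lp_norm M F p S x w =
     ennreal_powr (nn_cond_exp M F (\<lambda>v. ennreal (L0_rep (rnorm S x) v powr p)) w) (1 / p)"

text \<open>The base of the following module is \<open>restr_to_subalg M F\<close>, that is, the probability of \<open>M\<close>
  restricted to the sub-\<open>\<sigma>\<close>-algebra. A class of \<open>F\<close>-measurable functions acts on the given module
  through the larger class, with respect to \<open>M\<close>, of any of its members.\<close>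

definition cond_Lp_module ::
    "'w measure \<Rightarrow> 'w measure \<Rightarrow> real \<Rightarrow> ('w, 'k::real_normed_field, 'a) rn_module \<Rightarrow>
     ('w, 'k, 'a) rn_module" where
  "cond_Lp_module M F p S =
    \<lparr>carrier = {x \<in> carrier S. AE w in restr_to_subalg M F. cond_Lp_norm M F p S x w < \<top>},
     monoid.mult = undefined,
     one = undefined,
     zero = \<zero>\<^bsub>S\<^esub>,
     add = (\<lambda>x y. x \<oplus>\<^bsub>S\<^esub> y),
     smult = (\<lambda>\<xi> x. L0_class M (L0_rep \<xi>) \<odot>\<^bsub>S\<^esub> x),
     rnorm = (\<lambda>x. L0_class (restr_to_subalg M F) (\<lambda>w. enn2real (cond_Lp_norm M F p S x w)))\<rparr>"

end

theory Submission
  imports Defs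
begin

text \<open>The dual of \<open>L\<^sup>p(S)\<close> is \<open>L\<^sup>q(S\<^sup>*)\<close> with \<open>1/p + 1/q = 1\<close>. A bounded functional \<open>\<phi>\<close> on \<open>L\<^sup>p(S)\<close>
  yields for each \<open>x\<close> the set function \<open>A \<mapsto> \<phi>(1\<^sub>A x)\<close>, whose density \<open>f(x)\<close> depends on \<open>x\<close> as a module
  homomorphism. The essential supremum of \<open>|f(x)|\<close> over \<open>\<parallel>x\<parallel> \<le> 1\<close> bounds \<open>f\<close>, and testing with powers
  of its truncations gives \<open>\<parallel>f\<parallel>\<^sub>q \<le> \<parallel>\<phi>\<parallel>\<close>.

  If \<open>S\<close> is random reflexive, this representation for \<open>S\<^sup>*\<close> and \<open>q\<close> turns an element of the bidual of
  \<open>L\<^sup>p(S)\<close> into an element of \<open>S\<^sup>*\<^sup>*\<close>, hence into some \<open>x\<close> in \<open>S\<close>; the Hahn-Banach theorem in \<open>L\<^sup>p(S)\<close>,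
  applied to truncations of \<open>x\<close>, shows that \<open>x\<close> is in \<open>L\<^sup>p(S)\<close>. Completeness of \<open>L\<^sup>p(S)\<close> is a consequence of
  the surjectivity of the canonical embedding. Conversely, \<open>F\<close> in \<open>S\<^sup>*\<^sup>*\<close> divided by \<open>1 + \<parallel>F\<parallel>\<close> and
  integrated is an element of the bidual of \<open>L\<^sup>p(S)\<close>, and the point that represents it, multiplied by
  \<open>1 + \<parallel>F\<parallel>\<close>, represents \<open>F\<close>.

  The equivalence with (3) is the same theorem for the module \<open>L\<^sup>p\<^sub>F(S)\<close>: since
  \<open>E[E[\<parallel>x\<parallel>\<^sup>p | F]] = E[\<parallel>x\<parallel>\<^sup>p]\<close>, its \<open>L\<^sup>p\<close> space is \<open>L\<^sup>p(S)\<close>.\<close>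

section \<open>Classes and representatives\<close>

text \<open>Every law holds only off a null set depending on its arguments, so uncountable families
  of inequalities cannot be intersected. A bound uniform in \<open>x\<close> is therefore reached
  along a sequence in a directed family: bounds are directed because minima of bounds are bounds,
  moduli of densities because elements of a module can be glued along measurable sets. The
  multiplier \<open>1 / (1 + ...)\<close> recurs for one reason: the measure is a probability, so
  anything of bounded norm lies in every \<open>L^p\<close>. A functional on \<open>L^p(S)\<close>
  sees a general \<open>x\<close> only through multiples made bounded in this way, and an identity
  of integrals over all such multiples gives back an identity almost surely. Likewise, dividing an
  element of the second conjugate by 1 plus its norm yields a pairing that integrates to a
  functional of norm at most 1. Truncation in the norm estimate is forced: the argument cancels a
  power of an integral against the integral itself, which must be finite. The representation enters
  as a bijection with two one-sided norm estimates.\<close>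

lemma L0_rel_iff:
  "(f, g) \<in> L0_rel G \<longleftrightarrow> f \<in> borel_measurable G \<and> g \<in> borel_measurable G \<and> (AE w in G. f w = g w)"
  by (simp add: L0_rel_def)

lemma equiv_L0_rel: "equiv (borel_measurable G) (L0_rel G)"
proof (rule equivI)
  show "L0_rel G \<subseteq> borel_measurable G \<times> borel_measurable G"
    by (auto simp: L0_rel_def)
  show "refl_on (borel_measurable G) (L0_rel G)"
    by (auto simp: refl_on_def L0_rel_def)
  show "sym (L0_rel G)"
    by (auto simp: sym_def L0_rel_def elim: AE_mp)
  show "trans (L0_rel G)"
  proof (rule transI)
    fix x y z assume "(x, y) \<in> L0_rel G" "(y, z) \<in> L0_rel G"
    moreover from this have "AE w in G. x w = y w" "AE w in G. y w = z w"
      by (simp_all add: L0_rel_iff)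
    then have "AE w in G. x w = z w" by eventually_elim simp
    ultimately show "(x, z) \<in> L0_rel G" by (simp add: L0_rel_iff)
  qed
qed

lemma L0_class_in_L0 [simp]: "f \<in> borel_measurable G \<Longrightarrow> L0_class G f \<in> L0 G"
  by (simp add: L0_class_def L0_def quotientI)

lemma L0_rep_mem: "X \<in> L0 G \<Longrightarrow> L0_rep X \<in> X"
  unfolding L0_rep_def L0_def
  by (metis equiv_L0_rel equiv_Eps_in)

lemma L0_class_rep [simp]: "X \<in> L0 G \<Longrightarrow> L0_class G (L0_rep X) = X"
  using L0_rep_mem unfolding L0_def L0_class_def
  by (metis equiv_L0_rel Image_singleton_iff equiv_class_eq quotientE)

text \<open>A class contains measurable functions only, so the arbitrary choice in
  \<open>L0_rep\<close> is harmless.\<close>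

lemma L0_rep_measurable [measurable_dest, simp]: "X \<in> L0 G \<Longrightarrow> L0_rep X \<in> borel_measurable G"
  using L0_rep_mem unfolding L0_def
  by (metis in_quotient_imp_subset equiv_L0_rel subset_iff)

lemma L0_rep_class_measurable [measurable (raw)]:
  "f \<in> borel_measurable G \<Longrightarrow> L0_rep (L0_class G f) \<in> borel_measurable G"
  by simp

text \<open>Forming a class and choosing a representative returns the function up to a null set. All
  computation with classes passes through this fact.\<close>

lemma AE_L0_rep_class: "f \<in> borel_measurable G \<Longrightarrow> AE w in G. L0_rep (L0_class G f) w = f w"
  using L0_rep_mem[OF L0_class_in_L0, of f G] unfolding L0_class_def
  by (auto simp: L0_rel_def elim: AE_mp)

lemma L0_class_eq_iff:
  "f \<in> borel_measurable G \<Longrightarrow> g \<in> borel_measurable G \<Longrightarrow>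
    L0_class G f = L0_class G g \<longleftrightarrow> (AE w in G. f w = g w)"
  unfolding L0_class_def by (simp add: eq_equiv_class_iff[OF equiv_L0_rel] L0_rel_iff)

lemma L0_class_cong:
  "f \<in> borel_measurable G \<Longrightarrow> g \<in> borel_measurable G \<Longrightarrow> (AE w in G. f w = g w) \<Longrightarrow>
    L0_class G f = L0_class G g"
  by (simp add: L0_class_eq_iff)

lemma L0_eqI:
  assumes "X \<in> L0 G" "Y \<in> L0 G" "AE w in G. L0_rep X w = L0_rep Y w"
  shows "X = Y"
  using L0_class_eq_iff[of "L0_rep X" G "L0_rep Y"] assms by simp

lemma L0_eq_classI:
  assumes "X \<in> L0 G" "f \<in> borel_measurable G" "AE w in G. L0_rep X w = f w"
  shows "X = L0_class G f"
  using L0_class_eq_iff[of "L0_rep X" G f] assms by simp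

lemma L0_le_class_iff:
  fixes f g :: "'w \<Rightarrow> 'b::{topological_space, ord}"
  assumes "f \<in> borel_measurable G" "g \<in> borel_measurable G"
  shows "L0_le G (L0_class G f) (L0_class G g) \<longleftrightarrow> (AE w in G. f w \<le> g w)"
proof -
  have *: "AE w in G. L0_rep (L0_class G f) w = f w \<and> L0_rep (L0_class G g) w = g w"
    using AE_L0_rep_class[OF assms(1)] AE_L0_rep_class[OF assms(2)] by eventually_elim simp
  show ?thesis
    unfolding L0_le_def using * by (intro eventually_cong) auto
qed

lemma carrier_L0_ring [simp]: "carrier (L0_ring G) = L0 G"
  and zero_L0_ring: "\<zero>\<^bsub>L0_ring G\<^esub> = L0_class G (\<lambda>w. 0)"
  and one_L0_ring: "\<one>\<^bsub>L0_ring G\<^esub> = L0_class G (\<lambda>w. 1)"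
  by (simp_all add: L0_ring_def)

lemma L0_abs_class: 
  fixes f :: "'w \<Rightarrow> 'k::real_normed_field"
  assumes [measurable]: "f \<in> borel_measurable G"
  shows "L0_abs G (L0_class G f) = L0_class G (\<lambda>w. norm (f w))"
proof -
  have "AE w in G. norm (L0_rep (L0_class G f) w) = norm (f w)"
    using AE_L0_rep_class[OF assms] by eventually_elim simp
  then show ?thesis
    unfolding L0_abs_def using assms
    by (intro L0_class_cong borel_measurable_norm L0_rep_measurable) auto
qed

lemma L0_nonneg_iff: "X \<in> L0_nonneg G \<longleftrightarrow> X \<in> L0 G \<and> (AE w in G. 0 \<le> L0_rep X w)"
proof -
  have "L0_le G (L0_class G (\<lambda>w. 0)) X \<longleftrightarrow> (AE w in G. 0 \<le> L0_rep X w)" if "X \<in> L0 G"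
    using L0_le_class_iff[of "\<lambda>_. 0" G "L0_rep X"] that by simp
  then show ?thesis by (auto simp: L0_nonneg_def)
qed

lemma L0_class_nonneg_iff:
  "f \<in> borel_measurable G \<Longrightarrow> L0_class G f \<in> L0_nonneg G \<longleftrightarrow> (AE w in G. 0 \<le> f w)"
  unfolding L0_nonneg_def using L0_le_class_iff[of "\<lambda>_. 0" G f] by simp

context
  fixes G :: "'w measure"
begin

lemma L0_add_class:
  fixes f g :: "'w \<Rightarrow> 'k::{real_normed_field, second_countable_topology}"
  assumes [measurable]: "f \<in> borel_measurable G" "g \<in> borel_measurable G"
  shows "L0_class G f \<oplus>\<^bsub>L0_ring G\<^esub> L0_class G g = L0_class G (\<lambda>w. f w + g w)"
proof -
  have "AE w in G. L0_rep (L0_class G f) w + L0_rep (L0_class G g) w = f w + g w"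
    using AE_L0_rep_class[OF assms(1)] AE_L0_rep_class[OF assms(2)] by eventually_elim simp
  then show ?thesis
    unfolding L0_ring_def by (simp, intro L0_class_cong) auto
qed

lemma L0_mult_class:
  fixes f g :: "'w \<Rightarrow> 'k::{real_normed_field, second_countable_topology}"
  assumes [measurable]: "f \<in> borel_measurable G" "g \<in> borel_measurable G"
  shows "L0_class G f \<otimes>\<^bsub>L0_ring G\<^esub> L0_class G g = L0_class G (\<lambda>w. f w * g w)"
proof -
  have "AE w in G. L0_rep (L0_class G f) w * L0_rep (L0_class G g) w = f w * g w"
    using AE_L0_rep_class[OF assms(1)] AE_L0_rep_class[OF assms(2)] by eventually_elim simp
  then show ?thesis
    unfolding L0_ring_def by (simp, intro L0_class_cong) auto
qed

end

lemma L0_cases: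
  assumes "X \<in> L0 G"
  obtains f where "f \<in> borel_measurable G" "X = L0_class G f"
  using assms L0_class_rep L0_rep_measurable by metis

lemma cring_L0_ring:
  "cring (L0_ring G :: ('w \<Rightarrow> 'k::{real_normed_field, second_countable_topology}) set ring)"
  (is "cring ?R")
proof (rule cringI)
  have add: "x \<oplus>\<^bsub>?R\<^esub> y \<in> carrier ?R" if "x \<in> carrier ?R" "y \<in> carrier ?R" for x y
    using that by (auto elim!: L0_cases simp: L0_add_class)
  have mult: "x \<otimes>\<^bsub>?R\<^esub> y \<in> carrier ?R" if "x \<in> carrier ?R" "y \<in> carrier ?R" for x y
    using that by (auto elim!: L0_cases simp: L0_mult_class)
  show "abelian_group ?R"
  proof (rule abelian_groupI)
    fix x assume "x \<in> carrier ?R"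
    then obtain f where [measurable]: "f \<in> borel_measurable G" and x: "x = L0_class G f"
      by (auto elim: L0_cases)
    show "\<exists>y\<in>carrier ?R. y \<oplus>\<^bsub>?R\<^esub> x = \<zero>\<^bsub>?R\<^esub>"
      by (rule bexI[of _ "L0_class G (\<lambda>w. - f w)"]) (auto simp: x L0_add_class zero_L0_ring)
  qed (auto simp: add zero_L0_ring L0_add_class ac_simps elim!: L0_cases)
  show "comm_monoid ?R"
    by (rule comm_monoidI)
       (auto simp: mult one_L0_ring L0_mult_class ac_simps elim!: L0_cases)
  show "(x \<oplus>\<^bsub>?R\<^esub> y) \<otimes>\<^bsub>?R\<^esub> z = x \<otimes>\<^bsub>?R\<^esub> z \<oplus>\<^bsub>?R\<^esub> y \<otimes>\<^bsub>?R\<^esub> z"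
    if "x \<in> carrier ?R" "y \<in> carrier ?R" "z \<in> carrier ?R" for x y z
    using that by (auto elim!: L0_cases simp: L0_mult_class L0_add_class distrib_right)
qed

lemma AE_L0_rep_add:
  fixes X Y :: "('w \<Rightarrow> 'k::{real_normed_field, second_countable_topology}) set"
  assumes "X \<in> L0 G" "Y \<in> L0 G"
  shows "AE w in G. L0_rep (X \<oplus>\<^bsub>L0_ring G\<^esub> Y) w = L0_rep X w + L0_rep Y w"
  using AE_L0_rep_class[of "\<lambda>w. L0_rep X w + L0_rep Y w" G] assms by (simp add: L0_ring_def)

lemma AE_L0_rep_mult:
  fixes X Y :: "('w \<Rightarrow> 'k::{real_normed_field, second_countable_topology}) set"
  assumes "X \<in> L0 G" "Y \<in> L0 G"
  shows "AE w in G. L0_rep (X \<otimes>\<^bsub>L0_ring G\<^esub> Y) w = L0_rep X w * L0_rep Y w"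
  using AE_L0_rep_class[of "\<lambda>w. L0_rep X w * L0_rep Y w" G] assms by (simp add: L0_ring_def)

lemma L0_add_closed [simp]:
  fixes X Y :: "('w \<Rightarrow> 'k::{real_normed_field, second_countable_topology}) set"
  assumes "X \<in> L0 G" "Y \<in> L0 G"
  shows "X \<oplus>\<^bsub>L0_ring G\<^esub> Y \<in> L0 G" "X \<otimes>\<^bsub>L0_ring G\<^esub> Y \<in> L0 G"
  using assms by (auto elim!: L0_cases simp: L0_add_class L0_mult_class)

section \<open>Random normed modules, in terms of representatives\<close>

context random_normed_module
begin

text \<open>The representative is an arbitrary choice, so \<open>N x\<close> is nonnegative almost
  everywhere but possibly negative on a null set. This is why \<open>\<bar>N x w\<bar>\<close>
  appears wherever a sign is needed at every point.\<close>

definition N :: "'a \<Rightarrow> 'w \<Rightarrow> real" where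
  "N x = L0_rep (rnorm S x)"

definition sm :: "('w \<Rightarrow> 'k) \<Rightarrow> 'a \<Rightarrow> 'a" where
  "sm a x = L0_class G a \<odot> x"

lemma rnorm_L0: "x \<in> carrier S \<Longrightarrow> rnorm S x \<in> L0 G"
  using rnorm_nonneg by (auto simp: L0_nonneg_iff)

lemma N_measurable [measurable_dest, simp]: "x \<in> carrier S \<Longrightarrow> N x \<in> borel_measurable G"
  unfolding N_def using rnorm_L0 by simp

lemma rnorm_eq_class: "x \<in> carrier S \<Longrightarrow> rnorm S x = L0_class G (N x)"
  unfolding N_def using rnorm_L0 by simp

lemma AE_N_nonneg: "x \<in> carrier S \<Longrightarrow> AE w in G. 0 \<le> N x w"
  using rnorm_nonneg by (auto simp: L0_nonneg_iff N_def)

lemma AE_N_add: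
  assumes "x \<in> carrier S" "y \<in> carrier S"
  shows "AE w in G. N (x \<oplus> y) w \<le> N x w + N y w"
proof -
  have "AE w in G. N (x \<oplus> y) w \<le> L0_rep (rnorm S x \<oplus>\<^bsub>L0_ring G\<^esub> rnorm S y) w"
    using rnorm_triangle[OF assms] unfolding L0_le_def N_def .
  moreover have "AE w in G. L0_rep (rnorm S x \<oplus>\<^bsub>L0_ring G\<^esub> rnorm S y) w = N x w + N y w"
    unfolding N_def by (rule AE_L0_rep_add) (simp_all add: rnorm_L0 assms)
  ultimately show ?thesis by eventually_elim simp
qed

lemma sm_closed [simp]:
  "a \<in> borel_measurable G \<Longrightarrow> x \<in> carrier S \<Longrightarrow> sm a x \<in> carrier S"
  unfolding sm_def by simp

lemma AE_N_sm:
  assumes [measurable]: "a \<in> borel_measurable G" and x: "x \<in> carrier S"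
  shows "AE w in G. N (sm a x) w = norm (a w) * N x w"
proof -
  have "rnorm S (sm a x) = L0_class G (\<lambda>w. norm (a w)) \<otimes>\<^bsub>L0_ring G\<^esub> L0_class G (N x)"
    using rnorm_smult[of "L0_class G a" x] x
    unfolding sm_def by (simp add: L0_abs_class rnorm_eq_class[OF x])
  also have "\<dots> = L0_class G (\<lambda>w. norm (a w) * N x w)"
    using x by (intro L0_mult_class) auto
  finally show ?thesis
    unfolding N_def[of "sm a x"] using x by (auto intro!: AE_L0_rep_class)
qed

lemma AE_N_eq_0_iff: "x \<in> carrier S \<Longrightarrow> (AE w in G. N x w = 0) \<longleftrightarrow> x = \<zero>"
  using rnorm_eq_zero_iff[of x] by (simp add: rnorm_eq_class zero_L0_ring L0_class_eq_iff)

lemma sm_cong: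
  assumes "a \<in> borel_measurable G" "b \<in> borel_measurable G" "AE w in G. a w = b w"
  shows "sm a x = sm b x"
  unfolding sm_def using L0_class_cong[OF assms] by simp

lemma sm_add:
  "a \<in> borel_measurable G \<Longrightarrow> b \<in> borel_measurable G \<Longrightarrow> x \<in> carrier S \<Longrightarrow>
    sm (\<lambda>w. a w + b w) x = sm a x \<oplus> sm b x"
  unfolding sm_def by (simp add: smult_l_distr[symmetric] L0_add_class)

lemma sm_mult:
  "a \<in> borel_measurable G \<Longrightarrow> b \<in> borel_measurable G \<Longrightarrow> x \<in> carrier S \<Longrightarrow>
    sm a (sm b x) = sm (\<lambda>w. a w * b w) x"
  unfolding sm_def by (simp add: smult_assoc1[symmetric] L0_mult_class)

lemma sm_add_right:
  "a \<in> borel_measurable G \<Longrightarrow> x \<in> carrier S \<Longrightarrow> y \<in> carrier S \<Longrightarrow>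
    sm a (x \<oplus> y) = sm a x \<oplus> sm a y"
  unfolding sm_def by (simp add: smult_r_distr)

lemma sm_one [simp]: "x \<in> carrier S \<Longrightarrow> sm (\<lambda>_. 1) x = x"
  unfolding sm_def by (simp add: one_L0_ring[symmetric])

lemma sm_zero_left [simp]: "x \<in> carrier S \<Longrightarrow> sm (\<lambda>_. 0) x = \<zero>"
  unfolding sm_def by (simp add: zero_L0_ring[symmetric])

text \<open>The random norm of \<open>sm (\<lambda>w. a w - b w) x\<close> is
  \<open>norm (a w - b w)\<close> times \<open>N x w\<close>, which vanishes almost surely.\<close>

lemma sm_cong_support:
  assumes [measurable]: "a \<in> borel_measurable G" "b \<in> borel_measurable G" and x: "x \<in> carrier S"
    and eq: "AE w in G. N x w \<noteq> 0 \<longrightarrow> a w = b w"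
  shows "sm a x = sm b x"
proof -
  have "sm (\<lambda>w. a w - b w) x = \<zero>"
  proof -
    have "AE w in G. N (sm (\<lambda>w. a w - b w) x) w = 0"
      using AE_N_sm[OF borel_measurable_diff[OF assms(1,2)] x] eq by eventually_elim auto
    then show ?thesis using x by (simp add: AE_N_eq_0_iff)
  qed
  moreover have "sm a x = sm (\<lambda>w. b w + (a w - b w)) x"
    by simp
  moreover have "sm (\<lambda>w. b w + (a w - b w)) x = sm b x \<oplus> sm (\<lambda>w. a w - b w) x"
    using x by (intro sm_add) auto
  ultimately show ?thesis using x by simp
qed

end

section \<open>Essential suprema and infima\<close>

text \<open>Exhaustion. A sequence in \<open>A\<close> whose integrals approach their supremum is
  made increasing with the help of \<open>dir\<close>, and its limit then attains that supremum. A
  member of \<open>A\<close> exceeding the limit on a set of positive measure would produce a larger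
  integral.\<close>

lemma directed_ess_sup:
  fixes A :: "('w \<Rightarrow> ennreal) set"
  assumes ne: "A \<noteq> {}" and meas: "\<And>g. g \<in> A \<Longrightarrow> g \<in> borel_measurable M"
    and bd: "\<And>g. g \<in> A \<Longrightarrow> (\<integral>\<^sup>+w. g w \<partial>M) \<le> ennreal c"
    and dir: "\<And>g h. g \<in> A \<Longrightarrow> h \<in> A \<Longrightarrow> \<exists>k\<in>A. AE w in M. k w = max (g w) (h w)"
  obtains s :: "nat \<Rightarrow> 'w \<Rightarrow> ennreal" where "\<forall>n. s n \<in> A" "AE w in M. incseq (\<lambda>n. s n w)"
    "\<forall>g\<in>A. AE w in M. g w \<le> (SUP n. s n w)" "(\<integral>\<^sup>+w. (SUP n. s n w) \<partial>M) \<le> ennreal c"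
proof -
  define I where "I = (\<lambda>g. \<integral>\<^sup>+w. g w \<partial>M)"
  obtain F :: "nat \<Rightarrow> ennreal" where F: "range F \<subseteq> I ` A" "Sup (I ` A) = Sup (range F)"
    using ennreal_SUP_countable_SUP[OF ne, of I] by (elim exE conjE)
  have "\<exists>g. g \<in> A \<and> F n = I g" for n
  proof -
    have "F n \<in> I ` A" using F(1) by (rule subsetD) (rule rangeI)
    then show ?thesis by (rule imageE) (intro exI conjI)
  qed
  then have "\<forall>n. \<exists>g. g \<in> A \<and> F n = I g" by (rule allI)
  then obtain g where "\<forall>n. g n \<in> A \<and> F n = I (g n)" by (rule choice[THEN exE])
  then have g: "\<And>n. g n \<in> A" "\<And>n. F n = I (g n)" by simp_all
  \<comment> \<open>The new term absorbs the \<open>n\<close>-th near-maximiser, so the integrals of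
    \<open>s\<close> overtake all of \<open>F\<close> while \<open>s\<close> grows.\<close>
  have "\<exists>s. \<forall>n. s n \<in> A \<and> (AE w in M. s (Suc n) w = max (s n w) (g n w))"
  proof (rule dependent_nat_choice)
    show "\<exists>x. x \<in> A" using ne by auto
    fix x n assume "x \<in> A"
    from dir[OF this g(1)] show "\<exists>y. y \<in> A \<and> (AE w in M. y w = max (x w) (g n w))"
      unfolding Bex_def .
  qed
  then obtain s where sA: "\<And>n. s n \<in> A"
    and s: "\<And>n. AE w in M. s (Suc n) w = max (s n w) (g n w)" by auto
  note [measurable] = meas[OF sA]
  have smono: "AE w in M. s n w \<le> s (Suc n) w" for n
    using s[of n] by eventually_elim simp
  have sinc: "AE w in M. incseq (\<lambda>n. s n w)"
    using smono by (simp add: incseq_Suc_iff AE_all_countable)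
  have IS: "I (\<lambda>w. SUP n. s n w) = (SUP n. I (s n))"
    unfolding I_def by (rule nn_integral_monotone_convergence_SUP_AE) (auto simp: smono)
  have "Sup (I ` A) \<le> (SUP n. I (s n))"
    unfolding F(2)
  proof (rule SUP_least)
    fix n
    have "F n \<le> I (s (Suc n))"
      unfolding g(2) I_def by (rule nn_integral_mono_AE, use s[of n] in eventually_elim) simp
    then show "F n \<le> (SUP n. I (s n))" by (rule order_trans) (rule SUP_upper, simp)
  qed
  moreover have "I h \<le> Sup (I ` A)" if "h \<in> A" for h
    using that by (intro SUP_upper)
  ultimately have le: "I h \<le> I (\<lambda>w. SUP n. s n w)" if "h \<in> A" for h
    unfolding IS using that order_trans by blast
  have fin: "I (\<lambda>w. SUP n. s n w) \<le> ennreal c"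
    unfolding IS by (rule SUP_least) (simp add: I_def bd[OF sA])
  have "AE w in M. h w \<le> (SUP n. s n w)" if h: "h \<in> A" for h
  proof -
    note [measurable] = meas[OF h]
    have "\<forall>n. \<exists>k\<in>A. AE w in M. k w = max (h w) (s n w)"
      using dir[OF h sA] by (rule allI)
    then obtain k where kA: "\<And>n. k n \<in> A" and k: "\<And>n. AE w in M. k n w = max (h w) (s n w)"
      by metis
    note [measurable] = meas[OF kA]
    let ?\<xi> = "\<lambda>w. SUP n. s n w"
    \<comment> \<open>In \<open>ennreal\<close> the difference of two infinite values is infinite,
      so \<open>h w \<le> ?\<xi> w\<close> makes \<open>h w - ?\<xi> w\<close> zero only where
      \<open>h\<close> is finite.\<close>
    have hfin: "AE w in M. h w \<noteq> \<infinity>"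
      by (rule nn_integral_PInf_AE) (use bd[OF h] in \<open>auto simp: top_unique\<close>)
    have "AE w in M. \<forall>n. k n w = max (h w) (s n w)"
      using k by (simp add: AE_all_countable)
    then have max_eq: "AE w in M. (SUP n. k n w) = ?\<xi> w + (h w - ?\<xi> w)"
      using hfin
    proof eventually_elim
      case (elim w)
      have "(SUP n. k n w) = max (h w) (?\<xi> w)"
        using elim(1) by (simp add: sup_max[symmetric] SUP_sup_distrib[symmetric])
      also have "\<dots> = ?\<xi> w + (h w - ?\<xi> w)"
      proof (cases "h w \<le> ?\<xi> w")
        case True
        then have "h w - ?\<xi> w = 0" using elim(2) by (simp add: diff_eq_0_iff_ennreal less_top)
        with True show ?thesis by (simp add: max_absorb2)
      next
        case False
        then show ?thesis by (simp add: max_absorb1 add_diff_inverse_ennreal)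
      qed
      finally show ?case .
    qed
    \<comment> \<open>The functions \<open>k n\<close> are members of \<open>A\<close> increasing to
      the maximum of \<open>h\<close> and the limit, so the integral of this maximum is no larger
      than that of the limit. Cancelling the finite \<open>I ?\<xi>\<close> shows that the excess
      integrates to 0.\<close>
    have "I ?\<xi> + (\<integral>\<^sup>+w. (h w - ?\<xi> w) \<partial>M) = (\<integral>\<^sup>+w. ?\<xi> w + (h w - ?\<xi> w) \<partial>M)"
      unfolding I_def by (rule nn_integral_add[symmetric]) auto
    also have "\<dots> = (\<integral>\<^sup>+w. (SUP n. k n w) \<partial>M)"
      using max_eq by (intro nn_integral_cong_AE) auto
    also have "\<dots> = (SUP n. I (k n))"
      unfolding I_def
    proof (rule nn_integral_monotone_convergence_SUP_AE)
      show "AE w in M. k n w \<le> k (Suc n) w" for n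
        using k[of n] k[of "Suc n"] smono[of n] by eventually_elim (simp add: max.coboundedI2)
    qed auto
    also have "\<dots> \<le> I ?\<xi>" using le[OF kA] by (intro SUP_least)
    finally have "I ?\<xi> + (\<integral>\<^sup>+w. (h w - ?\<xi> w) \<partial>M) \<le> I ?\<xi> + 0" by simp
    moreover have "I ?\<xi> \<noteq> \<top>" using fin by (auto simp: top_unique)
    ultimately have "(\<integral>\<^sup>+w. (h w - ?\<xi> w) \<partial>M) = 0"
      by (simp add: ennreal_add_left_cancel_le)
    then have "AE w in M. h w - ?\<xi> w = 0" by (subst (asm) nn_integral_0_iff_AE) auto
    then show ?thesis by eventually_elim (simp add: diff_eq_0_iff_ennreal)
  qed
  then have "\<forall>h\<in>A. AE w in M. h w \<le> (SUP n. s n w)" by (rule ballI)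
  from that[OF allI[OF sA] sinc this fin[unfolded I_def]] show ?thesis .
qed

lemma L0_nonneg_rep:
  assumes "X \<in> L0_nonneg G"
  obtains r where "r \<in> borel_measurable G" "\<forall>w. 0 \<le> r w" "X = L0_class G r"
proof
  let ?r = "\<lambda>w. max 0 (L0_rep X w)"
  have X: "X \<in> L0 G" "AE w in G. 0 \<le> L0_rep X w" using assms by (auto simp: L0_nonneg_iff)
  show "?r \<in> borel_measurable G" using X(1) by simp
  show "X = L0_class G ?r"
    using X by (intro L0_eq_classI) (auto elim!: eventually_mono)
qed auto

lemma L0_le_antisym:
  fixes X Y :: "('w \<Rightarrow> 'b::{topological_space, order}) set"
  assumes "X \<in> L0 G" "Y \<in> L0 G" "L0_le G X Y" "L0_le G Y X"
  shows "X = Y"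
proof (rule L0_eqI[OF assms(1,2)])
  show "AE w in G. L0_rep X w = L0_rep Y w"
    using assms(3,4) unfolding L0_le_def by eventually_elim simp
qed

text \<open>Closure under countable infima makes the infimum a minimum. The decreasing map from
  \<open>r\<close> to \<open>1 / (1 + r)\<close> sends nonnegative functions to values at most 1, so
  that the total mass bounds all integrals and the essential supremum above becomes an essential
  infimum here.\<close>

lemma (in finite_measure) L0_Inf_least:
  assumes sub: "B \<subseteq> L0_nonneg M" and ne: "B \<noteq> {}"
    and cl: "\<And>r :: nat \<Rightarrow> 'a \<Rightarrow> real. (\<And>n. r n \<in> borel_measurable M) \<Longrightarrow> (\<And>n w. 0 \<le> r n w) \<Longrightarrow>
      (\<And>n. L0_class M (r n) \<in> B) \<Longrightarrow> L0_class M (\<lambda>w. INF n. r n w) \<in> B"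
  shows "L0_Inf M B \<in> B" "\<And>X. X \<in> B \<Longrightarrow> L0_le M (L0_Inf M B) X"
proof -
  define R where "R = {r \<in> borel_measurable M. (\<forall>w. 0 \<le> r w) \<and> L0_class M r \<in> B}"
  define T where "T = (\<lambda>(r::'a \<Rightarrow> real) w. ennreal (1 / (1 + r w)))"
  have bij: "1 / (1 + x) \<le> 1 / (1 + y) \<longleftrightarrow> y \<le> x" if "0 \<le> x" "0 \<le> y" for x y :: real
    using that by (auto simp: field_simps)
  have TT: "T u w \<le> T v w \<longleftrightarrow> v w \<le> u w" if "0 \<le> u w" "0 \<le> v w" for u v w
    using that bij[of "u w" "v w"] unfolding T_def by (subst ennreal_le_iff) auto
  have le1: "1 / (1 + x) \<le> 1" if "0 \<le> x" for x :: real
    using that by simp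
  have BR: "\<exists>r\<in>R. X = L0_class M r" if "X \<in> B" for X
  proof -
    have "X \<in> L0_nonneg M" using that sub by blast
    then obtain r where r: "r \<in> borel_measurable M" "\<forall>w. 0 \<le> r w" "X = L0_class M r"
      by (rule L0_nonneg_rep)
    then have "r \<in> R" using that unfolding R_def by blast
    with r(3) show ?thesis by blast
  qed
  obtain s where s: "\<forall>n. s n \<in> T ` R" "AE w in M. incseq (\<lambda>n. s n w)"
    "\<forall>g\<in>T ` R. AE w in M. g w \<le> (SUP n. s n w)"
    "(\<integral>\<^sup>+w. (SUP n. s n w) \<partial>M) \<le> ennreal (measure M (space M))"
  proof (rule directed_ess_sup[of "T ` R" M "measure M (space M)"])
    show "T ` R \<noteq> {}" using ne BR by auto
    show "g \<in> borel_measurable M" if "g \<in> T ` R" for g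
    proof -
      obtain r where [measurable]: "r \<in> borel_measurable M" and "g = T r"
        using \<open>g \<in> T ` R\<close> unfolding R_def by blast
      then show ?thesis unfolding T_def by simp
    qed
    show "(\<integral>\<^sup>+w. g w \<partial>M) \<le> ennreal (measure M (space M))" if g: "g \<in> T ` R" for g
    proof -
      have "(\<integral>\<^sup>+w. g w \<partial>M) \<le> (\<integral>\<^sup>+w. 1 \<partial>M)"
        using g by (intro nn_integral_mono) (auto simp: R_def T_def le1)
      then show ?thesis by (simp add: emeasure_eq_measure)
    qed
    show "\<exists>k\<in>T ` R. AE w in M. k w = max (g w) (h w)" if gh: "g \<in> T ` R" "h \<in> T ` R" for g h
    proof -
      obtain r r' where r: "r \<in> R" "r' \<in> R" "g = T r" "h = T r'" using gh by auto
      \<comment> \<open>The sequence \<open>r, r', r', ...\<close> has infimum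
        \<open>min r r'\<close>, so the closure hypothesis for sequences also gives
        directedness.\<close>
      define q where "q = (\<lambda>n::nat. if n = 0 then r else r')"
      have "range (\<lambda>n. q n w) = {r w, r' w}" for w
        by (auto simp: q_def image_iff)
      then have eq: "(INF n. q n w) = min (r w) (r' w)" for w
        by (simp add: inf_min cInf_insert)
      have "L0_class M (\<lambda>w. INF n. q n w) \<in> B"
        by (rule cl) (use r in \<open>auto simp: q_def R_def\<close>)
      then have "(\<lambda>w. min (r w) (r' w)) \<in> R"
        using r by (auto simp: R_def eq)
      moreover have "T (\<lambda>w. min (r w) (r' w)) w = max (g w) (h w)" for w
      proof -
        have "0 \<le> r w" "0 \<le> r' w" using r by (auto simp: R_def)
        then show ?thesis
          using TT[of r w r'] TT[of r' w r] unfolding r(3,4)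
          by (cases "r w \<le> r' w") (simp_all add: T_def max_absorb1 max_absorb2)
      qed
      ultimately show ?thesis
        by (intro bexI[of _ "T (\<lambda>w. min (r w) (r' w))"]) auto
    qed
  qed
  have "\<exists>r. r \<in> R \<and> s n = T r" for n
  proof -
    have "s n \<in> T ` R" using s(1) by (rule spec)
    then show ?thesis by (rule imageE) (intro exI conjI)
  qed
  then have "\<forall>n. \<exists>r. r \<in> R \<and> s n = T r" by (rule allI)
  then obtain r where "\<forall>n. r n \<in> R \<and> s n = T (r n)" by (rule choice[THEN exE])
  then have r: "\<And>n. r n \<in> R" "\<And>n. s n = T (r n)" by simp_all
  define m where "m = (\<lambda>w. INF n. r n w)"
  have rb: "bdd_below (range (\<lambda>n. r n w))" for w
    using r(1) by (intro bdd_belowI[of _ 0]) (auto simp: R_def)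
  have mle: "m w \<le> r n w" for n w
    unfolding m_def by (rule cINF_lower[OF rb]) simp
  have m0: "0 \<le> m w" for w
    unfolding m_def using r(1) by (intro cINF_greatest) (auto simp: R_def)
  have [measurable]: "m \<in> borel_measurable M"
    unfolding m_def using r(1) rb by (intro borel_measurable_cINF) (auto simp: R_def)
  have mB: "L0_class M m \<in> B"
    unfolding m_def by (rule cl) (use r(1) in \<open>auto simp: R_def\<close>)
  have mleast: "AE w in M. m w \<le> q w" if q: "q \<in> R" for q
    using bspec[OF s(3) imageI[OF q]]
  proof eventually_elim
    case (elim w)
    have q0: "0 \<le> q w" using q by (simp add: R_def)
    have "(SUP n. s n w) \<le> T m w"
      unfolding r(2) using m0 mle r(1) by (intro SUP_least) (simp add: TT R_def)
    with elim have "T q w \<le> T m w" by (rule order_trans)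
    then show "m w \<le> q w" using m0[of w] q0 by (simp add: TT)
  qed
  have mleast': "L0_le M (L0_class M m) X" if "X \<in> B" for X
    using BR[OF that] mleast by (auto simp: R_def L0_le_class_iff)
  have "L0_Inf M B = L0_class M m"
  proof -
    define L where "L = L0_ext_lattice M"
    define E where "E = (\<lambda>X. L0_class M (\<lambda>w. ereal (L0_rep X w))) ` B"
    have BL0: "B \<subseteq> L0 M" using sub by (auto simp: L0_nonneg_iff)
    have L: "carrier L = L0 M" "gorder.le L = L0_le M" by (simp_all add: L_def L0_ext_lattice_def)
    have Eclass: "L0_class M (\<lambda>w. ereal (L0_rep (L0_class M q) w)) = L0_class M (\<lambda>w. ereal (q w))"
      if "q \<in> borel_measurable M" for q
      using that AE_L0_rep_class[OF that]
      by (intro L0_class_cong borel_measurable_ereal) (auto elim!: eventually_mono)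
    define m' where "m' = L0_class M (\<lambda>w. ereal (m w))"
    have m'L0: "m' \<in> L0 M" by (simp add: m'_def)
    \<comment> \<open>The candidate lies in the set itself, so it is a minimum and any greatest
      lower bound equals it by antisymmetry; thus the choice inside \<open>Lattice.inf\<close> is
      determined.\<close>
    have m'E: "m' \<in> E" using mB Eclass[of m] by (auto simp: E_def m'_def intro!: rev_image_eqI)
    have E0: "E \<subseteq> L0 M" using BL0 by (auto simp: E_def)
    have low: "L0_le M m' Y" if "Y \<in> E" for Y
    proof -
      obtain X where X: "X \<in> B" "Y = L0_class M (\<lambda>w. ereal (L0_rep X w))"
        using \<open>Y \<in> E\<close> by (auto simp: E_def)
      then obtain q where q: "q \<in> R" "X = L0_class M q" using BR by auto
      then have qm: "q \<in> borel_measurable M" by (simp add: R_def)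
      show ?thesis
        unfolding X(2) q(2) Eclass[OF qm] m'_def
        using mleast[OF q(1)] qm by (simp add: L0_le_class_iff)
    qed
    have gr: "greatest L m' (Lower L E)"
      using m'L0 E0 m'E low by (auto simp: greatest_def Lower_def L)
    have "Lattice.inf L E = m'"
      unfolding Lattice.inf_def
    proof (rule some_equality, rule gr)
      fix x assume x: "greatest L x (Lower L E)"
      then have "x \<in> L0 M" "L0_le M x m'" "L0_le M m' x"
        using gr m'E m'L0 by (auto simp: greatest_def Lower_def L)
      then show "x = m'" using m'L0 by (intro L0_le_antisym)
    qed
    then have "L0_Inf M B = L0_class M (\<lambda>w. real_of_ereal (L0_rep m' w))"
      unfolding L0_Inf_def L_def E_def by (simp only:)
    also have "\<dots> = L0_class M m"
    proof (rule L0_class_cong)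
      show "AE w in M. real_of_ereal (L0_rep m' w) = m w"
        unfolding m'_def using AE_L0_rep_class[OF borel_measurable_ereal, OF \<open>m \<in> borel_measurable M\<close>]
        by eventually_elim simp
    qed (use m'L0 in simp_all)
    finally show ?thesis .
  qed
  note eq = this
  show "L0_Inf M B \<in> B" unfolding eq by (rule mB)
  show "L0_le M (L0_Inf M B) X" if "X \<in> B" for X
    unfolding eq using that by (rule mleast')
qed

section \<open>The random conjugate space\<close>

context random_normed_module
begin

abbreviation conj_module where "conj_module \<equiv> random_conjugate G S"

definition Nc :: "('a \<Rightarrow> ('w \<Rightarrow> 'k) set) \<Rightarrow> 'w \<Rightarrow> real" where
  "Nc f = L0_rep (rnorm conj_module f)"

lemma class_mem_random_bounds_iff:
  assumes r [measurable]: "r \<in> borel_measurable G" and f: "\<And>x. x \<in> carrier S \<Longrightarrow> f x \<in> L0 G"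
  shows "L0_class G r \<in> random_bounds G S f \<longleftrightarrow> (AE w in G. 0 \<le> r w) \<and>
    (\<forall>x\<in>carrier S. AE w in G. norm (L0_rep (f x) w) \<le> r w * N x w)"
proof -
  have "L0_le G (L0_abs G (f x)) (L0_class G r \<otimes>\<^bsub>L0_ring G\<^esub> rnorm S x) \<longleftrightarrow>
      (AE w in G. norm (L0_rep (f x) w) \<le> r w * N x w)" if x: "x \<in> carrier S" for x
  proof -
    note [measurable] = N_measurable[OF x] L0_rep_measurable[OF f[OF x]]
    have "L0_class G r \<otimes>\<^bsub>L0_ring G\<^esub> rnorm S x = L0_class G (\<lambda>w. r w * N x w)"
      unfolding rnorm_eq_class[OF x] by (rule L0_mult_class) simp_all
    moreover have "L0_abs G (f x) = L0_class G (\<lambda>w. norm (L0_rep (f x) w))"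
      by (simp add: L0_abs_def)
    ultimately show ?thesis by (simp add: L0_le_class_iff)
  qed
  then show ?thesis
    unfolding random_bounds_def by (auto simp: L0_class_nonneg_iff)
qed

lemma conj_L0: "f \<in> carrier conj_module \<Longrightarrow> x \<in> carrier S \<Longrightarrow> f x \<in> L0 G"
  by (auto simp: random_conjugate_def)

lemma rep_conj_measurable [simp]:
  "f \<in> carrier conj_module \<Longrightarrow> x \<in> carrier S \<Longrightarrow> L0_rep (f x) \<in> borel_measurable G"
  by (simp add: conj_L0)

text \<open>The infimum defining the conjugate norm is attained, hence is itself a bound. Along a
  sequence of bounds the inequality for a fixed \<open>x\<close> holds for all \<open>n\<close> off
  one null set. Where \<open>N x w\<close> is positive it can be divided out before taking the
  infimum, and where it is 0 every bound already forces the value of \<open>f x\<close> to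
  vanish.\<close>

lemma conj_norm_mem_bounds:
  assumes f: "f \<in> carrier conj_module"
  shows "rnorm conj_module f \<in> random_bounds G S f"
    and "\<And>X. X \<in> random_bounds G S f \<Longrightarrow> L0_le G (rnorm conj_module f) X"
proof -
  note fL0 = conj_L0[OF f]
  have eq: "rnorm conj_module f = L0_Inf G (random_bounds G S f)"
    by (simp add: random_conjugate_def)
  have sub: "random_bounds G S f \<subseteq> L0_nonneg G"
    by (auto simp: random_bounds_def)
  have ne: "random_bounds G S f \<noteq> {}"
    using f by (simp add: random_conjugate_def)
  have cl: "L0_class G (\<lambda>w. INF n. r n w) \<in> random_bounds G S f"
    if r: "\<And>n. r n \<in> borel_measurable G" and r0: "\<And>n w. 0 \<le> r n w"
      and rb: "\<And>n. L0_class G (r n) \<in> random_bounds G S f" for r :: "nat \<Rightarrow> 'w \<Rightarrow> real"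
  proof -
    have bb: "bdd_below (range (\<lambda>n. r n w))" for w
      using r0 by (intro bdd_belowI[of _ 0]) auto
    have m: "(\<lambda>w. INF n. r n w) \<in> borel_measurable G"
      using r bb by (intro borel_measurable_cINF) auto
    have "AE w in G. norm (L0_rep (f x) w) \<le> (INF n. r n w) * N x w" if x: "x \<in> carrier S" for x
    proof -
      have "AE w in G. \<forall>n. norm (L0_rep (f x) w) \<le> r n w * N x w"
        using rb class_mem_random_bounds_iff[OF r fL0] x by (simp add: AE_all_countable)
      with AE_N_nonneg[OF x] show ?thesis
      proof eventually_elim
        case (elim w)
        show ?case
        proof (cases "N x w = 0")
          case True
          then show ?thesis using elim(2) by simp
        next
          case False
          then have pos: "N x w > 0" using elim(1) by simp
          have "norm (L0_rep (f x) w) / N x w \<le> (INF n. r n w)"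
            using elim(2) pos by (intro cINF_greatest) (auto simp: field_simps)
          then show ?thesis using pos by (simp add: field_simps)
        qed
      qed
    qed
    moreover have "AE w in G. 0 \<le> (INF n. r n w)"
      using r0 by (intro AE_I2 cINF_greatest) auto
    ultimately show ?thesis
      using class_mem_random_bounds_iff[OF m fL0] by simp
  qed
  show "rnorm conj_module f \<in> random_bounds G S f"
    unfolding eq by (rule L0_Inf_least[OF sub ne cl])
  show "L0_le G (rnorm conj_module f) X" if "X \<in> random_bounds G S f" for X
    unfolding eq by (rule L0_Inf_least(2)[OF sub ne cl that])
qed

lemma rnorm_conj_L0: "f \<in> carrier conj_module \<Longrightarrow> rnorm conj_module f \<in> L0_nonneg G"
  using conj_norm_mem_bounds(1)[of f] by (auto simp: random_bounds_def)

lemma Nc_measurable [measurable_dest, simp]: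
  "f \<in> carrier conj_module \<Longrightarrow> Nc f \<in> borel_measurable G"
  unfolding Nc_def using rnorm_conj_L0[of f] by (auto simp: L0_nonneg_iff)

lemma rnorm_conj_eq: "f \<in> carrier conj_module \<Longrightarrow> rnorm conj_module f = L0_class G (Nc f)"
  unfolding Nc_def using rnorm_conj_L0[of f] by (auto simp: L0_nonneg_iff)

lemma AE_Nc_nonneg: "f \<in> carrier conj_module \<Longrightarrow> AE w in G. 0 \<le> Nc f w"
  unfolding Nc_def using rnorm_conj_L0[of f] by (auto simp: L0_nonneg_iff)

lemma AE_conj_le:
  assumes f: "f \<in> carrier conj_module" and x: "x \<in> carrier S"
  shows "AE w in G. norm (L0_rep (f x) w) \<le> Nc f w * N x w"
  using conj_norm_mem_bounds(1)[OF f] class_mem_random_bounds_iff[OF Nc_measurable[OF f], of f]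
    conj_L0[OF f] x by (simp add: rnorm_conj_eq[OF f])

lemma Nc_least:
  assumes f: "f \<in> carrier conj_module" and r: "r \<in> borel_measurable G" "AE w in G. 0 \<le> r w"
    and b: "\<And>x. x \<in> carrier S \<Longrightarrow> AE w in G. norm (L0_rep (f x) w) \<le> r w * N x w"
  shows "AE w in G. Nc f w \<le> r w"
proof -
  have "L0_class G r \<in> random_bounds G S f"
    using class_mem_random_bounds_iff[OF r(1), of f] conj_L0[OF f] r(2) b by simp
  from conj_norm_mem_bounds(2)[OF f this] show ?thesis
    using r(1) by (simp add: rnorm_conj_eq[OF f] L0_le_class_iff f)
qed

lemma AE_conj_add:
  assumes f: "f \<in> carrier conj_module" and x: "x \<in> carrier S" and y: "y \<in> carrier S"
  shows "AE w in G. L0_rep (f (x \<oplus> y)) w = L0_rep (f x) w + L0_rep (f y) w"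
proof -
  have "f (x \<oplus> y) = f x \<oplus>\<^bsub>L0_ring G\<^esub> f y"
    using f x y by (simp add: random_conjugate_def)
  then show ?thesis using AE_L0_rep_add[OF conj_L0[OF f x] conj_L0[OF f y]] by simp
qed

lemma AE_conj_sm:
  assumes f: "f \<in> carrier conj_module" and x: "x \<in> carrier S" and a: "a \<in> borel_measurable G"
  shows "AE w in G. L0_rep (f (sm a x)) w = a w * L0_rep (f x) w"
proof -
  have "f (sm a x) = L0_class G a \<otimes>\<^bsub>L0_ring G\<^esub> f x"
    using f x a by (simp add: random_conjugate_def sm_def)
  then show ?thesis
    using AE_L0_rep_mult[of "L0_class G a" G "f x"] conj_L0[OF f x] AE_L0_rep_class[OF a] a
    by (auto elim: eventually_elim2)
qed

definition conj_of :: "('a \<Rightarrow> 'w \<Rightarrow> 'k) \<Rightarrow> 'a \<Rightarrow> ('w \<Rightarrow> 'k) set" where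
  "conj_of u = (\<lambda>x\<in>carrier S. L0_class G (u x))"

text \<open>Passage from almost-sure laws of functions to a functional on classes. It produces the
  sums and multiples of functionals, the functional made of densities, and the canonical
  embedding.\<close>

lemma conj_of:
  assumes meas: "\<And>x. x \<in> carrier S \<Longrightarrow> u x \<in> borel_measurable G"
    and add: "\<And>x y. x \<in> carrier S \<Longrightarrow> y \<in> carrier S \<Longrightarrow>
      AE w in G. u (x \<oplus> y) w = u x w + u y w"
    and hom: "\<And>a x. a \<in> borel_measurable G \<Longrightarrow> x \<in> carrier S \<Longrightarrow>
      AE w in G. u (sm a x) w = a w * u x w"
    and r: "r \<in> borel_measurable G" "AE w in G. 0 \<le> r w"
    and bd: "\<And>x. x \<in> carrier S \<Longrightarrow> AE w in G. norm (u x w) \<le> r w * N x w"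
  shows "conj_of u \<in> carrier conj_module"
    and "\<And>x. x \<in> carrier S \<Longrightarrow> AE w in G. L0_rep (conj_of u x) w = u x w"
    and "AE w in G. Nc (conj_of u) w \<le> r w"
proof -
  let ?f = "conj_of u"
  have fx: "?f x = L0_class G (u x)" if "x \<in> carrier S" for x
    using that by (simp add: conj_of_def)
  have rep: "AE w in G. L0_rep (?f x) w = u x w" if "x \<in> carrier S" for x
    using AE_L0_rep_class[OF meas] that by (simp add: fx)
  have bd': "AE w in G. norm (L0_rep (?f x) w) \<le> r w * N x w" if "x \<in> carrier S" for x
    using rep[OF that] bd[OF that] by eventually_elim simp
  have add': "?f (x \<oplus> y) = ?f x \<oplus>\<^bsub>L0_ring G\<^esub> ?f y" if "x \<in> carrier S" "y \<in> carrier S" for x y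
  proof -
    have "L0_class G (u (x \<oplus> y)) = L0_class G (\<lambda>w. u x w + u y w)"
      using that add[OF that] by (intro L0_class_cong borel_measurable_add meas M.a_closed)
    then show ?thesis using that meas by (simp add: fx L0_add_class)
  qed
  have hom': "?f (\<xi> \<odot> x) = \<xi> \<otimes>\<^bsub>L0_ring G\<^esub> ?f x" if "\<xi> \<in> L0 G" "x \<in> carrier S" for \<xi> x
  proof -
    from \<open>\<xi> \<in> L0 G\<close> obtain a where a [measurable]: "a \<in> borel_measurable G" and \<xi>: "\<xi> = L0_class G a"
      by (rule L0_cases)
    have "L0_class G (u (sm a x)) = L0_class G (\<lambda>w. a w * u x w)"
      using that a hom[OF a] by (intro L0_class_cong borel_measurable_times meas sm_closed) auto
    then show ?thesis using that a meas
      by (simp add: fx L0_mult_class \<xi> sm_closed[unfolded sm_def] sm_def[symmetric])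
  qed
  have "L0_class G r \<in> random_bounds G S ?f"
    using class_mem_random_bounds_iff[OF r(1), of ?f] bd' r(2) meas by (simp add: fx)
  then have "random_bounds G S ?f \<noteq> {}" by blast
  moreover have "?f \<in> carrier S \<rightarrow>\<^sub>E L0 G"
    unfolding conj_of_def using meas by auto
  ultimately show f: "?f \<in> carrier conj_module"
    using add' hom' by (simp add: random_conjugate_def)
  show "\<And>x. x \<in> carrier S \<Longrightarrow> AE w in G. L0_rep (?f x) w = u x w" by (rule rep)
  show "AE w in G. Nc ?f w \<le> r w" by (rule Nc_least[OF f r bd'])
qed

lemma conj_eqI:
  assumes f: "f \<in> carrier conj_module" and g: "g \<in> carrier conj_module"
    and eq: "\<And>x. x \<in> carrier S \<Longrightarrow> AE w in G. L0_rep (f x) w = L0_rep (g x) w"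
  shows "f = g"
proof (rule ext)
  fix x
  show "f x = g x"
  proof (cases "x \<in> carrier S")
    case True
    then show ?thesis using L0_eqI[OF conj_L0[OF f] conj_L0[OF g]] eq by blast
  next
    case False
    then show ?thesis using f g by (auto simp: random_conjugate_def PiE_def extensional_def)
  qed
qed

lemma AE_Nc_eq_0D:
  assumes f: "f \<in> carrier conj_module" and x: "x \<in> carrier S" and "AE w in G. Nc f w = 0"
  shows "AE w in G. L0_rep (f x) w = 0"
  using AE_conj_le[OF f x] assms(3) by eventually_elim simp

lemma conj_add_rep:
  assumes f: "f \<in> carrier conj_module" and g: "g \<in> carrier conj_module"
  shows "f \<oplus>\<^bsub>conj_module\<^esub> g \<in> carrier conj_module"
    and "\<And>x. x \<in> carrier S \<Longrightarrow>
      AE w in G. L0_rep ((f \<oplus>\<^bsub>conj_module\<^esub> g) x) w = L0_rep (f x) w + L0_rep (g x) w"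
    and "AE w in G. Nc (f \<oplus>\<^bsub>conj_module\<^esub> g) w \<le> Nc f w + Nc g w"
proof -
  define u where "u = (\<lambda>x w. L0_rep (f x) w + L0_rep (g x) w)"
  have eq: "f \<oplus>\<^bsub>conj_module\<^esub> g = conj_of u"
    by (auto simp: random_conjugate_def conj_of_def u_def L0_ring_def)
  have 1: "u x \<in> borel_measurable G" if "x \<in> carrier S" for x
    unfolding u_def using that f g by (intro borel_measurable_add rep_conj_measurable)
  have 2: "AE w in G. u (x \<oplus> y) w = u x w + u y w" if "x \<in> carrier S" "y \<in> carrier S" for x y
    using AE_conj_add[OF f that] AE_conj_add[OF g that] unfolding u_def by eventually_elim simp
  have 3: "AE w in G. u (sm a x) w = a w * u x w" if "a \<in> borel_measurable G" "x \<in> carrier S" for a x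
    using AE_conj_sm[OF f that(2,1)] AE_conj_sm[OF g that(2,1)] unfolding u_def
    by eventually_elim (simp add: distrib_left)
  have 4: "AE w in G. norm (u x w) \<le> (Nc f w + Nc g w) * N x w" if "x \<in> carrier S" for x
    using AE_conj_le[OF f that] AE_conj_le[OF g that] unfolding u_def
    by eventually_elim (metis add_mono distrib_right norm_triangle_le)
  have 5: "AE w in G. 0 \<le> Nc f w + Nc g w"
    using AE_Nc_nonneg[OF f] AE_Nc_nonneg[OF g] by eventually_elim simp
  have 6: "(\<lambda>w. Nc f w + Nc g w) \<in> borel_measurable G" using f g by simp
  note * = conj_of[of u "\<lambda>w. Nc f w + Nc g w", OF 1 2 3 6 5 4]
  show "f \<oplus>\<^bsub>conj_module\<^esub> g \<in> carrier conj_module" unfolding eq by (rule *(1))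
  show "AE w in G. L0_rep ((f \<oplus>\<^bsub>conj_module\<^esub> g) x) w = L0_rep (f x) w + L0_rep (g x) w"
    if "x \<in> carrier S" for x
    using *(2)[OF _ _ _ _ _ _ that] unfolding eq u_def .
  show "AE w in G. Nc (f \<oplus>\<^bsub>conj_module\<^esub> g) w \<le> Nc f w + Nc g w"
    unfolding eq by (rule *(3))
qed

lemma conj_smult_rep:
  assumes f: "f \<in> carrier conj_module" and \<xi>: "\<xi> \<in> L0 G"
  shows "\<xi> \<odot>\<^bsub>conj_module\<^esub> f \<in> carrier conj_module"
    and "\<And>x. x \<in> carrier S \<Longrightarrow>
      AE w in G. L0_rep ((\<xi> \<odot>\<^bsub>conj_module\<^esub> f) x) w = L0_rep \<xi> w * L0_rep (f x) w"
    and "AE w in G. Nc (\<xi> \<odot>\<^bsub>conj_module\<^esub> f) w = norm (L0_rep \<xi> w) * Nc f w"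
proof -
  define b where "b = L0_rep \<xi>"
  have b [measurable]: "b \<in> borel_measurable G" using \<xi> by (simp add: b_def)
  define u where "u = (\<lambda>x w. b w * L0_rep (f x) w)"
  have eq: "\<xi> \<odot>\<^bsub>conj_module\<^esub> f = conj_of u"
    by (auto simp: random_conjugate_def conj_of_def u_def L0_ring_def b_def)
  have 1: "u x \<in> borel_measurable G" if "x \<in> carrier S" for x
    unfolding u_def using that f b by (intro borel_measurable_times rep_conj_measurable)
  have 2: "AE w in G. u (x \<oplus> y) w = u x w + u y w" if "x \<in> carrier S" "y \<in> carrier S" for x y
    using AE_conj_add[OF f that] unfolding u_def by eventually_elim (simp add: distrib_left)
  have 3: "AE w in G. u (sm a x) w = a w * u x w" if "a \<in> borel_measurable G" "x \<in> carrier S" for a x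
    using AE_conj_sm[OF f that(2,1)] unfolding u_def by eventually_elim simp
  have 4: "AE w in G. norm (u x w) \<le> (norm (b w) * Nc f w) * N x w" if "x \<in> carrier S" for x
    using AE_conj_le[OF f that] unfolding u_def
    by eventually_elim (simp add: norm_mult mult.assoc mult_left_mono)
  have 5: "AE w in G. 0 \<le> norm (b w) * Nc f w"
    using AE_Nc_nonneg[OF f] by eventually_elim simp
  have 6: "(\<lambda>w. norm (b w) * Nc f w) \<in> borel_measurable G" using f by simp
  note * = conj_of[of u "\<lambda>w. norm (b w) * Nc f w", OF 1 2 3 6 5 4]
  show g: "\<xi> \<odot>\<^bsub>conj_module\<^esub> f \<in> carrier conj_module" unfolding eq by (rule *(1))
  have rep: "AE w in G. L0_rep ((\<xi> \<odot>\<^bsub>conj_module\<^esub> f) x) w = b w * L0_rep (f x) w"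
    if "x \<in> carrier S" for x
    using *(2)[OF _ _ _ _ _ _ that] unfolding eq u_def .
  then show "\<And>x. x \<in> carrier S \<Longrightarrow>
      AE w in G. L0_rep ((\<xi> \<odot>\<^bsub>conj_module\<^esub> f) x) w = L0_rep \<xi> w * L0_rep (f x) w"
    unfolding b_def .
  let ?N = "Nc (\<xi> \<odot>\<^bsub>conj_module\<^esub> f)"
  have le: "AE w in G. ?N w \<le> norm (b w) * Nc f w"
    unfolding eq by (rule *(3))
  \<comment> \<open>A bound for \<open>f\<close> recovered from one for its multiple: divide where
    \<open>b\<close> is nonzero and keep \<open>Nc f\<close> elsewhere. Minimality of
    \<open>Nc f\<close> then gives the inequality opposite to \<open>le\<close>.\<close>
  define r where "r = (\<lambda>w. if b w = 0 then Nc f w else ?N w / norm (b w))"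
  have [measurable]: "Nc f \<in> borel_measurable G" "?N \<in> borel_measurable G" using f g by simp_all
  have r: "r \<in> borel_measurable G" unfolding r_def by measurable
  have r0: "AE w in G. 0 \<le> r w"
    using AE_Nc_nonneg[OF f] AE_Nc_nonneg[OF g] by eventually_elim (simp add: r_def)
  have "AE w in G. norm (L0_rep (f x) w) \<le> r w * N x w" if x: "x \<in> carrier S" for x
    using AE_conj_le[OF f x] AE_conj_le[OF g x] rep[OF x]
    by eventually_elim (auto simp: r_def field_simps norm_mult)
  from Nc_least[OF f r r0 this] have "AE w in G. Nc f w \<le> r w" .
  with le show "AE w in G. ?N w = norm (L0_rep \<xi> w) * Nc f w"
    using AE_Nc_nonneg[OF g]
  proof eventually_elim
    case (elim w)
    then show ?case
      by (cases "b w = 0") (auto simp: r_def b_def[symmetric] field_simps)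
  qed
qed

lemma conj_zero_rep:
  shows "\<zero>\<^bsub>conj_module\<^esub> \<in> carrier conj_module"
    and "\<And>x. x \<in> carrier S \<Longrightarrow> AE w in G. L0_rep (\<zero>\<^bsub>conj_module\<^esub> x) w = 0"
    and "AE w in G. Nc \<zero>\<^bsub>conj_module\<^esub> w = 0"
proof -
  have eq: "\<zero>\<^bsub>conj_module\<^esub> = conj_of (\<lambda>x w. 0)"
    by (auto simp: random_conjugate_def conj_of_def zero_L0_ring)
  note * = conj_of[of "\<lambda>x w. 0" "\<lambda>w. 0", simplified]
  show 1: "\<zero>\<^bsub>conj_module\<^esub> \<in> carrier conj_module" unfolding eq by (rule *(1))
  show "AE w in G. L0_rep (\<zero>\<^bsub>conj_module\<^esub> x) w = 0" if "x \<in> carrier S" for x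
    unfolding eq by (rule *(2)[OF that])
  have "AE w in G. Nc \<zero>\<^bsub>conj_module\<^esub> w \<le> 0" unfolding eq by (rule *(3))
  then show "AE w in G. Nc \<zero>\<^bsub>conj_module\<^esub> w = 0"
    using AE_Nc_nonneg[OF 1] by eventually_elim simp
qed

text \<open>With this the conjugate is again an instance of the locale, so every theorem about
  \<open>S\<close>, in particular the representation of functionals, can be applied to the conjugate
  as well.\<close>

lemma random_normed_module_conj: "random_normed_module G conj_module"
proof -
  note cl = conj_add_rep(1) conj_smult_rep(1) conj_zero_rep(1)
  have ab: "abelian_group conj_module"
  proof (rule abelian_groupI)
    fix f assume f: "f \<in> carrier conj_module"
    let ?g = "L0_class G (\<lambda>w. -1) \<odot>\<^bsub>conj_module\<^esub> f"
    have g: "?g \<in> carrier conj_module" using f by (simp add: cl)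
    have "?g \<oplus>\<^bsub>conj_module\<^esub> f = \<zero>\<^bsub>conj_module\<^esub>"
    proof (rule conj_eqI)
      fix x assume x: "x \<in> carrier S"
      show "AE w in G. L0_rep ((?g \<oplus>\<^bsub>conj_module\<^esub> f) x) w = L0_rep (\<zero>\<^bsub>conj_module\<^esub> x) w"
        using conj_add_rep(2)[OF g f x] conj_smult_rep(2)[OF f L0_class_in_L0 x, of "\<lambda>w. -1", simplified]
          conj_zero_rep(2)[OF x] AE_L0_rep_class[of "\<lambda>w. -1::'k" G, simplified]
        by eventually_elim simp
    qed (simp_all add: cl f g)
    with g show "\<exists>g\<in>carrier conj_module. g \<oplus>\<^bsub>conj_module\<^esub> f = \<zero>\<^bsub>conj_module\<^esub>" by blast
    show "\<zero>\<^bsub>conj_module\<^esub> \<oplus>\<^bsub>conj_module\<^esub> f = f"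
    proof (rule conj_eqI)
      fix x assume x: "x \<in> carrier S"
      show "AE w in G. L0_rep ((\<zero>\<^bsub>conj_module\<^esub> \<oplus>\<^bsub>conj_module\<^esub> f) x) w = L0_rep (f x) w"
        using conj_add_rep(2)[OF cl(3) f x] conj_zero_rep(2)[OF x] by eventually_elim simp
    qed (simp_all add: cl f)
  next
    fix f g assume f: "f \<in> carrier conj_module" and g: "g \<in> carrier conj_module"
    show "f \<oplus>\<^bsub>conj_module\<^esub> g = g \<oplus>\<^bsub>conj_module\<^esub> f"
    proof (rule conj_eqI)
      fix x assume x: "x \<in> carrier S"
      show "AE w in G. L0_rep ((f \<oplus>\<^bsub>conj_module\<^esub> g) x) w = L0_rep ((g \<oplus>\<^bsub>conj_module\<^esub> f) x) w"
        using conj_add_rep(2)[OF f g x] conj_add_rep(2)[OF g f x] by eventually_elim simp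
    qed (simp_all add: cl f g)
    fix h assume h: "h \<in> carrier conj_module"
    show "(f \<oplus>\<^bsub>conj_module\<^esub> g) \<oplus>\<^bsub>conj_module\<^esub> h = f \<oplus>\<^bsub>conj_module\<^esub> (g \<oplus>\<^bsub>conj_module\<^esub> h)"
    proof (rule conj_eqI)
      fix x assume x: "x \<in> carrier S"
      show "AE w in G. L0_rep ((f \<oplus>\<^bsub>conj_module\<^esub> g \<oplus>\<^bsub>conj_module\<^esub> h) x) w =
          L0_rep ((f \<oplus>\<^bsub>conj_module\<^esub> (g \<oplus>\<^bsub>conj_module\<^esub> h)) x) w"
        using conj_add_rep(2)[OF f g x] conj_add_rep(2)[OF g h x]
          conj_add_rep(2)[OF cl(1)[OF f g] h x] conj_add_rep(2)[OF f cl(1)[OF g h] x]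
        by eventually_elim simp
    qed (simp_all add: cl f g h)
  qed (simp_all add: cl)
  have mod: "Module.module (L0_ring G) conj_module"
  proof (rule moduleI)
    show "cring (L0_ring G :: ('w \<Rightarrow> 'k) set ring)" by (rule cring_L0_ring)
    show "abelian_group conj_module" by (rule ab)
    show "a \<odot>\<^bsub>conj_module\<^esub> f \<in> carrier conj_module"
      if "a \<in> carrier (L0_ring G)" "f \<in> carrier conj_module" for a f
      using that by (simp add: cl)
    show "(a \<oplus>\<^bsub>L0_ring G\<^esub> b) \<odot>\<^bsub>conj_module\<^esub> f =
        a \<odot>\<^bsub>conj_module\<^esub> f \<oplus>\<^bsub>conj_module\<^esub> b \<odot>\<^bsub>conj_module\<^esub> f"
      if "a \<in> carrier (L0_ring G)" "b \<in> carrier (L0_ring G)" "f \<in> carrier conj_module" for a b f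
      using that by (auto simp: random_conjugate_def fun_eq_iff R.l_distr PiE_def Pi_iff)
    show "a \<odot>\<^bsub>conj_module\<^esub> (f \<oplus>\<^bsub>conj_module\<^esub> g) =
        a \<odot>\<^bsub>conj_module\<^esub> f \<oplus>\<^bsub>conj_module\<^esub> a \<odot>\<^bsub>conj_module\<^esub> g"
      if "a \<in> carrier (L0_ring G)" "f \<in> carrier conj_module" "g \<in> carrier conj_module" for a f g
      using that by (auto simp: random_conjugate_def fun_eq_iff R.r_distr PiE_def Pi_iff)
    show "(a \<otimes>\<^bsub>L0_ring G\<^esub> b) \<odot>\<^bsub>conj_module\<^esub> f = a \<odot>\<^bsub>conj_module\<^esub> (b \<odot>\<^bsub>conj_module\<^esub> f)"
      if "a \<in> carrier (L0_ring G)" "b \<in> carrier (L0_ring G)" "f \<in> carrier conj_module" for a b f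
      using that by (auto simp: random_conjugate_def fun_eq_iff R.m_assoc PiE_def Pi_iff)
    show "\<one>\<^bsub>L0_ring G\<^esub> \<odot>\<^bsub>conj_module\<^esub> f = f" if "f \<in> carrier conj_module" for f
    proof (rule conj_eqI)
      have 1: "\<one>\<^bsub>L0_ring G\<^esub> \<in> L0 G" by (simp add: one_L0_ring)
      show "\<one>\<^bsub>L0_ring G\<^esub> \<odot>\<^bsub>conj_module\<^esub> f \<in> carrier conj_module" by (rule cl(2)[OF that 1])
      show "AE w in G. L0_rep ((\<one>\<^bsub>L0_ring G\<^esub> \<odot>\<^bsub>conj_module\<^esub> f) x) w = L0_rep (f x) w"
        if x: "x \<in> carrier S" for x
        using conj_smult_rep(2)[OF \<open>f \<in> carrier conj_module\<close> 1 x]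
          AE_L0_rep_class[of "\<lambda>w. 1::'k" G, simplified]
        unfolding one_L0_ring by eventually_elim simp
    qed fact
  qed
  show ?thesis
  proof (intro random_normed_module.intro random_normed_module_axioms.intro)
    show "prob_space G" by unfold_locales
    show "Module.module (L0_ring G) conj_module" by (rule mod)
    fix f assume f: "f \<in> carrier conj_module"
    show "rnorm conj_module f \<in> L0_nonneg G" by (rule rnorm_conj_L0[OF f])
    show "rnorm conj_module (\<xi> \<odot>\<^bsub>conj_module\<^esub> f) = L0_abs G \<xi> \<otimes>\<^bsub>L0_ring G\<^esub> rnorm conj_module f"
      if \<xi>: "\<xi> \<in> L0 G" for \<xi>
    proof -
      have "L0_abs G \<xi> \<otimes>\<^bsub>L0_ring G\<^esub> rnorm conj_module f = L0_class G (\<lambda>w. norm (L0_rep \<xi> w) * Nc f w)"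
        unfolding rnorm_conj_eq[OF f] L0_abs_def
        by (rule L0_mult_class) (use \<xi> f in simp_all)
      also have "\<dots> = rnorm conj_module (\<xi> \<odot>\<^bsub>conj_module\<^esub> f)"
        unfolding rnorm_conj_eq[OF cl(2)[OF f \<xi>]]
        by (rule L0_class_cong) (use \<xi> f conj_smult_rep(3)[OF f \<xi>] cl in \<open>auto elim!: eventually_mono\<close>)
      finally show ?thesis by simp
    qed
    show "L0_le G (rnorm conj_module (f \<oplus>\<^bsub>conj_module\<^esub> g))
        (rnorm conj_module f \<oplus>\<^bsub>L0_ring G\<^esub> rnorm conj_module g)" if g: "g \<in> carrier conj_module" for g
      using conj_add_rep(3)[OF f g] f g cl(1)[OF f g]
      by (simp add: rnorm_conj_eq L0_add_class L0_le_class_iff)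
    show "rnorm conj_module f = \<zero>\<^bsub>L0_ring G\<^esub> \<longleftrightarrow> f = \<zero>\<^bsub>conj_module\<^esub>"
    proof
      assume "rnorm conj_module f = \<zero>\<^bsub>L0_ring G\<^esub>"
      then have 0: "AE w in G. Nc f w = 0"
        using f by (simp add: rnorm_conj_eq zero_L0_ring L0_class_eq_iff)
      show "f = \<zero>\<^bsub>conj_module\<^esub>"
      proof (rule conj_eqI[OF f cl(3)])
        fix x assume x: "x \<in> carrier S"
        show "AE w in G. L0_rep (f x) w = L0_rep (\<zero>\<^bsub>conj_module\<^esub> x) w"
          using AE_Nc_eq_0D[OF f x 0] conj_zero_rep(2)[OF x] by eventually_elim simp
      qed
    next
      assume "f = \<zero>\<^bsub>conj_module\<^esub>"
      then show "rnorm conj_module f = \<zero>\<^bsub>L0_ring G\<^esub>"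
        using conj_zero_rep(3) cl(3) by (simp add: rnorm_conj_eq zero_L0_ring L0_class_eq_iff)
    qed
  qed
qed

end

section \<open>Integral inequalities and densities\<close>

text \<open>Convexity of the \<open>p\<close>-th power, with \<open>(a + b) / (A + B)\<close>
  written as the average of \<open>a / A\<close> and \<open>b / B\<close> with weights
  \<open>A / (A + B)\<close> and \<open>B / (A + B)\<close>. The right side is linear in
  \<open>a powr p\<close> and \<open>b powr p\<close>, so it can be integrated, and also conditioned
  when \<open>A\<close> and \<open>B\<close> are functions measurable for the smaller
  algebra.\<close>

lemma powr_add_le_weighted:
  fixes a b A B p :: real
  assumes p: "1 < p" and a: "0 \<le> a" and b: "0 \<le> b" and A: "0 < A" and B: "0 < B"
  shows "(a + b) powr p \<le>
    (A + B) powr (p - 1) * (A powr (1 - p) * a powr p + B powr (1 - p) * b powr p)"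
proof -
  have mono: "1 \<le> (A + B) powr (p - 1) * X powr (1 - p)" if X: "0 < X" "X \<le> A + B" for X
  proof -
    have "1 = X powr (p - 1) * X powr (1 - p)"
      using X by (simp add: powr_add[symmetric])
    also have "\<dots> \<le> (A + B) powr (p - 1) * X powr (1 - p)"
      using X p by (intro mult_right_mono powr_mono2) auto
    finally show ?thesis .
  qed
  show ?thesis
  proof (cases "a = 0 \<or> b = 0")
    \<comment> \<open>At most one term survives on each side, and \<open>mono\<close> says that its
      coefficient on the right is at least 1.\<close>
    case True
    have "1 * a powr p \<le> ((A + B) powr (p - 1) * A powr (1 - p)) * a powr p"
      "1 * b powr p \<le> ((A + B) powr (p - 1) * B powr (1 - p)) * b powr p"
      using A B by (intro mult_right_mono mono; simp)+
    with True show ?thesis by (auto simp: algebra_simps)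
  next
    case False
    then have pos: "a > 0" "b > 0" using a b by auto
    define t where "t = B / (A + B)"
    have t: "0 \<le> t" "t \<le> 1" "1 - t = A / (A + B)" using A B by (auto simp: t_def field_simps)
    have "((1 - t) * (a / A) + t * (b / B)) powr p \<le> (1 - t) * (a / A) powr p + t * (b / B) powr p"
      using convex_onD[OF powr_convex, of p t "a / A" "b / B"] p pos A B t by simp
    also have "(1 - t) * (a / A) + t * (b / B) = (a + b) / (A + B)"
      using A B by (simp add: t(3)) (simp add: t_def add_divide_distrib)
    finally have "(a + b) powr p \<le> (A + B) powr p * ((1 - t) * (a / A) powr p + t * (b / B) powr p)"
      using pos A B by (simp add: powr_divide field_simps)
    also have "\<dots> = (A + B) powr p * (A / (A + B) * (a powr p / A powr p) + B / (A + B) * (b powr p / B powr p))"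
      using pos A B by (simp add: powr_divide t(3)) (simp add: t_def)
    also have "\<dots> = ((A + B) powr p / (A + B)) * (A / A powr p * a powr p + B / B powr p * b powr p)"
      by (simp add: distrib_left)
    also have "\<dots> = (A + B) powr (p - 1) * (A powr (1 - p) * a powr p + B powr (1 - p) * b powr p)"
      using A B by (simp add: powr_diff)
    finally show ?thesis .
  qed
qed

lemma AE_zero_of_nn_integral_powr:
  assumes [measurable]: "f \<in> borel_measurable M" and "(\<integral>\<^sup>+w. ennreal (f w powr p) \<partial>M) \<le> 0"
  shows "AE w in M. f w = 0"
proof -
  have "(\<integral>\<^sup>+w. ennreal (f w powr p) \<partial>M) = 0" using assms(2) by simp
  then have "AE w in M. ennreal (f w powr p) = 0"
    by (subst (asm) nn_integral_0_iff_AE) auto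
  then show ?thesis by eventually_elim (simp add: ennreal_eq_0_iff)
qed

text \<open>The weighted inequality with the norm bounds as weights:
  \<open>A powr (1 - p) * A powr p = A\<close> and likewise for \<open>B\<close>, so the right side
  integrates to at most \<open>(A + B) powr (p - 1) * (A + B)\<close>. A bound equal to 0 cannot be
  a weight, but then the function itself is null.\<close>

lemma nn_integral_Minkowski:
  fixes f g :: "'w \<Rightarrow> real"
  assumes [measurable]: "f \<in> borel_measurable M" "g \<in> borel_measurable M"
    and f0: "AE w in M. 0 \<le> f w" and g0: "AE w in M. 0 \<le> g w"
    and p: "1 < p" and A: "0 \<le> A" and B: "0 \<le> B"
    and fA: "(\<integral>\<^sup>+w. ennreal (f w powr p) \<partial>M) \<le> ennreal (A powr p)"
    and gB: "(\<integral>\<^sup>+w. ennreal (g w powr p) \<partial>M) \<le> ennreal (B powr p)"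
  shows "(\<integral>\<^sup>+w. ennreal ((f w + g w) powr p) \<partial>M) \<le> ennreal ((A + B) powr p)"
proof (cases "A = 0 \<or> B = 0")
  case True
  then show ?thesis
  proof
    assume "A = 0"
    then have "AE w in M. f w = 0" using fA p by (intro AE_zero_of_nn_integral_powr[of f M p]) auto
    then have "(\<integral>\<^sup>+w. ennreal ((f w + g w) powr p) \<partial>M) = (\<integral>\<^sup>+w. ennreal (g w powr p) \<partial>M)"
      by (intro nn_integral_cong_AE) (auto elim!: eventually_mono)
    with gB \<open>A = 0\<close> show ?thesis by simp
  next
    assume "B = 0"
    then have "AE w in M. g w = 0" using gB p by (intro AE_zero_of_nn_integral_powr[of g M p]) auto
    then have "(\<integral>\<^sup>+w. ennreal ((f w + g w) powr p) \<partial>M) = (\<integral>\<^sup>+w. ennreal (f w powr p) \<partial>M)"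
      by (intro nn_integral_cong_AE) (auto elim!: eventually_mono)
    with fA \<open>B = 0\<close> show ?thesis by simp
  qed
next
  case False
  then have pos: "0 < A" "0 < B" using A B by auto
  let ?c = "(A + B) powr (p - 1)" and ?a = "A powr (1 - p)" and ?b = "B powr (1 - p)"
  have "(\<integral>\<^sup>+w. ennreal ((f w + g w) powr p) \<partial>M) \<le>
      (\<integral>\<^sup>+w. ennreal ?c * (ennreal ?a * ennreal (f w powr p) + ennreal ?b * ennreal (g w powr p)) \<partial>M)"
    using f0 g0
  proof (intro nn_integral_mono_AE, eventually_elim)
    case (elim w)
    have "ennreal ((f w + g w) powr p) \<le> ennreal (?c * (?a * f w powr p + ?b * g w powr p))"
      using powr_add_le_weighted[OF p elim(3,4) pos] by (rule ennreal_leI)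
    also have "\<dots> = ennreal ?c * (ennreal ?a * ennreal (f w powr p) + ennreal ?b * ennreal (g w powr p))"
      by (simp add: ennreal_mult ennreal_plus)
    finally show ?case .
  qed
  also have "\<dots> = ennreal ?c * (ennreal ?a * (\<integral>\<^sup>+w. ennreal (f w powr p) \<partial>M)
      + ennreal ?b * (\<integral>\<^sup>+w. ennreal (g w powr p) \<partial>M))"
    by (simp add: nn_integral_cmult nn_integral_add)
  also have "\<dots> \<le> ennreal ?c * (ennreal ?a * ennreal (A powr p) + ennreal ?b * ennreal (B powr p))"
    by (intro mult_left_mono add_mono fA gB) auto
  also have "\<dots> = ennreal (?c * (?a * A powr p + ?b * B powr p))"
    by (simp add: ennreal_mult ennreal_plus)
  also have "?a * A powr p = A" using pos by (simp add: powr_add[symmetric])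
  also have "?b * B powr p = B" using pos by (simp add: powr_add[symmetric])
  also have "?c * (A + B) = (A + B) powr p"
    using pos powr_add[of "A + B" "p - 1" 1] by simp
  finally show ?thesis .
qed

text \<open>Young's inequality for \<open>f / A\<close> and \<open>g / B\<close>, scaled by
  \<open>A * B\<close>; the two terms integrate to at most \<open>A * B / p\<close> and
  \<open>A * B / q\<close>.\<close>

lemma nn_integral_Hoelder:
  fixes f g :: "'w \<Rightarrow> real"
  assumes [measurable]: "f \<in> borel_measurable M" "g \<in> borel_measurable M"
    and f0: "AE w in M. 0 \<le> f w" and g0: "AE w in M. 0 \<le> g w"
    and p: "1 < p" "1 < q" "1 / p + 1 / q = 1" and A: "0 \<le> A" and B: "0 \<le> B"
    and fA: "(\<integral>\<^sup>+w. ennreal (f w powr p) \<partial>M) \<le> ennreal (A powr p)"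
    and gB: "(\<integral>\<^sup>+w. ennreal (g w powr q) \<partial>M) \<le> ennreal (B powr q)"
  shows "(\<integral>\<^sup>+w. ennreal (f w * g w) \<partial>M) \<le> ennreal (A * B)"
proof (cases "A = 0 \<or> B = 0")
  case True
  then have "AE w in M. f w * g w = 0"
  proof
    assume "A = 0"
    then have "AE w in M. f w = 0" using fA p by (intro AE_zero_of_nn_integral_powr[of f M p]) auto
    then show ?thesis by eventually_elim simp
  next
    assume "B = 0"
    then have "AE w in M. g w = 0" using gB p by (intro AE_zero_of_nn_integral_powr[of g M q]) auto
    then show ?thesis by eventually_elim simp
  qed
  then have "(\<integral>\<^sup>+w. ennreal (f w * g w) \<partial>M) = (\<integral>\<^sup>+w. 0 \<partial>M)"
    by (intro nn_integral_cong_AE) (auto elim!: eventually_mono)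
  then show ?thesis by simp
next
  case False
  then have pos: "0 < A" "0 < B" using A B by auto
  let ?a = "A * B / (p * A powr p)" and ?b = "A * B / (q * B powr q)"
  have "(\<integral>\<^sup>+w. ennreal (f w * g w) \<partial>M) \<le>
      (\<integral>\<^sup>+w. ennreal ?a * ennreal (f w powr p) + ennreal ?b * ennreal (g w powr q) \<partial>M)"
    using f0 g0
  proof (intro nn_integral_mono_AE, eventually_elim)
    case (elim w)
    have "f w * g w = A * B * ((f w / A) * (g w / B))" using pos by simp
    also have "\<dots> \<le> A * B * ((f w / A) powr p / p + (g w / B) powr q / q)"
      using pos elim by (intro mult_left_mono Youngs_inequality p) auto
    also have "\<dots> = ?a * f w powr p + ?b * g w powr q"
      using pos elim by (simp add: powr_divide field_simps)
    finally have "ennreal (f w * g w) \<le> ennreal (?a * f w powr p + ?b * g w powr q)"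
      by (rule ennreal_leI)
    also have "\<dots> = ennreal ?a * ennreal (f w powr p) + ennreal ?b * ennreal (g w powr q)"
      using pos p by (simp add: ennreal_mult[symmetric] ennreal_plus[symmetric] del: ennreal_plus)
    finally show ?case .
  qed
  also have "\<dots> = ennreal ?a * (\<integral>\<^sup>+w. ennreal (f w powr p) \<partial>M)
      + ennreal ?b * (\<integral>\<^sup>+w. ennreal (g w powr q) \<partial>M)"
    by (simp add: nn_integral_cmult nn_integral_add)
  also have "\<dots> \<le> ennreal ?a * ennreal (A powr p) + ennreal ?b * ennreal (B powr q)"
    by (intro mult_left_mono add_mono fA gB) auto
  also have "\<dots> = ennreal (?a * A powr p + ?b * B powr q)"
    using pos p by (simp add: ennreal_mult[symmetric] ennreal_plus[symmetric] del: ennreal_plus)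
  also have "?a * A powr p + ?b * B powr q = A * B * (1 / p + 1 / q)"
    using pos p(1,2) by (simp add: field_simps)
  finally show ?thesis by (simp add: p(3))
qed

section \<open>Densities of additive set functions\<close>

lemma (in finite_measure) additive_density_nonneg:
  fixes l :: "'a set \<Rightarrow> real"
  assumes r: "0 < r" and l0: "\<And>A. A \<in> sets M \<Longrightarrow> 0 \<le> l A"
    and lC: "\<And>A. A \<in> sets M \<Longrightarrow> l A \<le> C * measure M A powr r"
    and add: "\<And>A B. A \<in> sets M \<Longrightarrow> B \<in> sets M \<Longrightarrow> A \<inter> B = {} \<Longrightarrow> l (A \<union> B) = l A + l B"
  obtains g :: "'a \<Rightarrow> real" where "integrable M g" "\<forall>w. 0 \<le> g w"
    "\<forall>A\<in>sets M. l A = (\<integral>w. indicator A w * g w \<partial>M)"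
proof -
  let ?m = "\<lambda>A. ennreal (l A)"
  have l_empty: "l {} = 0" using add[of "{}" "{}"] by simp
  define N where "N = measure_of (space M) (sets M) ?m"
  have pos: "positive (sets M) ?m" by (simp add: positive_def l_empty)
  \<comment> \<open>For a finite additive function countable additivity is continuity at the empty
    set, and the bound by a positive power of the measure provides it.\<close>
  have "countably_additive (sets M) ?m"
  proof (rule sets.empty_continuous_imp_countably_additive[OF pos])
    show "additive (sets M) ?m"
      using l0 add by (auto simp: additive_def ennreal_plus[symmetric] simp del: ennreal_plus)
    fix A :: "nat \<Rightarrow> 'a set" assume A: "range A \<subseteq> sets M" "decseq A" "(\<Inter>i. A i) = {}"
    have "(\<lambda>i. measure M (A i)) \<longlonglongrightarrow> measure M (\<Inter>i. A i)"
      using A by (intro finite_Lim_measure_decseq) auto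
    then have "(\<lambda>i. measure M (A i)) \<longlonglongrightarrow> 0" using A by simp
    then have "(\<lambda>i. measure M (A i) powr r) \<longlonglongrightarrow> 0 powr r"
      using r by (intro tendsto_powr') auto
    then have "(\<lambda>i. C * measure M (A i) powr r) \<longlonglongrightarrow> 0"
      using tendsto_mult_right_zero[of "\<lambda>i. measure M (A i) powr r" sequentially C] by simp
    then have "(\<lambda>i. l (A i)) \<longlonglongrightarrow> 0"
      using l0 lC A(1) by (intro tendsto_sandwich[OF _ _ tendsto_const, of 0 "\<lambda>i. l (A i)"] always_eventually) auto
    then show "(\<lambda>i. ?m (A i)) \<longlonglongrightarrow> 0"
      using tendsto_ennrealI by fastforce
  qed simp
  then have N: "emeasure N A = ?m A" if "A \<in> sets M" for A
    using that pos sets.sigma_algebra_axioms unfolding N_def by (intro emeasure_measure_of_sigma)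
  have sN: "sets N = sets M" by (simp add: N_def)
  \<comment> \<open>The same bound gives absolute continuity, since
    \<open>0 powr r = 0\<close>.\<close>
  have "absolutely_continuous M N"
    unfolding absolutely_continuous_def
  proof safe
    fix A assume A: "A \<in> null_sets M"
    then have "l A \<le> C * 0 powr r" using lC[of A] by (auto simp: null_sets_def measure_def)
    then have "l A \<le> 0" by simp
    then show "A \<in> null_sets N" using A N[of A] by (auto simp: null_sets_def sN ennreal_eq_0_iff)
  qed
  from Radon_Nikodym[OF this sN] obtain f where
    f [measurable]: "f \<in> borel_measurable M" and fN: "density M f = N" by blast
  have int: "(\<integral>\<^sup>+w. f w * indicator A w \<partial>M) = ?m A" if "A \<in> sets M" for A
    using N[OF that] that unfolding fN[symmetric] by (simp add: emeasure_density)
  have "(\<integral>\<^sup>+w. f w \<partial>M) = (\<integral>\<^sup>+w. f w * indicator (space M) w \<partial>M)"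
    by (intro nn_integral_cong) auto
  then have fin: "(\<integral>\<^sup>+w. f w \<partial>M) = ?m (space M)" using int[OF sets.top] by (rule trans)
  have AEf: "AE w in M. f w \<noteq> \<infinity>" by (rule nn_integral_PInf_AE) (simp_all add: fin)
  define g where "g = (\<lambda>w. enn2real (f w))"
  have AEg: "AE w in M. ennreal (g w) = f w"
    using AEf by eventually_elim (simp add: g_def less_top)
  have [measurable]: "g \<in> borel_measurable M" by (simp add: g_def)
  have "(\<integral>\<^sup>+w. ennreal (g w) \<partial>M) = ?m (space M)"
    unfolding fin[symmetric] by (rule nn_integral_cong_AE[OF AEg])
  then have ig: "integrable M g" by (intro integrableI_nonneg) (auto simp: g_def)
  have "l A = (\<integral>w. indicator A w * g w \<partial>M)" if A [measurable]: "A \<in> sets M" for A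
  proof -
    have "(\<integral>\<^sup>+w. ennreal (indicator A w * g w) \<partial>M) = (\<integral>\<^sup>+w. f w * indicator A w \<partial>M)"
      by (rule nn_integral_cong_AE, use AEg in eventually_elim) (auto simp: indicator_def)
    then have "(\<integral>w. indicator A w * g w \<partial>M) = enn2real (?m A)"
      using int[OF A] by (subst integral_eq_nn_integral) (auto simp: g_def)
    then show ?thesis using l0[OF A] by simp
  qed
  with ig that show ?thesis by (auto simp: g_def)
qed

text \<open>Jordan decomposition: the positive variation \<open>m A\<close> is the supremum of \<open>l\<close> over the measurable
  subsets of \<open>A\<close>, and both \<open>m\<close> and \<open>m - l\<close> have densities.\<close>

lemma (in finite_measure) additive_density:
  fixes l :: "'a set \<Rightarrow> real"
  assumes r: "0 < r" and C: "0 \<le> C"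
    and lC: "\<And>A. A \<in> sets M \<Longrightarrow> \<bar>l A\<bar> \<le> C * measure M A powr r"
    and add: "\<And>A B. A \<in> sets M \<Longrightarrow> B \<in> sets M \<Longrightarrow> A \<inter> B = {} \<Longrightarrow> l (A \<union> B) = l A + l B"
  obtains g :: "'a \<Rightarrow> real" where "integrable M g"
    "\<forall>A\<in>sets M. l A = (\<integral>w. indicator A w * g w \<partial>M)"
proof -
  define m where "m = (\<lambda>A. SUP B\<in>{B\<in>sets M. B \<subseteq> A}. l B)"
  have l_empty: "l {} = 0" using add[of "{}" "{}"] by simp
  have lC': "l B \<le> C * measure M A powr r" if "A \<in> sets M" "B \<in> sets M" "B \<subseteq> A" for A B
  proof -
    have "l B \<le> C * measure M B powr r" using lC[OF that(2)] by linarith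
    also have "\<dots> \<le> C * measure M A powr r"
      using that C r by (intro mult_left_mono powr_mono2 finite_measure_mono) auto
    finally show ?thesis .
  qed
  have bdd: "bdd_above (l ` {B\<in>sets M. B \<subseteq> A})" if "A \<in> sets M" for A
    using lC'[OF that] by (intro bdd_aboveI[of _ "C * measure M A powr r"]) auto
  have up: "l B \<le> m A" if "A \<in> sets M" "B \<in> sets M" "B \<subseteq> A" for A B
    unfolding m_def using that bdd by (intro cSUP_upper) auto
  have least: "m A \<le> c" if "A \<in> sets M" "\<And>B. B \<in> sets M \<Longrightarrow> B \<subseteq> A \<Longrightarrow> l B \<le> c" for A c
    unfolding m_def using that by (intro cSUP_least) auto
  have m0: "0 \<le> m A" if "A \<in> sets M" for A using up[OF that, of "{}"] l_empty by simp
  have mC: "m A \<le> C * measure M A powr r" if "A \<in> sets M" for A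
    using that lC'[OF that] by (intro least)
  have madd: "m (A \<union> B) = m A + m B" if AB: "A \<in> sets M" "B \<in> sets M" "A \<inter> B = {}" for A B
  proof (rule antisym)
    show "m (A \<union> B) \<le> m A + m B"
    proof (rule least)
      fix D assume D: "D \<in> sets M" "D \<subseteq> A \<union> B"
      have "l D = l ((D \<inter> A) \<union> (D \<inter> B))" using D by (intro arg_cong[of _ _ l]) auto
      also have "\<dots> = l (D \<inter> A) + l (D \<inter> B)" using D AB by (intro add) auto
      also have "\<dots> \<le> m A + m B" using D AB by (intro add_mono up) auto
      finally show "l D \<le> m A + m B" .
    qed (use AB in auto)
    \<comment> \<open>Superadditivity: subsets \<open>D\<close> of \<open>A\<close> and
      \<open>E\<close> of \<open>B\<close> are disjoint and their union competes for the supremum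
      over \<open>A \<union> B\<close>. The two suprema are taken one after the other.\<close>
    have "m A \<le> m (A \<union> B) - m B"
    proof (rule least)
      fix D assume D: "D \<in> sets M" "D \<subseteq> A"
      have "m B \<le> m (A \<union> B) - l D"
      proof (rule least)
        fix E assume E: "E \<in> sets M" "E \<subseteq> B"
        have "l D + l E = l (D \<union> E)" using D E AB by (intro add[symmetric]) auto
        also have "\<dots> \<le> m (A \<union> B)" using D E AB by (intro up) auto
        finally show "l E \<le> m (A \<union> B) - l D" by simp
      qed (use AB in auto)
      then show "l D \<le> m (A \<union> B) - m B" by simp
    qed (use AB in auto)
    then show "m A + m B \<le> m (A \<union> B)" by simp
  qed
  obtain g where g: "integrable M g" "\<forall>w. 0 \<le> g w" "\<forall>A\<in>sets M. m A = (\<integral>w. indicator A w * g w \<partial>M)"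
    by (rule additive_density_nonneg[OF r, of m C]) (use m0 mC madd in auto)
  obtain h where h: "integrable M h" "\<forall>w. 0 \<le> h w"
      "\<forall>A\<in>sets M. m A - l A = (\<integral>w. indicator A w * h w \<partial>M)"
  \<comment> \<open>The constant doubles because \<open>m A\<close> and \<open>- l A\<close> are
    each at most \<open>C * measure M A powr r\<close>.\<close>
  proof (rule additive_density_nonneg[OF r, of "\<lambda>A. m A - l A" "2 * C"])
    fix A assume A: "A \<in> sets M"
    show "0 \<le> m A - l A" using up[OF A A] by simp
    show "m A - l A \<le> 2 * C * measure M A powr r" using mC[OF A] lC[OF A] by linarith
  qed (use madd add in auto)
  have "l A = (\<integral>w. indicator A w * (g w - h w) \<partial>M)" if A: "A \<in> sets M" for A
  proof -
    have ig: "integrable M (\<lambda>w. indicator A w * g w)" "integrable M (\<lambda>w. indicator A w * h w)"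
      using g h A by (auto intro!: integrable_real_mult_indicator simp: mult.commute[of "indicator A _"])
    have "l A = m A - (m A - l A)" by simp
    also have "\<dots> = (\<integral>w. indicator A w * g w \<partial>M) - (\<integral>w. indicator A w * h w \<partial>M)"
      using g(3) h(3) A by simp
    also have "\<dots> = (\<integral>w. indicator A w * (g w - h w) \<partial>M)"
      using ig by (simp add: right_diff_distrib)
    finally show ?thesis .
  qed
  then show ?thesis using that[of "\<lambda>w. g w - h w"] g h by auto
qed

section \<open>The spaces \<open>L\<^sup>p(S)\<close>\<close>

context random_normed_module
begin

abbreviation Lp where "Lp p \<equiv> Lp_space G p S"

lemma Lp_simps [simp]:
  "add (Lp p) = add S" "zero (Lp p) = zero S" "c \<odot>\<^bsub>Lp p\<^esub> x = sm (\<lambda>_. c) x"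
  by (simp_all add: Lp_space_def sm_def)

lemma nnorm_Lp: "nnorm (Lp p) x =
    enn2real (ennreal_powr (\<integral>\<^sup>+ w. ennreal (N x w powr p) \<partial>G) (1 / p))"
  by (simp add: Lp_space_def Lp_norm_def N_def)

lemma Lp_carrier_iff:
  "x \<in> carrier (Lp p) \<longleftrightarrow> x \<in> carrier S \<and> (\<integral>\<^sup>+ w. ennreal (N x w powr p) \<partial>G) < \<top>"
  by (auto simp: Lp_space_def Lp_norm_def N_def ennreal_powr_def less_top)

lemma Lp_carrierD: "x \<in> carrier (Lp p) \<Longrightarrow> x \<in> carrier S"
  by (simp add: Lp_carrier_iff)

lemma nnorm_Lp_nonneg: "0 \<le> nnorm (Lp p) x"
  by (simp add: nnorm_Lp)

lemma Lp_integral: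
  assumes "x \<in> carrier (Lp p)" "1 < p"
  shows "(\<integral>\<^sup>+ w. ennreal (N x w powr p) \<partial>G) = ennreal (nnorm (Lp p) x powr p)"
  using assms by (auto simp: nnorm_Lp Lp_carrier_iff ennreal_powr_def powr_powr)

lemma LpI:
  assumes "x \<in> carrier S" "1 < p" "0 \<le> A" "(\<integral>\<^sup>+ w. ennreal (N x w powr p) \<partial>G) \<le> ennreal (A powr p)"
  shows "x \<in> carrier (Lp p)" "nnorm (Lp p) x \<le> A"
proof -
  show x: "x \<in> carrier (Lp p)" using assms by (auto simp: Lp_carrier_iff less_top[symmetric] top_unique)
  have "nnorm (Lp p) x powr p \<le> A powr p"
    using assms(4) unfolding Lp_integral[OF x assms(2)] by (auto simp: ennreal_le_iff2)
  then show "nnorm (Lp p) x \<le> A"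
    using assms(2,3) powr_less_mono2[of p A "nnorm (Lp p) x"] by linarith
qed

lemma LpI_AE:
  assumes x: "x \<in> carrier S" and p: "1 < p" and A: "0 \<le> A"
    and le: "AE w in G. N x w \<le> h w" and h: "(\<integral>\<^sup>+ w. ennreal (h w powr p) \<partial>G) \<le> ennreal (A powr p)"
  shows "x \<in> carrier (Lp p)" "nnorm (Lp p) x \<le> A"
proof -
  have "(\<integral>\<^sup>+ w. ennreal (N x w powr p) \<partial>G) \<le> (\<integral>\<^sup>+ w. ennreal (h w powr p) \<partial>G)"
    using AE_N_nonneg[OF x] le
    by (intro nn_integral_mono_AE, eventually_elim) (use p in \<open>auto intro!: ennreal_leI powr_mono2\<close>)
  then have *: "(\<integral>\<^sup>+ w. ennreal (N x w powr p) \<partial>G) \<le> ennreal (A powr p)" using h by (rule order_trans)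
  show "x \<in> carrier (Lp p)" "nnorm (Lp p) x \<le> A" using LpI[OF x p A *] by simp_all
qed

text \<open>Total mass 1 gives the constant \<open>B\<close> the \<open>p\<close>-norm
  \<open>B\<close>.\<close>

lemma bounded_in_Lp:
  assumes x: "x \<in> carrier S" and p: "1 < p" and B: "0 \<le> B" and le: "AE w in G. N x w \<le> B"
  shows "x \<in> carrier (Lp p)" "nnorm (Lp p) x \<le> B"
  using LpI_AE[OF x p B le] by (simp_all add: emeasure_space_1)

lemma Lp_add:
  assumes x: "x \<in> carrier (Lp p)" and y: "y \<in> carrier (Lp p)" and p: "1 < p"
  shows "x \<oplus> y \<in> carrier (Lp p)"
    and "nnorm (Lp p) (x \<oplus> y) \<le> nnorm (Lp p) x + nnorm (Lp p) y"
proof -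
  have xS: "x \<in> carrier S" "y \<in> carrier S" using x y by (simp_all add: Lp_carrierD)
  have "(\<integral>\<^sup>+ w. ennreal ((N x w + N y w) powr p) \<partial>G)
      \<le> ennreal ((nnorm (Lp p) x + nnorm (Lp p) y) powr p)"
    using xS p by (intro nn_integral_Minkowski AE_N_nonneg nnorm_Lp_nonneg)
      (simp_all add: Lp_integral[OF x p] Lp_integral[OF y p])
  from LpI_AE[OF M.a_closed[OF xS] p _ AE_N_add[OF xS] this]
  show "x \<oplus> y \<in> carrier (Lp p)" "nnorm (Lp p) (x \<oplus> y) \<le> nnorm (Lp p) x + nnorm (Lp p) y"
    by (simp_all add: nnorm_Lp_nonneg)
qed

lemma Lp_sm:
  assumes a [measurable]: "a \<in> borel_measurable G" and x: "x \<in> carrier (Lp p)" and p: "1 < p"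
    and B: "0 \<le> B" and le: "AE w in G. norm (a w) \<le> B"
  shows "sm a x \<in> carrier (Lp p)" "nnorm (Lp p) (sm a x) \<le> B * nnorm (Lp p) x"
proof -
  have xS: "x \<in> carrier S" using x by (simp add: Lp_carrierD)
  note [measurable] = N_measurable[OF xS]
  have 1: "AE w in G. N (sm a x) w \<le> B * N x w"
    using AE_N_sm[OF a xS] AE_N_nonneg[OF xS] le by eventually_elim (simp add: mult_right_mono)
  have "(\<integral>\<^sup>+ w. ennreal ((B * N x w) powr p) \<partial>G) = (\<integral>\<^sup>+ w. ennreal (B powr p) * ennreal (N x w powr p) \<partial>G)"
    using AE_N_nonneg[OF xS]
    by (intro nn_integral_cong_AE, eventually_elim) (use B in \<open>simp add: powr_mult ennreal_mult\<close>)
  also have "\<dots> = ennreal ((B * nnorm (Lp p) x) powr p)"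
    using B by (simp add: nn_integral_cmult Lp_integral[OF x p] powr_mult nnorm_Lp_nonneg ennreal_mult)
  finally have 2: "(\<integral>\<^sup>+ w. ennreal ((B * N x w) powr p) \<partial>G) \<le> ennreal ((B * nnorm (Lp p) x) powr p)"
    by simp
  show "sm a x \<in> carrier (Lp p)" "nnorm (Lp p) (sm a x) \<le> B * nnorm (Lp p) x"
    using LpI_AE[OF sm_closed[OF a xS] p _ 1 2] B by (simp_all add: nnorm_Lp_nonneg)
qed

text \<open>Dominated convergence with majorant \<open>B powr p * N x w powr p\<close>. It lets a
  bounded functional follow multipliers to their pointwise limits: from simple functions to bounded
  ones, and from truncations of \<open>x\<close> to \<open>x\<close>.\<close>

lemma Lp_sm_tendsto_0:
  assumes a [measurable]: "\<And>i::nat. a i \<in> borel_measurable G" and x: "x \<in> carrier (Lp p)" and p: "1 < p"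
    and B: "0 \<le> B" and le: "\<And>i. AE w in G. norm (a i w) \<le> B"
    and lim: "AE w in G. (\<lambda>i. a i w) \<longlonglongrightarrow> 0"
  shows "(\<lambda>i. nnorm (Lp p) (sm (a i) x)) \<longlonglongrightarrow> 0"
proof -
  have xS: "x \<in> carrier S" using x by (simp add: Lp_carrierD)
  note [measurable] = N_measurable[OF xS] N_measurable[OF sm_closed[OF a xS]]
  have "(\<lambda>i. \<integral>\<^sup>+ w. ennreal (N (sm (a i) x) w powr p) \<partial>G) \<longlonglongrightarrow> (\<integral>\<^sup>+ w. 0 \<partial>G)"
  proof (rule nn_integral_dominated_convergence[where w = "\<lambda>w. ennreal (B powr p) * ennreal (N x w powr p)"])
    show "(\<integral>\<^sup>+ w. ennreal (B powr p) * ennreal (N x w powr p) \<partial>G) < \<infinity>"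
      by (simp add: nn_integral_cmult Lp_integral[OF x p] ennreal_mult_less_top)
    show "AE w in G. ennreal (N (sm (a i) x) w powr p) \<le> ennreal (B powr p) * ennreal (N x w powr p)" for i
      using AE_N_sm[OF a xS, of i] AE_N_nonneg[OF xS] le[of i]
    proof eventually_elim
      case (elim w)
      have "(norm (a i w) * N x w) powr p \<le> (B * N x w) powr p"
        using elim p by (intro powr_mono2 mult_right_mono) auto
      also have "\<dots> = B powr p * N x w powr p" using elim B by (simp add: powr_mult)
      finally show ?case using elim by (simp add: ennreal_mult[symmetric])
    qed
    have "AE w in G. \<forall>i. N (sm (a i) x) w = norm (a i w) * N x w"
      using AE_N_sm[OF a xS] by (simp add: AE_all_countable)
    then show "AE w in G. (\<lambda>i. ennreal (N (sm (a i) x) w powr p)) \<longlonglongrightarrow> 0"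
      using AE_N_nonneg[OF xS] lim
    proof eventually_elim
      case (elim w)
      have "(\<lambda>i. (norm (a i w) * N x w) powr p) \<longlonglongrightarrow> (norm (0::'k) * N x w) powr p"
        using elim p by (intro tendsto_powr' tendsto_intros) auto
      then show ?case using elim p tendsto_ennrealI by fastforce
    qed
  qed auto
  then have "(\<lambda>i. ennreal (nnorm (Lp p) (sm (a i) x) powr p)) \<longlonglongrightarrow> 0"
    using Lp_integral[OF Lp_sm(1)[OF a x p B le] p] by simp
  then have "(\<lambda>i. nnorm (Lp p) (sm (a i) x) powr p) \<longlonglongrightarrow> 0"
    using tendsto_ennreal_iff[of "\<lambda>i. nnorm (Lp p) (sm (a i) x) powr p" sequentially 0] by simp
  then have "(\<lambda>i. (nnorm (Lp p) (sm (a i) x) powr p) powr (1 / p)) \<longlonglongrightarrow> 0 powr (1 / p)"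
    using p by (intro tendsto_powr') auto
  then show ?thesis using p by (simp add: powr_powr nnorm_Lp_nonneg)
qed

end

text \<open>The conjugate of the phase of \<open>z\<close>, written as a quotient so that one
  formula serves the real and the complex field.\<close>

definition unit_of :: "'k::real_normed_field \<Rightarrow> 'k" where
  "unit_of z = (if z = 0 then 0 else of_real (norm z) / z)"

lemma unit_of: "unit_of z * z = of_real (norm z)" "norm (unit_of z) \<le> 1"
  by (auto simp: unit_of_def norm_divide)

lemma unit_of_measurable [measurable]:
  "(unit_of :: 'k::{real_normed_field, second_countable_topology} \<Rightarrow> 'k) \<in> borel_measurable borel"
proof -
  have "(\<lambda>z::'k. if z = 0 then 0 else of_real (norm z) * inverse z) \<in> borel_measurable borel"
    by measurable
  also have "(\<lambda>z::'k. if z = 0 then 0 else of_real (norm z) * inverse z) = unit_of"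
    by (auto simp: unit_of_def divide_inverse)
  finally show ?thesis .
qed

text \<open>Testing with \<open>v\<close> times the conjugate phase of \<open>d - d'\<close> turns
  the difference of the integrals into the integral of the nonnegative function
  \<open>v w * norm (d w - d' w)\<close>. The weight \<open>v\<close> may be as small as
  integrability of the products demands, so functions that are not integrable can be
  compared.\<close>

lemma AE_eq_of_test_integrals:
  fixes d d' :: "'w \<Rightarrow> 'k::{real_normed_field, euclidean_space}"
  assumes [measurable]: "d \<in> borel_measurable M" "d' \<in> borel_measurable M" "v \<in> borel_measurable M"
    and v: "\<And>w. 0 < (v w :: real)"
    and test: "\<And>a. a \<in> borel_measurable M \<Longrightarrow> (\<And>w. norm (a w) \<le> v w) \<Longrightarrow>
      integrable M (\<lambda>w. a w * d w) \<and> integrable M (\<lambda>w. a w * d' w) \<and>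
      (\<integral>w. a w * d w \<partial>M) = (\<integral>w. a w * d' w \<partial>M)"
  shows "AE w in M. d w = d' w"
proof -
  define a where "a = (\<lambda>w. of_real (v w) * unit_of (d w - d' w))"
  have [measurable]: "a \<in> borel_measurable M" by (simp add: a_def)
  have "norm (a w) \<le> v w" for w
    using v[of w] mult_left_mono[OF unit_of(2), of "v w" "d w - d' w"] by (simp add: a_def norm_mult)
  from test[OF _ this] have t: "integrable M (\<lambda>w. a w * d w)" "integrable M (\<lambda>w. a w * d' w)"
      "(\<integral>w. a w * d w \<partial>M) = (\<integral>w. a w * d' w \<partial>M)" by auto
  have "a w * d w - a w * d' w = of_real (v w * norm (d w - d' w))" for w
    using unit_of(1)[of "d w - d' w"] by (simp add: a_def right_diff_distrib[symmetric] mult.assoc)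
  then have eq: "(\<lambda>w. of_real (v w * norm (d w - d' w)) :: 'k) = (\<lambda>w. a w * d w - a w * d' w)"
    by auto
  have "integrable M (\<lambda>w. of_real (v w * norm (d w - d' w)) :: 'k)"
    unfolding eq using t by (intro Bochner_Integration.integrable_diff)
  from integrable_norm[OF this]
  have "integrable M (\<lambda>w. norm (of_real (v w * norm (d w - d' w)) :: 'k))" .
  moreover have "norm (of_real (v w * norm (d w - d' w)) :: 'k) = v w * norm (d w - d' w)" for w
    using v[of w] by (simp add: norm_mult)
  ultimately have i: "integrable M (\<lambda>w. v w * norm (d w - d' w))" by (simp only:)
  have "of_real (\<integral>w. v w * norm (d w - d' w) \<partial>M) = (\<integral>w. (of_real (v w * norm (d w - d' w)) :: 'k) \<partial>M)"
    by (rule integral_of_real[OF i, symmetric])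
  also have "\<dots> = 0" unfolding eq using t by (simp add: Bochner_Integration.integral_diff)
  finally have "(\<integral>w. v w * norm (d w - d' w) \<partial>M) = 0" by simp
  then have "AE w in M. v w * norm (d w - d' w) = 0"
    using integral_nonneg_eq_0_iff_AE[OF i] v by (simp add: less_imp_le)
  then show ?thesis
  proof eventually_elim
    case (elim w)
    then show ?case using v[of w] by simp
  qed
qed

section \<open>Representation of bounded functionals on \<open>L\<^sup>p(S)\<close>\<close>

text \<open>If \<open>a (1 + \<parallel>x\<parallel>)\<close> is bounded then \<open>a x\<close> lies in \<open>L\<^sup>p(S)\<close>; restricting the test functions
  \<open>a\<close> in this way gives every \<open>x\<close> a density, which need not be integrable.\<close>

definition test_density :: "'w measure \<Rightarrow> ('w, 'k, 'a) rn_module \<Rightarrow> ('a \<Rightarrow> 'k) \<Rightarrow> 'a \<Rightarrow>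
    ('w \<Rightarrow> 'k::{real_normed_field, euclidean_space}) \<Rightarrow> bool" where
  "test_density G S \<phi> x d \<longleftrightarrow> d \<in> borel_measurable G \<and> (\<forall>a\<in>borel_measurable G.
     (\<exists>B. AE w in G. norm (a w) * (1 + L0_rep (rnorm S x) w) \<le> B) \<longrightarrow>
     integrable G (\<lambda>w. a w * d w) \<and> \<phi> (L0_class G a \<odot>\<^bsub>S\<^esub> x) = (\<integral>w. a w * d w \<partial>G))"

context random_normed_module
begin

lemma test_densityD:
  assumes "test_density G S \<phi> x d"
  shows "d \<in> borel_measurable G"
    and "\<And>a B. a \<in> borel_measurable G \<Longrightarrow> AE w in G. norm (a w) * (1 + N x w) \<le> B \<Longrightarrow>
      integrable G (\<lambda>w. a w * d w)"
    and "\<And>a B. a \<in> borel_measurable G \<Longrightarrow> AE w in G. norm (a w) * (1 + N x w) \<le> B \<Longrightarrow>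
      \<phi> (sm a x) = (\<integral>w. a w * d w \<partial>G)"
  using assms unfolding test_density_def N_def[symmetric] sm_def[symmetric] by blast+

lemma AE_eq_of_test:
  fixes d d' :: "'w \<Rightarrow> 'k" and b :: "'w \<Rightarrow> real"
  assumes x: "x \<in> carrier S" and d [measurable]: "d \<in> borel_measurable G"
    and d' [measurable]: "d' \<in> borel_measurable G" and b [measurable]: "b \<in> borel_measurable G"
    and test: "\<And>a. a \<in> borel_measurable G \<Longrightarrow> AE w in G. norm (a w) * b w \<le> 1 \<Longrightarrow>
      integrable G (\<lambda>w. a w * d w) \<and> integrable G (\<lambda>w. a w * d' w) \<and>
      (\<integral>w. a w * d w \<partial>G) = (\<integral>w. a w * d' w \<partial>G)"
    and b0: "AE w in G. 0 < b w"
  shows "AE w in G. d w = d' w"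
proof (rule AE_eq_of_test_integrals[OF d d'])
  \<comment> \<open>The weight is the reciprocal of \<open>b\<close>; on the null set where
    \<open>b\<close> is not positive any positive value serves.\<close>
  let ?v = "\<lambda>w. if 0 < b w then 1 / b w else 1"
  show "?v \<in> borel_measurable G" by measurable
  show "0 < ?v w" for w by simp
  fix a :: "'w \<Rightarrow> 'k"
  assume a: "a \<in> borel_measurable G" and le: "\<And>w. norm (a w) \<le> ?v w"
  show "integrable G (\<lambda>w. a w * d w) \<and> integrable G (\<lambda>w. a w * d' w) \<and>
      (\<integral>w. a w * d w \<partial>G) = (\<integral>w. a w * d' w \<partial>G)"
  proof (rule test[OF a])
    show "AE w in G. norm (a w) * b w \<le> 1"
      using b0
    proof eventually_elim
      case (elim w)
      then show ?case using le[of w] by (simp add: field_simps)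
    qed
  qed
qed

section \<open>Densities of a bounded functional\<close>

context
  fixes p C :: real and \<phi> :: "'a \<Rightarrow> 'k"
  assumes p: "1 < p" and C: "0 \<le> C"
    and \<phi>_add: "\<And>x y. x \<in> carrier (Lp p) \<Longrightarrow> y \<in> carrier (Lp p) \<Longrightarrow> \<phi> (x \<oplus> y) = \<phi> x + \<phi> y"
    and \<phi>_smult: "\<And>c x. x \<in> carrier (Lp p) \<Longrightarrow> \<phi> (sm (\<lambda>_. c) x) = c * \<phi> x"
    and \<phi>_le: "\<And>x. x \<in> carrier (Lp p) \<Longrightarrow> norm (\<phi> x) \<le> C * nnorm (Lp p) x"
begin

lemma sm_in_Lp:
  assumes a: "a \<in> borel_measurable G" and x: "x \<in> carrier S"
    and le: "AE w in G. norm (a w) * (1 + N x w) \<le> B"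
  shows "sm a x \<in> carrier (Lp p)"
proof (rule bounded_in_Lp[OF sm_closed[OF a x] p])
  show "0 \<le> \<bar>B\<bar>" by simp
  show "AE w in G. N (sm a x) w \<le> \<bar>B\<bar>"
    using AE_N_sm[OF a x] AE_N_nonneg[OF x] le
  proof eventually_elim
    case (elim w)
    have "norm (a w) * N x w \<le> norm (a w) * (1 + N x w)" by (simp add: mult_left_mono)
    with elim show ?case by linarith
  qed
qed

text \<open>For \<open>x\<close> of norm at most 1 the element cut down to \<open>A\<close> has
  \<open>p\<close>-norm at most \<open>measure G A powr (1 / p)\<close>, so the set function is
  additive and bounded by a power of the measure, as \<open>additive_density\<close> requires.
  Densities are found for each coordinate of the scalar field and summed.\<close>

lemma density_on_sets:
  assumes x: "x \<in> carrier S" and x1: "AE w in G. N x w \<le> 1"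
  obtains g :: "'w \<Rightarrow> 'k" where "integrable G g"
    "\<forall>A\<in>sets G. \<phi> (sm (indicator A) x) = (\<integral>w. indicator A w * g w \<partial>G)"
proof -
  have inLp: "sm (indicator A) x \<in> carrier (Lp p)"
    and bound: "norm (\<phi> (sm (indicator A) x)) \<le> C * measure G A powr (1 / p)"
    if A [measurable]: "A \<in> sets G" for A
  proof -
    have mA: "(indicator A :: 'w \<Rightarrow> 'k) \<in> borel_measurable G" by simp
    have 1: "AE w in G. N (sm (indicator A) x) w \<le> indicator A w"
      using AE_N_sm[OF mA x] x1 AE_N_nonneg[OF x] by eventually_elim (auto simp: indicator_def)
    have "(\<integral>\<^sup>+ w. ennreal (indicator A w powr p) \<partial>G) = (\<integral>\<^sup>+ w. indicator A w \<partial>G)"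
      by (intro nn_integral_cong) (auto simp: indicator_def)
    also have "\<dots> = ennreal ((measure G A powr (1 / p)) powr p)"
      using p by (simp add: emeasure_eq_measure powr_powr)
    finally have 2: "(\<integral>\<^sup>+ w. ennreal (indicator A w powr p) \<partial>G) \<le> ennreal ((measure G A powr (1 / p)) powr p)"
      by simp
    note * = LpI_AE[OF sm_closed[OF mA x] p _ 1 2]
    show L: "sm (indicator A) x \<in> carrier (Lp p)" using * by simp
    have "norm (\<phi> (sm (indicator A) x)) \<le> C * nnorm (Lp p) (sm (indicator A) x)" by (rule \<phi>_le[OF L])
    also have "\<dots> \<le> C * measure G A powr (1 / p)" using * C by (intro mult_left_mono) auto
    finally show "norm (\<phi> (sm (indicator A) x)) \<le> C * measure G A powr (1 / p)" .
  qed
  have add: "\<phi> (sm (indicator (A \<union> B)) x) = \<phi> (sm (indicator A) x) + \<phi> (sm (indicator B) x)"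
    if AB: "A \<in> sets G" "B \<in> sets G" "A \<inter> B = {}" for A B
  proof -
    have "(indicator (A \<union> B) :: 'w \<Rightarrow> 'k) = (\<lambda>w. indicator A w + indicator B w)"
      using AB(3) by (auto simp: indicator_def fun_eq_iff)
    then have "sm (indicator (A \<union> B)) x = sm (indicator A) x \<oplus> sm (indicator B) x"
      using AB x by (simp add: sm_add)
    then show ?thesis using inLp AB by (simp add: \<phi>_add)
  qed
  have "\<exists>g. integrable G g \<and> (\<forall>A\<in>sets G. \<phi> (sm (indicator A) x) \<bullet> b = (\<integral>w. indicator A w * g w \<partial>G))"
    if b: "b \<in> Basis" for b
  proof -
    obtain g where "integrable G g" "\<forall>A\<in>sets G. \<phi> (sm (indicator A) x) \<bullet> b = (\<integral>w. indicator A w * g w \<partial>G)"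
    proof (rule additive_density[of "1 / p" C "\<lambda>A. \<phi> (sm (indicator A) x) \<bullet> b"])
      show "0 < 1 / p" using p by simp
      show "\<bar>\<phi> (sm (indicator A) x) \<bullet> b\<bar> \<le> C * measure G A powr (1 / p)" if "A \<in> sets G" for A
        using Basis_le_norm[OF b, of "\<phi> (sm (indicator A) x)"] bound[OF that] by linarith
    qed (use C add in \<open>auto simp: inner_add_left\<close>)
    then show ?thesis by blast
  qed
  then have "\<forall>b\<in>Basis. \<exists>g. integrable G g \<and>
      (\<forall>A\<in>sets G. \<phi> (sm (indicator A) x) \<bullet> b = (\<integral>w. indicator A w * g w \<partial>G))" by blast
  then obtain g where g: "\<And>b. b \<in> Basis \<Longrightarrow> integrable G (g b)"
    "\<And>b A. b \<in> Basis \<Longrightarrow> A \<in> sets G \<Longrightarrow> \<phi> (sm (indicator A) x) \<bullet> b = (\<integral>w. indicator A w * g b w \<partial>G)"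
    by (auto dest!: bchoice)
  define h where "h = (\<lambda>w. \<Sum>b\<in>Basis. g b w *\<^sub>R (b::'k))"
  have "integrable G h" unfolding h_def using g(1) by (intro Bochner_Integration.integrable_sum) auto
  moreover have "\<phi> (sm (indicator A) x) = (\<integral>w. indicator A w * h w \<partial>G)" if A: "A \<in> sets G" for A
  proof -
    have i: "integrable G (\<lambda>w. indicator A w * g b w)" if "b \<in> Basis" for b
      using integrable_real_mult_indicator[OF A g(1)[OF that]] by (simp add: mult.commute)
    have "(\<integral>w. indicator A w * h w \<partial>G) = (\<integral>w. (\<Sum>b\<in>Basis. (indicator A w * g b w) *\<^sub>R b) \<partial>G)"
      by (intro Bochner_Integration.integral_cong) (auto simp: h_def indicator_def)
    also have "\<dots> = (\<Sum>b\<in>Basis. (\<integral>w. indicator A w * g b w \<partial>G) *\<^sub>R b)"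
      using i by (subst Bochner_Integration.integral_sum) auto
    also have "\<dots> = (\<Sum>b\<in>Basis. (\<phi> (sm (indicator A) x) \<bullet> b) *\<^sub>R b)"
      using g(2) A by simp
    also have "\<dots> = \<phi> (sm (indicator A) x)" by (rule euclidean_representation)
    finally show ?thesis by simp
  qed
  ultimately show ?thesis using that by blast
qed

lemma density_simple:
  assumes x: "x \<in> carrier S" and x1: "AE w in G. N x w \<le> 1"
    and g: "integrable G g" "\<forall>A\<in>sets G. \<phi> (sm (indicator A) x) = (\<integral>w. indicator A w * g w \<partial>G)"
    and s: "simple_function G s"
  shows "integrable G (\<lambda>w. s w * g w)" "\<phi> (sm s x) = (\<integral>w. s w * g w \<partial>G)" 
proof -
  have xL: "x \<in> carrier (Lp p)" using bounded_in_Lp[OF x p _ x1] by simp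
  have gi: "integrable G (\<lambda>w. indicator A w * g w)" if A: "A \<in> sets G" for A
  proof -
    have "integrable G (\<lambda>w. indicator A w *\<^sub>R g w)" by (rule integrable_mult_indicator[OF A g(1)])
    moreover have "(\<lambda>w. indicator A w *\<^sub>R g w) = (\<lambda>w. indicator A w * g w)"
      by (auto simp: indicator_def)
    ultimately show ?thesis by simp
  qed
  \<comment> \<open>The normal form of a simple function, a sum over its values. Induction over the
    set of values works with arbitrary measurable sets \<open>A y\<close>, so that disjointness need
    not be carried along.\<close>
  define F where "F = (\<lambda>(A::'k \<Rightarrow> 'w set) (Y::'k set) w. \<Sum>y\<in>Y. indicator (A y) w * y)"
  have *: "integrable G (\<lambda>w. F A Y w * g w) \<and> sm (F A Y) x \<in> carrier (Lp p) \<and>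
      \<phi> (sm (F A Y) x) = (\<integral>w. F A Y w * g w \<partial>G)"
    if "finite Y" and A: "\<And>y. A y \<in> sets G" for Y :: "'k set" and A
    using \<open>finite Y\<close>
  proof (induction Y)
    case empty
    have F0: "F A {} = (\<lambda>w. 0)" by (simp add: F_def)
    have "sm (\<lambda>w. 0) x = sm (\<lambda>_. 0) (sm (\<lambda>_. 1) x)" using x by simp
    then have "\<phi> (sm (\<lambda>w. 0) x) = 0" using \<phi>_smult[OF xL, of 0] by simp
    moreover have "sm (\<lambda>w. 0) x \<in> carrier (Lp p)" using Lp_sm(1)[OF _ xL p, of "\<lambda>_. 0" 0] by simp
    ultimately show ?case by (simp add: F0)
  next
    case (insert y Y)
    let ?a = "\<lambda>w. indicator (A y) w * y"
    note [measurable] = A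
    have am: "?a \<in> borel_measurable G" by measurable
    have bm: "F A Y \<in> borel_measurable G" unfolding F_def by measurable
    have Fi: "F A (insert y Y) = (\<lambda>w. ?a w + F A Y w)"
      unfolding F_def sum.insert[OF insert.hyps(1,2)] ..
    have iL: "sm (indicator (A y)) x \<in> carrier (Lp p)"
      by (rule Lp_sm[OF _ xL p, of _ 1]) (auto simp: indicator_def)
    have "sm ?a x = sm (\<lambda>_. y) (sm (indicator (A y)) x)"
      using x A by (simp add: sm_mult mult.commute)
    moreover have "(\<integral>w. ?a w * g w \<partial>G) = (\<integral>w. y * (indicator (A y) w * g w) \<partial>G)"
      by (intro Bochner_Integration.integral_cong) (simp_all add: mult_ac)
    ultimately have a1: "\<phi> (sm ?a x) = (\<integral>w. ?a w * g w \<partial>G)" and a2: "sm ?a x \<in> carrier (Lp p)"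
      using \<phi>_smult[OF iL, of y] g(2) A Lp_sm(1)[OF _ iL p, of "\<lambda>_. y" "norm y"] gi[OF A]
      by simp_all
    have ai: "integrable G (\<lambda>w. ?a w * g w)"
      using integrable_mult_right[OF gi[OF A], of y] by (simp add: mult_ac)
    have smF: "sm (F A (insert y Y)) x = sm ?a x \<oplus> sm (F A Y) x"
      unfolding Fi by (rule sm_add[OF am bm x])
    have IH: "integrable G (\<lambda>w. F A Y w * g w)" "sm (F A Y) x \<in> carrier (Lp p)"
      "\<phi> (sm (F A Y) x) = (\<integral>w. F A Y w * g w \<partial>G)" using insert.IH by auto
    have "integrable G (\<lambda>w. ?a w * g w + F A Y w * g w)"
      using ai IH(1) by (rule Bochner_Integration.integrable_add)
    moreover have "(\<integral>w. ?a w * g w + F A Y w * g w \<partial>G) = \<phi> (sm ?a x) + \<phi> (sm (F A Y) x)"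
      unfolding a1 IH(3) using ai IH(1) by (rule Bochner_Integration.integral_add)
    ultimately show ?case
      unfolding smF \<phi>_add[OF a2 IH(2)] unfolding Fi distrib_right
      using Lp_add(1)[OF a2 IH(2) p] by simp
  qed
  define A where "A = (\<lambda>y. s -` {y} \<inter> space G)"
  have fin: "finite (s ` space G)" using s by (simp add: simple_function_def)
  have A: "A y \<in> sets G" for y unfolding A_def using s by (rule simple_functionD)
  have eq: "s w = F A (s ` space G) w" if "w \<in> space G" for w
  proof -
    have "F A (s ` space G) w = (\<Sum>y\<in>{s w}. indicator (A y) w * y)"
      unfolding F_def using that fin by (intro sum.mono_neutral_right) (auto simp: A_def)
    then show ?thesis using that by (simp add: A_def)
  qed
  have sms: "s \<in> borel_measurable G" by (rule borel_measurable_simple_function[OF s])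
  have "F A (s ` space G) \<in> borel_measurable G"
    using sms by (rule measurable_cong[THEN iffD1, rotated]) (rule eq)
  then have smeq: "sm s x = sm (F A (s ` space G)) x"
    using eq by (intro sm_cong sms AE_I2)
  have inteq: "(\<integral>w. s w * g w \<partial>G) = (\<integral>w. F A (s ` space G) w * g w \<partial>G)"
    using eq by (intro Bochner_Integration.integral_cong) auto
  have "integrable G (\<lambda>w. s w * g w) \<longleftrightarrow> integrable G (\<lambda>w. F A (s ` space G) w * g w)"
    using eq by (intro Bochner_Integration.integrable_cong) auto
  then show "integrable G (\<lambda>w. s w * g w)" "\<phi> (sm s x) = (\<integral>w. s w * g w \<partial>G)"
    using *[OF fin A] smeq inteq by simp_all
qed

text \<open>Approximation of \<open>a\<close> by simple functions. The integrals converge by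
  dominated convergence and the values of \<open>\<phi>\<close> because its arguments converge in
  \<open>p\<close>-norm, so the identity passes to the limit.\<close>

lemma density_bounded:
  assumes x: "x \<in> carrier S" and x1: "AE w in G. N x w \<le> 1"
    and g: "integrable G g" "\<forall>A\<in>sets G. \<phi> (sm (indicator A) x) = (\<integral>w. indicator A w * g w \<partial>G)"
    and a: "a \<in> borel_measurable G" and le: "AE w in G. norm (a w) \<le> B"
  shows "integrable G (\<lambda>w. a w * g w)" "\<phi> (sm a x) = (\<integral>w. a w * g w \<partial>G)" 
proof -
  have xL: "x \<in> carrier (Lp p)" using bounded_in_Lp[OF x p _ x1] by simp
  note [measurable] = a borel_measurable_integrable[OF g(1)]
  have leB: "AE w in G. norm (a w) \<le> \<bar>B\<bar>" using le by eventually_elim linarith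
  \<comment> \<open>The reference point 0 in the approximation theorem yields the bound by twice the
    norm of \<open>a\<close>.\<close>
  obtain s where s: "\<And>i. simple_function G (s i)" "\<And>w. w \<in> space G \<Longrightarrow> (\<lambda>i. s i w) \<longlonglongrightarrow> a w"
    "\<And>i w. w \<in> space G \<Longrightarrow> norm (s i w) \<le> 2 * norm (a w)"
    using borel_measurable_implies_sequence_metric[OF a, of 0] unfolding norm_conv_dist by metis
  have sm [measurable]: "s i \<in> borel_measurable G" for i by (rule borel_measurable_simple_function[OF s(1)])
  have domi: "AE w in G. norm (s i w * g w) \<le> 2 * \<bar>B\<bar> * norm (g w)" for i
    using leB AE_space
  proof eventually_elim
    case (elim w)
    then have "norm (s i w) \<le> 2 * \<bar>B\<bar>" using s(3)[of w i] by linarith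
    then show ?case by (simp add: norm_mult mult_right_mono)
  qed
  have ptw: "AE w in G. (\<lambda>i. s i w * g w) \<longlonglongrightarrow> a w * g w"
    by (rule AE_I2) (intro tendsto_intros s)
  have domint: "integrable G (\<lambda>w. 2 * \<bar>B\<bar> * norm (g w))"
    using g(1) by (intro integrable_mult_right integrable_norm)
  show "integrable G (\<lambda>w. a w * g w)"
    by (rule integrable_dominated_convergence[OF _ _ domint ptw domi]) auto
  have lim1: "(\<lambda>i. \<integral>w. s i w * g w \<partial>G) \<longlonglongrightarrow> (\<integral>w. a w * g w \<partial>G)"
    by (rule integral_dominated_convergence[OF _ _ domint ptw domi]) auto
  have "(\<lambda>i. nnorm (Lp p) (sm (\<lambda>w. s i w - a w) x)) \<longlonglongrightarrow> 0"
  proof (rule Lp_sm_tendsto_0[OF _ xL p])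
    \<comment> \<open>Twice \<bar>B\<bar> from \<open>s i\<close> and once from
      \<open>a\<close>.\<close>
    show "AE w in G. norm (s i w - a w) \<le> 3 * \<bar>B\<bar>" for i
      using leB AE_space
    proof eventually_elim
      case (elim w)
      then show ?case using s(3)[of w i] norm_triangle_ineq4[of "s i w" "a w"] by linarith
    qed
    show "AE w in G. (\<lambda>i. s i w - a w) \<longlonglongrightarrow> 0"
      by (rule AE_I2) (use s(2) LIM_zero in blast)
  qed auto
  from tendsto_mult_right_zero[OF this, of C]
  have lim0: "(\<lambda>i. C * nnorm (Lp p) (sm (\<lambda>w. s i w - a w) x)) \<longlonglongrightarrow> 0" .
  have aL: "sm a x \<in> carrier (Lp p)" by (rule Lp_sm(1)[OF a xL p _ leB]) simp
  have "norm (\<phi> (sm (s i) x) - \<phi> (sm a x)) \<le> C * nnorm (Lp p) (sm (\<lambda>w. s i w - a w) x)" for i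
  proof -
    have dL: "sm (\<lambda>w. s i w - a w) x \<in> carrier (Lp p)"
    proof (rule Lp_sm(1)[OF _ xL p])
      show "AE w in G. norm (s i w - a w) \<le> 3 * \<bar>B\<bar>"
        using leB AE_space
      proof eventually_elim
        case (elim w)
        then show ?case using s(3)[of w i] norm_triangle_ineq4[of "s i w" "a w"] by linarith
      qed
    qed auto
    have "sm (s i) x = sm (\<lambda>w. (s i w - a w) + a w) x" by simp
    also have "\<dots> = sm (\<lambda>w. s i w - a w) x \<oplus> sm a x"
      using x by (intro sm_add) auto
    finally have "\<phi> (sm (s i) x) - \<phi> (sm a x) = \<phi> (sm (\<lambda>w. s i w - a w) x)"
      using \<phi>_add[OF dL aL] by simp
    then show ?thesis using \<phi>_le[OF dL] by simp
  qed
  then have "(\<lambda>i. \<phi> (sm (s i) x) - \<phi> (sm a x)) \<longlonglongrightarrow> 0"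
    by (intro Lim_null_comparison[OF always_eventually lim0]) auto
  then have "(\<lambda>i. \<phi> (sm (s i) x)) \<longlonglongrightarrow> \<phi> (sm a x)" by (rule LIM_zero_cancel)
  moreover have "\<phi> (sm (s i) x) = (\<integral>w. s i w * g w \<partial>G)" for i
    by (rule density_simple(2)[OF x x1 g s(1)])
  ultimately show "\<phi> (sm a x) = (\<integral>w. a w * g w \<partial>G)" using lim1 LIMSEQ_unique by fastforce
qed

text \<open>Division by \<open>1 + \<bar>N x w\<bar>\<close> gives an element \<open>y\<close> of
  norm at most 1, whose density \<open>g\<close> is integrable. Multiplying back yields the density
  of \<open>x\<close>: an admissible test function \<open>a\<close> for \<open>x\<close> corresponds
  to the bounded function \<open>?b\<close> for \<open>y\<close>.\<close>

lemma test_density_exists: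
  assumes x: "x \<in> carrier S"
  shows "\<exists>d. test_density G S \<phi> x d"
proof -
  note [measurable] = N_measurable[OF x]
  define c where "c = (\<lambda>w. of_real (1 / (1 + \<bar>N x w\<bar>)) :: 'k)"
  have c [measurable]: "c \<in> borel_measurable G" by (simp add: c_def)
  have nc: "norm (c w) = 1 / (1 + \<bar>N x w\<bar>)" for w
    unfolding c_def norm_of_real by simp
  define y where "y = sm c x"
  have y: "y \<in> carrier S" using c x by (simp add: y_def)
  have y1: "AE w in G. N y w \<le> 1"
    unfolding y_def using AE_N_sm[OF c x] AE_N_nonneg[OF x]
    by eventually_elim (simp add: nc)
  obtain g where g: "integrable G g"
      "\<forall>A\<in>sets G. \<phi> (sm (indicator A) y) = (\<integral>w. indicator A w * g w \<partial>G)"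
    by (rule density_on_sets[OF y y1])
  note [measurable] = borel_measurable_integrable[OF g(1)]
  define d where "d = (\<lambda>w. of_real (1 + \<bar>N x w\<bar>) * g w)"
  have "test_density G S \<phi> x d"
    unfolding test_density_def N_def[symmetric] sm_def[symmetric]
  proof (intro conjI ballI impI)
    show "d \<in> borel_measurable G" by (simp add: d_def)
    fix a :: "'w \<Rightarrow> 'k"
    assume a [measurable]: "a \<in> borel_measurable G" and "\<exists>B. AE w in G. norm (a w) * (1 + N x w) \<le> B"
    then obtain B where B: "AE w in G. norm (a w) * (1 + N x w) \<le> B" by blast
    let ?b = "\<lambda>w. a w * of_real (1 + \<bar>N x w\<bar>)"
    have b: "?b \<in> borel_measurable G" by measurable
    have bB: "AE w in G. norm (?b w) \<le> B"
      using B AE_N_nonneg[OF x] by eventually_elim (simp add: norm_mult del: of_real_add)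
    note db = density_bounded[OF y y1 g b bB]
    have nz: "(of_real (1 + \<bar>N x w\<bar>) :: 'k) \<noteq> 0" for w
      unfolding of_real_eq_0_iff by linarith
    have "sm ?b y = sm a x"
    proof -
      have "sm ?b y = sm (\<lambda>w. ?b w * c w) x" unfolding y_def by (rule sm_mult[OF b c x])
      also have "(\<lambda>w. ?b w * c w) = a"
        using nz by (simp add: c_def mult.assoc del: of_real_add)
      finally show ?thesis .
    qed
    then show "integrable G (\<lambda>w. a w * d w)" "\<phi> (sm a x) = (\<integral>w. a w * d w \<partial>G)"
      using db by (simp_all add: d_def mult.assoc)
  qed
  then show ?thesis by (rule exI[of _ d])
qed

text \<open>Uniqueness of densities. The three weights are added in \<open>?b\<close>, so that a
  single family of test functions is admissible for \<open>x\<close>, \<open>y\<close> and their sum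
  at once.\<close>

lemma test_density_add:
  assumes x: "x \<in> carrier S" and y: "y \<in> carrier S"
    and dx: "test_density G S \<phi> x dx" and dy: "test_density G S \<phi> y dy"
    and dz: "test_density G S \<phi> (x \<oplus> y) dz"
  shows "AE w in G. dz w = dx w + dy w"
proof (rule AE_eq_of_test[OF x])
  let ?b = "\<lambda>w. (1 + N x w) + (1 + N y w) + (1 + N (x \<oplus> y) w)"
  have z: "x \<oplus> y \<in> carrier S" using x y by simp
  show "dz \<in> borel_measurable G" "(\<lambda>w. dx w + dy w) \<in> borel_measurable G"
    using test_densityD(1) dx dy dz by (auto intro!: borel_measurable_add)
  show "?b \<in> borel_measurable G" using x y z by (intro borel_measurable_add) auto
  show "AE w in G. 0 < ?b w"
    using AE_N_nonneg[OF x] AE_N_nonneg[OF y] AE_N_nonneg[OF z] by eventually_elim simp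
  fix a :: "'w \<Rightarrow> 'k"
  assume a: "a \<in> borel_measurable G" and le: "AE w in G. norm (a w) * ?b w \<le> 1"
  have "AE w in G. norm (a w) * (1 + N x w) \<le> 1 \<and> norm (a w) * (1 + N y w) \<le> 1 \<and>
      norm (a w) * (1 + N (x \<oplus> y) w) \<le> 1"
    using AE_N_nonneg[OF x] AE_N_nonneg[OF y] AE_N_nonneg[OF z] le
  proof eventually_elim
    case (elim w)
    have "norm (a w) * (1 + N x w) \<le> norm (a w) * ?b w" "norm (a w) * (1 + N y w) \<le> norm (a w) * ?b w"
      "norm (a w) * (1 + N (x \<oplus> y) w) \<le> norm (a w) * ?b w"
      using elim by (intro mult_left_mono; simp)+
    with elim show ?case by linarith
  qed
  then have bx: "AE w in G. norm (a w) * (1 + N x w) \<le> 1" and by': "AE w in G. norm (a w) * (1 + N y w) \<le> 1"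
    and bz: "AE w in G. norm (a w) * (1 + N (x \<oplus> y) w) \<le> 1" by auto
  note tx = test_densityD(2,3)[OF dx a bx] and ty = test_densityD(2,3)[OF dy a by']
    and tz = test_densityD(2,3)[OF dz a bz]
  have "\<phi> (sm a (x \<oplus> y)) = \<phi> (sm a x) + \<phi> (sm a y)"
    using \<phi>_add[OF sm_in_Lp[OF a x bx] sm_in_Lp[OF a y by']] by (simp add: sm_add_right[OF a x y])
  then show "integrable G (\<lambda>w. a w * dz w) \<and> integrable G (\<lambda>w. a w * (dx w + dy w)) \<and>
      (\<integral>w. a w * dz w \<partial>G) = (\<integral>w. a w * (dx w + dy w) \<partial>G)"
    using tx ty tz by (simp add: distrib_left)
qed

lemma test_density_sm:
  assumes x: "x \<in> carrier S" and b: "b \<in> borel_measurable G"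
    and dx: "test_density G S \<phi> x dx" and dz: "test_density G S \<phi> (sm b x) dz"
  shows "AE w in G. dz w = b w * dx w"
proof (rule AE_eq_of_test[OF x])
  \<comment> \<open>Dominates both \<open>1 + N (sm b x) w\<close> and
    \<open>norm (b w) * (1 + N x w)\<close>: then \<open>a\<close> is admissible for
    \<open>sm b x\<close> and the product of \<open>a\<close> and \<open>b\<close> for
    \<open>x\<close>.\<close>
  let ?c = "\<lambda>w. (1 + N (sm b x) w) + (1 + N x w) * (1 + norm (b w))"
  have z: "sm b x \<in> carrier S" using x b by simp
  note [measurable] = b N_measurable[OF x] N_measurable[OF z] test_densityD(1)[OF dx]
  show "dz \<in> borel_measurable G" by (rule test_densityD(1)[OF dz])
  show "(\<lambda>w. b w * dx w) \<in> borel_measurable G" by measurable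
  show "?c \<in> borel_measurable G" by measurable
  show "AE w in G. 0 < ?c w"
    using AE_N_nonneg[OF x] AE_N_nonneg[OF z]
    by eventually_elim (auto intro!: add_pos_nonneg mult_nonneg_nonneg)
  fix a :: "'w \<Rightarrow> 'k"
  assume a [measurable]: "a \<in> borel_measurable G" and le: "AE w in G. norm (a w) * ?c w \<le> 1"
  have "AE w in G. norm (a w * b w) * (1 + N x w) \<le> 1 \<and> norm (a w) * (1 + N (sm b x) w) \<le> 1"
    using AE_N_nonneg[OF x] AE_N_nonneg[OF z] le
  proof eventually_elim
    case (elim w)
    have "norm (b w) * (1 + N x w) \<le> (1 + norm (b w)) * (1 + N x w)"
      using elim by (intro mult_right_mono) auto
    then have 1: "norm (b w) * (1 + N x w) \<le> ?c w" using elim by (simp add: algebra_simps)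
    have 2: "1 + N (sm b x) w \<le> ?c w" using elim by simp
    show ?case
      using mult_left_mono[OF 1, of "norm (a w)"] mult_left_mono[OF 2, of "norm (a w)"] elim
      by (simp add: norm_mult mult.assoc)
  qed
  then have bx: "AE w in G. norm (a w * b w) * (1 + N x w) \<le> 1"
    and bz: "AE w in G. norm (a w) * (1 + N (sm b x) w) \<le> 1" by auto
  have ab: "(\<lambda>w. a w * b w) \<in> borel_measurable G" by measurable
  have "sm a (sm b x) = sm (\<lambda>w. a w * b w) x" by (rule sm_mult[OF a b x])
  then show "integrable G (\<lambda>w. a w * dz w) \<and> integrable G (\<lambda>w. a w * (b w * dx w)) \<and>
      (\<integral>w. a w * dz w \<partial>G) = (\<integral>w. a w * (b w * dx w) \<partial>G)"
    using test_densityD(2,3)[OF dx ab bx] test_densityD(2,3)[OF dz a bz] by (simp add: mult.assoc)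
qed

text \<open>With the conjugate phase of \<open>d\<close> as a factor, the test function satisfies
  \<open>a w * d w = of_real (g w * norm (d w))\<close>, while \<open>sm a x\<close> has norm at
  most \<open>g\<close>. Boundedness of \<open>g\<close> makes \<open>a\<close> admissible; the
  estimate itself sees only \<open>C\<close> and \<open>T\<close>.\<close>

lemma test_density_weak_bound:
  assumes x: "x \<in> carrier S" and x1: "AE w in G. N x w \<le> 1" and dx: "test_density G S \<phi> x d"
    and g [measurable]: "g \<in> borel_measurable G" and g0: "\<And>w. 0 \<le> g w" and gB: "\<And>w. g w \<le> B"
    and T: "0 \<le> T" "(\<integral>\<^sup>+ w. ennreal (g w powr p) \<partial>G) \<le> ennreal (T powr p)"
  shows "(\<integral>\<^sup>+ w. ennreal (g w * norm (d w)) \<partial>G) \<le> ennreal (C * T)"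
proof -
  note [measurable] = test_densityD(1)[OF dx]
  define a where "a = (\<lambda>w. of_real (g w) * unit_of (d w))"
  have a [measurable]: "a \<in> borel_measurable G" by (simp add: a_def)
  have ag: "norm (a w) \<le> g w" for w
    using mult_left_mono[OF unit_of(2)[of "d w"] g0[of w]] g0[of w] by (simp add: a_def norm_mult)
  have le: "AE w in G. norm (a w) * (1 + N x w) \<le> \<bar>B\<bar> * 2"
    using x1 AE_N_nonneg[OF x]
  proof eventually_elim
    case (elim w)
    then show ?case using ag[of w] gB[of w] by (intro mult_mono) auto
  qed
  have adw: "a w * d w = of_real (g w * norm (d w))" for w
    using unit_of(1)[of "d w"] by (simp add: a_def mult.assoc)
  have i: "integrable G (\<lambda>w. of_real (g w * norm (d w)) :: 'k)"
    and e: "\<phi> (sm a x) = (\<integral>w. of_real (g w * norm (d w)) \<partial>G)"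
    using test_densityD(2,3)[OF dx a le] unfolding adw by auto
  from integrable_norm[OF i] have i': "integrable G (\<lambda>w. g w * norm (d w))"
    using g0 by (simp add: norm_mult)
  have "AE w in G. N (sm a x) w \<le> g w"
    using AE_N_sm[OF a x] AE_N_nonneg[OF x] x1
  proof eventually_elim
    case (elim w)
    then show ?case using mult_mono[OF ag[of w] elim(3)] g0[of w] by simp
  qed
  from LpI_AE[OF sm_closed[OF a x] p T(1) this T(2)]
  have L: "sm a x \<in> carrier (Lp p)" "nnorm (Lp p) (sm a x) \<le> T" by auto
  have "norm (\<phi> (sm a x)) \<le> C * T"
    using \<phi>_le[OF L(1)] mult_left_mono[OF L(2) C] by linarith
  moreover have "norm (\<phi> (sm a x)) = (\<integral>w. g w * norm (d w) \<partial>G)"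
    unfolding e integral_of_real[OF i'] using g0 by (simp add: integral_nonneg_AE)
  ultimately show ?thesis
    using i' g0 by (subst nn_integral_eq_integral) (auto intro!: ennreal_leI)
qed

end
end

section \<open>The representing functional and its norm\<close>

context random_normed_module
begin

lemma Riesz_representation:
  fixes p q C :: real and \<phi> :: "'a \<Rightarrow> 'k"
  assumes p: "1 < p" and q: "1 < q" and pq: "1 / p + 1 / q = 1" and C: "0 \<le> C"
    and \<phi>_add: "\<And>x y. x \<in> carrier (Lp p) \<Longrightarrow> y \<in> carrier (Lp p) \<Longrightarrow> \<phi> (x \<oplus> y) = \<phi> x + \<phi> y"
    and \<phi>_smult: "\<And>c x. x \<in> carrier (Lp p) \<Longrightarrow> \<phi> (sm (\<lambda>_. c) x) = c * \<phi> x"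
    and \<phi>_le: "\<And>x. x \<in> carrier (Lp p) \<Longrightarrow> norm (\<phi> x) \<le> C * nnorm (Lp p) x"
  obtains f where "f \<in> carrier conj_module"
    "(\<integral>\<^sup>+ w. ennreal (Nc f w powr q) \<partial>G) \<le> ennreal (C powr q)"
    "\<forall>x\<in>carrier (Lp p). integrable G (L0_rep (f x)) \<and> \<phi> x = (\<integral>w. L0_rep (f x) w \<partial>G)"
proof -
  note loc = p C \<phi>_add \<phi>_smult \<phi>_le
  have "\<forall>x\<in>carrier S. \<exists>d. test_density G S \<phi> x d"
    using test_density_exists[OF loc] by blast
  then obtain D where D: "\<And>x. x \<in> carrier S \<Longrightarrow> test_density G S \<phi> x (D x)"
    by (auto dest!: bchoice)
  have Dm [measurable, simp]: "D x \<in> borel_measurable G" if "x \<in> carrier S" for x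
    by (rule test_densityD(1)[OF D[OF that]])
  have D_add: "AE w in G. D (x \<oplus> y) w = D x w + D y w"
    if "x \<in> carrier S" "y \<in> carrier S" for x y
    using that by (intro test_density_add[OF loc that] D M.a_closed)
  have D_sm: "AE w in G. D (sm b x) w = b w * D x w"
    if "b \<in> borel_measurable G" "x \<in> carrier S" for b x
    using that by (intro test_density_sm[OF loc that(2,1)] D sm_closed)
  \<comment> \<open>The random unit ball, on which the essential supremum of the moduli of densities
    is taken. That supremum will serve as the random bound of the functional.\<close>
  define U where "U = {x \<in> carrier S. AE w in G. N x w \<le> 1}"
  define T where "T = (\<lambda>x w. ennreal (norm (D x w)))"
  have zeroU: "\<zero> \<in> U"
    using AE_N_eq_0_iff[of "\<zero>"] by (auto simp: U_def elim!: eventually_mono)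
  have US: "x \<in> carrier S" if "x \<in> U" for x using that by (simp add: U_def)
  have glue: "\<exists>z\<in>U. AE w in G. T z w = max (T x w) (T y w)" if xy: "x \<in> U" "y \<in> U" for x y
  proof -
    have x: "x \<in> carrier S" "AE w in G. N x w \<le> 1" and y: "y \<in> carrier S" "AE w in G. N y w \<le> 1"
      using xy by (auto simp: U_def)
    note [measurable] = Dm[OF x(1)] Dm[OF y(1)]
    \<comment> \<open>Complementary indicators: \<open>z\<close> follows whichever of
      \<open>x\<close> and \<open>y\<close> has the larger density. At almost every point only one
      summand contributes to the norm, so \<open>z\<close> stays in \<open>U\<close>.\<close>
    define a b where "a = (\<lambda>w. if norm (D y w) \<le> norm (D x w) then 1 else 0 :: 'k)"
      and "b = (\<lambda>w. if norm (D y w) \<le> norm (D x w) then 0 else 1 :: 'k)"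
    have a: "a \<in> borel_measurable G" and b: "b \<in> borel_measurable G"
      unfolding a_def b_def by measurable
    define z where "z = sm a x \<oplus> sm b y"
    have ax: "sm a x \<in> carrier S" "sm b y \<in> carrier S" using a b x y by simp_all
    have zS: "z \<in> carrier S" using ax by (simp add: z_def)
    have "AE w in G. N z w \<le> 1"
      using AE_N_add[OF ax] AE_N_sm[OF a x(1)] AE_N_sm[OF b y(1)] x(2) y(2)
      unfolding z_def[symmetric] by eventually_elim (auto simp: a_def b_def split: if_splits)
    then have "z \<in> U" using zS by (simp add: U_def)
    moreover have "AE w in G. T z w = max (T x w) (T y w)"
      using D_add[OF ax] D_sm[OF a x(1)] D_sm[OF b y(1)] unfolding z_def[symmetric]
    proof eventually_elim
      case (elim w)
      then show ?case
        by (cases "norm (D y w) \<le> norm (D x w)")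
          (simp_all add: T_def a_def b_def max_absorb1 max_absorb2 ennreal_leI)
    qed
    ultimately show ?thesis by blast
  qed
  have weak: "(\<integral>\<^sup>+ w. ennreal (g w * norm (D x w)) \<partial>G) \<le> ennreal (C * t)"
    if "x \<in> U" "g \<in> borel_measurable G" "\<And>w. 0 \<le> g w" "\<And>w. g w \<le> B" "0 \<le> t"
      "(\<integral>\<^sup>+ w. ennreal (g w powr p) \<partial>G) \<le> ennreal (t powr p)" for g x B t
    using that D by (intro test_density_weak_bound[OF loc, of x "D x" g B t]) (auto simp: U_def)
  obtain s where s: "\<forall>n. s n \<in> T ` U" "AE w in G. incseq (\<lambda>n. s n w)"
    "\<forall>g\<in>T ` U. AE w in G. g w \<le> (SUP n. s n w)"
    "(\<integral>\<^sup>+w. (SUP n. s n w) \<partial>G) \<le> ennreal C"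
  proof (rule directed_ess_sup[of "T ` U" G C])
    show "T ` U \<noteq> {}" using zeroU by blast
    show "g \<in> borel_measurable G" if "g \<in> T ` U" for g
    proof -
      from that obtain x where x: "x \<in> U" "g = T x" by (rule imageE)
      note [measurable] = Dm[OF US[OF x(1)]]
      show ?thesis unfolding x(2) T_def by measurable
    qed
    show "(\<integral>\<^sup>+w. g w \<partial>G) \<le> ennreal C" if "g \<in> T ` U" for g
    proof -
      from that obtain x where x: "x \<in> U" "g = T x" by (rule imageE)
      \<comment> \<open>The constant test function 1 has \<open>p\<close>-norm 1, which gives the
        bound \<open>C\<close> for all integrals.\<close>
      from weak[OF x(1), of "\<lambda>_. 1" 1 1] show ?thesis
        unfolding x(2) T_def by (simp add: emeasure_space_1)
    qed
    show "\<exists>k\<in>T ` U. AE w in G. k w = max (g w) (h w)" if gh: "g \<in> T ` U" "h \<in> T ` U" for g h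
    proof -
      from gh(1) obtain x where x: "x \<in> U" "g = T x" by (rule imageE)
      from gh(2) obtain y where y: "y \<in> U" "h = T y" by (rule imageE)
      from glue[OF x(1) y(1)] obtain z where "z \<in> U" "AE w in G. T z w = max (T x w) (T y w)" by blast
      then show ?thesis unfolding x(2) y(2) by (intro bexI[of _ "T z"] imageI)
    qed
  qed
  have "\<exists>y. y \<in> U \<and> s n = T y" for n
  proof -
    have "s n \<in> T ` U" using s(1) by (rule spec)
    then show ?thesis by (rule imageE) (intro exI conjI)
  qed
  then have "\<forall>n. \<exists>y. y \<in> U \<and> s n = T y" by (rule allI)
  then obtain y where "\<forall>n. y n \<in> U \<and> s n = T (y n)" by (rule choice[THEN exE])
  then have y: "\<And>n. y n \<in> U" "\<And>n. s n = T (y n)" by simp_all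
  note [measurable] = Dm[OF US[OF y(1)]]
  have sm [measurable]: "s n \<in> borel_measurable G" for n unfolding y(2) T_def by measurable
  define \<xi> where "\<xi> = (\<lambda>w. enn2real (SUP n. s n w))"
  have [measurable]: "\<xi> \<in> borel_measurable G" by (simp add: \<xi>_def)
  have \<xi>0: "0 \<le> \<xi> w" for w by (simp add: \<xi>_def)
  have "AE w in G. (SUP n. s n w) \<noteq> \<infinity>"
    by (rule nn_integral_PInf_AE) (use s(4) in \<open>auto simp: top_unique\<close>)
  then have \<xi>: "AE w in G. ennreal (\<xi> w) = (SUP n. s n w)"
    unfolding infinity_ennreal_def less_top
    by eventually_elim (unfold \<xi>_def, rule ennreal_enn2real)
  have D_le: "AE w in G. norm (D x w) \<le> \<xi> w" if "x \<in> U" for x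
    using bspec[OF s(3) imageI[OF that]] \<xi>
  proof eventually_elim
    case (elim w)
    then have "ennreal (norm (D x w)) \<le> ennreal (\<xi> w)" by (simp add: T_def)
    then show ?case using \<xi>0[of w] by (auto simp: ennreal_le_iff2)
  qed
  have bound: "AE w in G. norm (D x w) \<le> \<xi> w * N x w" if x: "x \<in> carrier S" for x
  proof -
    note [measurable] = N_measurable[OF x]
    \<comment> \<open>\<open>a\<close> normalises \<open>x\<close> where its norm is positive, which
      brings it into \<open>U\<close>. \<open>b\<close> indicates the set where the norm vanishes;
      there \<open>sm b x\<close> equals \<open>sm (\<lambda>_. 0) x\<close>, so the density of
      \<open>x\<close> vanishes on that set too.\<close>
    define a b where "a = (\<lambda>w. of_real (if 0 < N x w then 1 / N x w else 0) :: 'k)"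
      and "b = (\<lambda>w. if N x w = 0 then 1 else 0 :: 'k)"
    have a: "a \<in> borel_measurable G" and b: "b \<in> borel_measurable G"
      unfolding a_def b_def by measurable
    have na: "norm (a w) = (if 0 < N x w then 1 / N x w else 0)" for w
      unfolding a_def norm_of_real by simp
    have "AE w in G. N (sm a x) w \<le> 1"
      using AE_N_sm[OF a x] by eventually_elim (simp add: na)
    then have "sm a x \<in> U" using a x by (simp add: U_def)
    note 1 = D_le[OF this]
    have "sm b x = sm (\<lambda>_. 0) x"
      using b x by (intro sm_cong_support) (auto simp: b_def)
    then have 2: "AE w in G. b w * D x w = 0"
      using D_sm[OF b x] D_sm[of "\<lambda>_. 0", OF _ x] by (auto elim: eventually_elim2)
    show ?thesis
      using 1 2 D_sm[OF a x] AE_N_nonneg[OF x]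
    proof eventually_elim
      case (elim w)
      show ?case
      proof (cases "N x w = 0")
        case True
        then show ?thesis using elim(2) by (simp add: b_def)
      next
        case False
        then have "0 < N x w" using elim(4) by simp
        then show ?thesis using elim(1,3) na[of w] by (simp add: norm_mult field_simps)
      qed
    qed
  qed
  \<comment> \<open>Each \<open>s n\<close> is the modulus of the density of one element of
    \<open>U\<close>, for which \<open>weak\<close> applies; the estimate survives the increasing
    limit.\<close>
  have \<xi>weak: "(\<integral>\<^sup>+ w. ennreal (g w * \<xi> w) \<partial>G) \<le> ennreal (C * t)"
    if g [measurable]: "g \<in> borel_measurable G" and g': "\<And>w. 0 \<le> g w" "\<And>w. g w \<le> B" "0 \<le> t"
      "(\<integral>\<^sup>+ w. ennreal (g w powr p) \<partial>G) \<le> ennreal (t powr p)" for g B t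
  proof -
    have "(\<integral>\<^sup>+ w. ennreal (g w * \<xi> w) \<partial>G) = (\<integral>\<^sup>+ w. (SUP n. ennreal (g w) * s n w) \<partial>G)"
      by (rule nn_integral_cong_AE, use \<xi> in eventually_elim)
        (use g'(1) \<xi>0 in \<open>simp add: ennreal_mult SUP_mult_left_ennreal\<close>)
    also have "\<dots> = (SUP n. \<integral>\<^sup>+ w. ennreal (g w) * s n w \<partial>G)"
    proof (rule nn_integral_monotone_convergence_SUP_AE)
      show "AE w in G. ennreal (g w) * s n w \<le> ennreal (g w) * s (Suc n) w" for n
        using s(2) by eventually_elim (auto intro!: mult_left_mono simp: incseq_Suc_iff)
    qed measurable
    also have "\<dots> \<le> ennreal (C * t)"
    proof (rule SUP_least)
      fix n
      have "(\<integral>\<^sup>+ w. ennreal (g w) * s n w \<partial>G) = (\<integral>\<^sup>+ w. ennreal (g w * norm (D (y n) w)) \<partial>G)"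
        by (intro nn_integral_cong) (simp add: y(2) T_def ennreal_mult g')
      also have "\<dots> \<le> ennreal (C * t)" by (rule weak[OF y(1) g g'])
      finally show "(\<integral>\<^sup>+ w. ennreal (g w) * s n w \<partial>G) \<le> ennreal (C * t)" .
    qed
    finally show ?thesis .
  qed
  \<comment> \<open>The test function \<open>m w powr (q - 1)\<close> has \<open>p\<close>-norm
    \<open>J powr (1 / p)\<close> because \<open>(q - 1) * p = q\<close>, whence
    \<open>J \<le> C * J powr (1 / p)\<close>. Dividing gives \<open>J powr (1 / q) \<le> C\<close>,
    which is legitimate since the truncation at \<open>k\<close> keeps \<open>J\<close>
    finite.\<close>
  have trunc: "(\<integral>\<^sup>+ w. ennreal (min (\<xi> w) (real k) powr q) \<partial>G) \<le> ennreal (C powr q)" for k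
  proof -
    define m where "m = (\<lambda>w. min (\<xi> w) (real k))"
    have [measurable]: "m \<in> borel_measurable G" by (simp add: m_def)
    have m0: "0 \<le> m w" and mk: "m w \<le> real k" and m\<xi>: "m w \<le> \<xi> w" for w
      using \<xi>0[of w] by (auto simp: m_def)
    define J where "J = enn2real (\<integral>\<^sup>+ w. ennreal (m w powr q) \<partial>G)"
    have "(\<integral>\<^sup>+ w. ennreal (m w powr q) \<partial>G) \<le> (\<integral>\<^sup>+ w. ennreal (real k powr q) \<partial>G)"
      using m0 mk q by (intro nn_integral_mono ennreal_leI powr_mono2) auto
    also have "\<dots> = ennreal (real k powr q)" by (simp add: emeasure_space_1)
    finally have J: "(\<integral>\<^sup>+ w. ennreal (m w powr q) \<partial>G) = ennreal J"
      unfolding J_def by (intro ennreal_enn2real[symmetric] le_less_trans[OF _ ennreal_less_top])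
    have J0: "0 \<le> J" by (simp add: J_def)
    have qp: "(q - 1) * p = q" using pq p q by (simp add: field_simps)
    have "ennreal J \<le> (\<integral>\<^sup>+ w. ennreal (m w powr (q - 1) * \<xi> w) \<partial>G)"
      unfolding J[symmetric]
    proof (intro nn_integral_mono ennreal_leI)
      fix w
      have "m w powr q = m w powr (q - 1) * m w"
        using m0[of w] q by (cases "m w = 0") (auto simp: powr_diff)
      also have "\<dots> \<le> m w powr (q - 1) * \<xi> w" using m\<xi> by (intro mult_left_mono) auto
      finally show "m w powr q \<le> m w powr (q - 1) * \<xi> w" .
    qed
    also have "\<dots> \<le> ennreal (C * J powr (1 / p))"
    proof (rule \<xi>weak)
      show "m w powr (q - 1) \<le> real k powr (q - 1)" for w
        using m0 mk q by (intro powr_mono2) auto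
      show "(\<integral>\<^sup>+ w. ennreal ((m w powr (q - 1)) powr p) \<partial>G) \<le> ennreal ((J powr (1 / p)) powr p)"
        using p J0 by (simp add: powr_powr qp J)
    qed auto
    finally have JC: "J \<le> C * J powr (1 / p)" using C by (subst (asm) ennreal_le_iff) auto
    have "J \<le> C powr q"
    proof (cases "J = 0")
      case False
      then have Jpos: "0 < J" using J0 by simp
      have "J = J powr (1 / q) * J powr (1 / p)"
        using Jpos pq by (simp add: powr_add[symmetric] add.commute)
      with JC have "J powr (1 / q) * J powr (1 / p) \<le> C * J powr (1 / p)" by simp
      then have "J powr (1 / q) \<le> C" using Jpos by simp
      then have "(J powr (1 / q)) powr q \<le> C powr q" using q by (intro powr_mono2) auto
      then show ?thesis using q J0 by (simp add: powr_powr)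
    qed simp
    then show ?thesis using J by (simp add: m_def ennreal_leI)
  qed
  \<comment> \<open>At each point the truncations are eventually equal to \<open>\<xi>\<close>, so
    Fatou's lemma removes them.\<close>
  have \<xi>q: "(\<integral>\<^sup>+ w. ennreal (\<xi> w powr q) \<partial>G) \<le> ennreal (C powr q)"
  proof -
    have "(\<lambda>k. ennreal (min (\<xi> w) (real k) powr q)) \<longlonglongrightarrow> ennreal (\<xi> w powr q)" for w
    proof (rule tendsto_eventually)
      obtain K :: nat where "\<xi> w \<le> real K" using real_arch_simple by blast
      then show "eventually (\<lambda>k. ennreal (min (\<xi> w) (real k) powr q) = ennreal (\<xi> w powr q)) sequentially"
        by (intro eventually_sequentiallyI[of K]) (simp add: min_absorb1)
    qed
    note lim = lim_imp_Liminf[OF trivial_limit_sequentially this]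
    have "(\<integral>\<^sup>+ w. ennreal (\<xi> w powr q) \<partial>G) =
        (\<integral>\<^sup>+ w. liminf (\<lambda>k. ennreal (min (\<xi> w) (real k) powr q)) \<partial>G)"
      unfolding lim ..
    also have "\<dots> \<le> liminf (\<lambda>k. \<integral>\<^sup>+ w. ennreal (min (\<xi> w) (real k) powr q) \<partial>G)"
      by (rule nn_integral_liminf) measurable
    also have "\<dots> \<le> liminf (\<lambda>k::nat. ennreal (C powr q))"
      by (intro Liminf_mono always_eventually allI trunc)
    also have "\<dots> = ennreal (C powr q)" by (simp add: Liminf_const)
    finally show ?thesis .
  qed
  have \<xi>0': "AE w in G. 0 \<le> \<xi> w" using \<xi>0 by simp
  have f1: "conj_of D \<in> carrier conj_module"
    by (rule conj_of(1)[of D \<xi>]) (fact Dm D_add D_sm \<open>\<xi> \<in> borel_measurable G\<close> \<xi>0' bound)+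
  have f2: "AE w in G. L0_rep (conj_of D x) w = D x w" if x: "x \<in> carrier S" for x
    by (rule conj_of(2)[of D \<xi>]) (fact x Dm D_add D_sm \<open>\<xi> \<in> borel_measurable G\<close> \<xi>0' bound)+
  have f3: "AE w in G. Nc (conj_of D) w \<le> \<xi> w"
    by (rule conj_of(3)[of D \<xi>]) (fact Dm D_add D_sm \<open>\<xi> \<in> borel_measurable G\<close> \<xi>0' bound)+
  show ?thesis
  proof (rule that[of "conj_of D"])
    show fc: "conj_of D \<in> carrier conj_module" by (rule f1)
    have "(\<integral>\<^sup>+ w. ennreal (Nc (conj_of D) w powr q) \<partial>G) \<le> (\<integral>\<^sup>+ w. ennreal (\<xi> w powr q) \<partial>G)"
      using AE_Nc_nonneg[OF fc] f3
      by (intro nn_integral_mono_AE, eventually_elim) (use q in \<open>auto intro!: ennreal_leI powr_mono2\<close>)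
    then show "(\<integral>\<^sup>+ w. ennreal (Nc (conj_of D) w powr q) \<partial>G) \<le> ennreal (C powr q)"
      using \<xi>q by (rule order_trans)
    show "\<forall>x\<in>carrier (Lp p). integrable G (L0_rep (conj_of D x)) \<and> \<phi> x = (\<integral>w. L0_rep (conj_of D x) w \<partial>G)"
    proof
      fix x assume xL: "x \<in> carrier (Lp p)"
      have x: "x \<in> carrier S" by (rule Lp_carrierD[OF xL])
      note [measurable] = Dm[OF x] N_measurable[OF x] rep_conj_measurable[OF fc x]
      \<comment> \<open>Hoelder's inequality makes \<open>\<xi> w * N x w\<close> an integrable
        majorant of the density.\<close>
      have "(\<integral>\<^sup>+ w. ennreal (\<xi> w * N x w) \<partial>G) \<le> ennreal (C * nnorm (Lp p) x)"
        using \<xi>0 AE_N_nonneg[OF x] pq C \<xi>q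
        by (intro nn_integral_Hoelder[of _ _ _ q p])
          (auto simp: p q nnorm_Lp_nonneg Lp_integral[OF xL p] add.commute)
      then have "(\<integral>\<^sup>+ w. ennreal (\<xi> w * N x w) \<partial>G) < \<infinity>"
        by (auto simp: less_top[symmetric] top_unique)
      then have i\<xi>: "integrable G (\<lambda>w. \<xi> w * N x w)"
        using \<xi>0 AE_N_nonneg[OF x] by (intro integrableI_nonneg) (auto elim!: eventually_mono)
      have iD: "integrable G (D x)"
        by (rule Bochner_Integration.integrable_bound[OF i\<xi>]) (use bound[OF x] in \<open>auto elim!: eventually_mono\<close>)
      \<comment> \<open>The density identity is known for admissible test functions only, and the
        constant 1 is not one when \<open>N x\<close> is unbounded. The indicators of the sets where
        \<open>N x w \<le> real i\<close> are admissible with bound \<open>1 + real i\<close> and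
        converge to 1.\<close>
      define a where "a = (\<lambda>(i::nat) w. if N x w \<le> real i then 1 else 0 :: 'k)"
      have a [measurable]: "a i \<in> borel_measurable G" for i unfolding a_def by measurable
      have a1: "norm (a i w) \<le> 1" for i w by (simp add: a_def)
      have alim: "(\<lambda>i. a i w) \<longlonglongrightarrow> 1" for w
      proof (rule tendsto_eventually)
        obtain K :: nat where "N x w \<le> real K" using real_arch_simple by blast
        then show "eventually (\<lambda>i. a i w = 1) sequentially"
          by (intro eventually_sequentiallyI[of K]) (auto simp: a_def)
      qed
      have eq: "\<phi> (sm (a i) x) = (\<integral>w. a i w * D x w \<partial>G)" for i
      proof (rule test_densityD(3)[OF D[OF x] a])
        show "AE w in G. norm (a i w) * (1 + N x w) \<le> 1 + real i"
          using AE_N_nonneg[OF x] by eventually_elim (simp add: a_def)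
      qed
      have "(\<lambda>i. \<integral>w. a i w * D x w \<partial>G) \<longlonglongrightarrow> (\<integral>w. D x w \<partial>G)"
      proof (rule integral_dominated_convergence[where w = "\<lambda>w. norm (D x w)"])
        show "AE w in G. (\<lambda>i. a i w * D x w) \<longlonglongrightarrow> D x w"
          using tendsto_mult[OF alim tendsto_const, of _ "D x _"] by simp
        show "AE w in G. norm (a i w * D x w) \<le> norm (D x w)" for i
          by (rule AE_I2) (simp add: a_def)
      qed (use iD in auto)
      moreover have "(\<lambda>i. \<phi> (sm (a i) x)) \<longlonglongrightarrow> \<phi> x"
      proof -
        have "(\<lambda>i. nnorm (Lp p) (sm (\<lambda>w. 1 - a i w) x)) \<longlonglongrightarrow> 0"
        proof (rule Lp_sm_tendsto_0[OF _ xL p, of _ 1])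
          show "AE w in G. (\<lambda>i. 1 - a i w) \<longlonglongrightarrow> 0"
            using tendsto_diff[OF tendsto_const alim, of 1] by simp
        qed (auto simp: a_def)
        from tendsto_mult_right_zero[OF this, of C]
        have lim0: "(\<lambda>i. C * nnorm (Lp p) (sm (\<lambda>w. 1 - a i w) x)) \<longlonglongrightarrow> 0" .
        have "norm (\<phi> (sm (a i) x) - \<phi> x) \<le> C * nnorm (Lp p) (sm (\<lambda>w. 1 - a i w) x)" for i
        proof -
          have L: "sm (a i) x \<in> carrier (Lp p)" "sm (\<lambda>w. 1 - a i w) x \<in> carrier (Lp p)"
            by (rule Lp_sm[OF _ xL p, of _ 1]; simp add: a_def)+
          have "x = sm (\<lambda>w. a i w + (1 - a i w)) x" using x by simp
          also have "\<dots> = sm (a i) x \<oplus> sm (\<lambda>w. 1 - a i w) x"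
            using x by (intro sm_add) auto
          finally have "\<phi> x = \<phi> (sm (a i) x) + \<phi> (sm (\<lambda>w. 1 - a i w) x)"
            using \<phi>_add[OF L] by simp
          then show ?thesis using \<phi>_le[OF L(2)] by (simp add: norm_minus_commute)
        qed
        then have "(\<lambda>i. \<phi> (sm (a i) x) - \<phi> x) \<longlonglongrightarrow> 0"
          by (intro Lim_null_comparison[OF always_eventually lim0]) auto
        then show ?thesis by (rule LIM_zero_cancel)
      qed
      ultimately have "\<phi> x = (\<integral>w. D x w \<partial>G)" unfolding eq using LIMSEQ_unique by blast
      moreover have "AE w in G. D x w = L0_rep (conj_of D x) w"
        using f2[OF x] by eventually_elim simp
      then have "(\<integral>w. D x w \<partial>G) = (\<integral>w. L0_rep (conj_of D x) w \<partial>G)"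
        "integrable G (D x) \<longleftrightarrow> integrable G (L0_rep (conj_of D x))"
        by (intro integral_cong_AE integrable_cong_AE; measurable)+
      ultimately show "integrable G (L0_rep (conj_of D x)) \<and> \<phi> x = (\<integral>w. L0_rep (conj_of D x) w \<partial>G)"
        using iD by simp
    qed
  qed
qed

end

section \<open>The Hahn-Banach theorem\<close>

text \<open>The multiplicativity of the norm makes the scalar field a field with conjugation: multiplication
  by \<open>a\<close> has the adjoint multiplication by \<open>field_conj a\<close>. This is how the real and the complex
  Hahn-Banach theorems are treated simultaneously.\<close>

definition field_conj :: "'k::{real_normed_field, euclidean_space} \<Rightarrow> 'k" where
  "field_conj a = (norm a)\<^sup>2 *\<^sub>R inverse a"

text \<open>Polarisation: multiplicativity of the norm says that multiplication by \<open>c\<close>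
  multiplies squared norms by \<open>(norm c)\<^sup>2\<close>, hence inner products as well.\<close>

lemma inner_mult_mult:
  fixes a b c :: "'k::{real_normed_field, euclidean_space}"
  shows "(a * c) \<bullet> (b * c) = (norm c)\<^sup>2 * (a \<bullet> b)"
proof -
  have pol: "4 * (x \<bullet> y) = (norm (x + y))\<^sup>2 - (norm (x - y))\<^sup>2" for x y :: 'k
    by (simp add: power2_norm_eq_inner inner_simps inner_commute)
  have "4 * ((a * c) \<bullet> (b * c)) = (norm ((a + b) * c))\<^sup>2 - (norm ((a - b) * c))\<^sup>2"
    unfolding pol by (simp only: distrib_right left_diff_distrib)
  also have "\<dots> = (norm c)\<^sup>2 * (4 * (a \<bullet> b))"
    unfolding pol norm_mult power_mult_distrib by (simp add: algebra_simps)
  finally show ?thesis by simp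
qed

lemma norm_field_conj [simp]: "norm (field_conj a) = norm a"
  by (cases "a = 0") (auto simp: field_conj_def norm_inverse power2_eq_square)

lemma field_conj_conj [simp]: "field_conj (field_conj a) = a"
proof -
  have "field_conj (field_conj a) = (norm a)\<^sup>2 *\<^sub>R inverse ((norm a)\<^sup>2 *\<^sub>R inverse a)"
    by (simp add: field_conj_def[of "field_conj a"]) (simp add: field_conj_def)
  then show ?thesis by (cases "a = 0") (simp_all add: inverse_scaleR_distrib)
qed

text \<open>Writing 1 as \<open>inverse b * b\<close> moves the factor \<open>b\<close> to the other
  side of the inner product. For the complex field \<open>z \<bullet> 1\<close> is the real part of
  \<open>z\<close>.\<close>

lemma inner_mult_one:
  fixes a b :: "'k::{real_normed_field, euclidean_space}"
  shows "(a * b) \<bullet> 1 = a \<bullet> field_conj b"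
proof (cases "b = 0")
  case False
  have "(a * b) \<bullet> 1 = (a * b) \<bullet> (inverse b * b)" using False by simp
  also have "\<dots> = (norm b)\<^sup>2 * (a \<bullet> inverse b)" by (rule inner_mult_mult)
  also have "\<dots> = a \<bullet> field_conj b"
    by (simp add: field_conj_def)
  finally show ?thesis .
qed (simp add: field_conj_def)

text \<open>Were \<open>a - b\<close> nonzero, \<open>k = inverse (a - b)\<close> would give
  \<open>1 \<bullet> 1 = 0\<close>. Thus an identity of real functionals valid after all scalings is
  an identity of scalars.\<close>

lemma eq_of_inner_mult_one:
  fixes a b :: "'k::{real_normed_field, euclidean_space}"
  assumes "\<And>k. (k * a) \<bullet> 1 = (k * b) \<bullet> 1"
  shows "a = b"
proof (rule ccontr)
  assume "a \<noteq> b"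
  then have "(1::'k) = inverse (a - b) * (a - b)" by simp
  then have "(1::'k) \<bullet> 1 = (inverse (a - b) * a) \<bullet> 1 - (inverse (a - b) * b) \<bullet> 1"
    by (metis inner_diff_left right_diff_distrib)
  then have "(1::'k) \<bullet> 1 = 0" using assms by simp
  then show False by simp
qed

lemma scalar_ring_simps [simp]:
  "carrier scalar_ring = UNIV" "add scalar_ring = (+)" "monoid.mult scalar_ring = (*)"
  "zero scalar_ring = 0" "one scalar_ring = 1"
  by (simp_all add: scalar_ring_def)

lemma cring_scalar_ring: "cring (scalar_ring :: 'k::real_normed_field ring)"
proof (rule cringI)
  show "abelian_group (scalar_ring :: 'k ring)"
  proof (rule abelian_groupI)
    fix x :: 'k
    show "\<exists>y\<in>carrier scalar_ring. y \<oplus>\<^bsub>scalar_ring\<^esub> x = \<zero>\<^bsub>scalar_ring\<^esub>"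
      by (rule bexI[of _ "- x"]) auto
  qed (auto simp: ac_simps)
  show "comm_monoid (scalar_ring :: 'k ring)"
    by (rule comm_monoidI) (auto simp: ac_simps)
qed (auto simp: distrib_right)

section \<open>Norming functionals from minimal sublinear functionals\<close>

context normed_space
begin

lemma s_add: "x \<in> carrier X \<Longrightarrow> (a + b) \<odot> x = a \<odot> x \<oplus> b \<odot> x"
  using smult_l_distr[of a b x] by simp

lemma s_closed [simp]: "x \<in> carrier X \<Longrightarrow> a \<odot> x \<in> carrier X"
  using smult_closed[of a x] by simp

lemma s_mult: "x \<in> carrier X \<Longrightarrow> a \<odot> (b \<odot> x) = (a * b) \<odot> x"
  using smult_assoc1[of a b x] by simp

lemma s_add_right: "x \<in> carrier X \<Longrightarrow> y \<in> carrier X \<Longrightarrow> a \<odot> (x \<oplus> y) = a \<odot> x \<oplus> a \<odot> y"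
  using smult_r_distr[of a x y] by simp

lemma s_one [simp]: "x \<in> carrier X \<Longrightarrow> 1 \<odot> x = x"
  using smult_one[of x] by simp

lemma s_zero [simp]: "x \<in> carrier X \<Longrightarrow> 0 \<odot> x = \<zero>"
  using smult_l_null[of x] by simp

lemma minus_eq: "x \<in> carrier X \<Longrightarrow> y \<in> carrier X \<Longrightarrow> x \<ominus> y = x \<oplus> (-1) \<odot> y"
proof -
  assume xy: "x \<in> carrier X" "y \<in> carrier X"
  have "y \<oplus> (-1) \<odot> y = \<zero>"
    using s_add[of y 1 "-1"] xy by simp
  then have "\<ominus> y = (-1) \<odot> y"
    using xy by (intro minus_equality) (auto simp: M.a_comm)
  then show ?thesis by (simp add: a_minus_def)
qed

text \<open>Homogeneity is imposed as an inequality, from which equality follows by scaling back.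
  The value 0 off the carrier keeps chains bounded below at every point of the type, so that their
  infima exist.\<close>

definition sublinear :: "('a \<Rightarrow> real) \<Rightarrow> bool" where
  "sublinear q \<longleftrightarrow> (\<forall>x. x \<notin> carrier X \<longrightarrow> q x = 0) \<and>
    (\<forall>x\<in>carrier X. \<forall>y\<in>carrier X. q (x \<oplus> y) \<le> q x + q y) \<and>
    (\<forall>r\<ge>0. \<forall>x\<in>carrier X. q (of_real r \<odot> x) \<le> r * q x) \<and>
    (\<forall>x\<in>carrier X. q x \<le> nnorm X x)"

lemma sublinearD:
  assumes "sublinear q"
  shows "\<And>x. x \<notin> carrier X \<Longrightarrow> q x = 0"
    and "\<And>x y. x \<in> carrier X \<Longrightarrow> y \<in> carrier X \<Longrightarrow> q (x \<oplus> y) \<le> q x + q y"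
    and "\<And>r x. 0 \<le> r \<Longrightarrow> x \<in> carrier X \<Longrightarrow> q (of_real r \<odot> x) \<le> r * q x"
    and "\<And>x. x \<in> carrier X \<Longrightarrow> q x \<le> nnorm X x"
  using assms by (simp_all add: sublinear_def)

lemma sublinear_zero:
  assumes "sublinear q"
  shows "q \<zero> = 0"
proof (rule antisym)
  have "q (of_real 0 \<odot> \<zero>) \<le> 0 * q \<zero>"
    by (rule sublinearD(3)[OF assms]) simp_all
  then show "q \<zero> \<le> 0" by simp
  have "q (\<zero> \<oplus> \<zero>) \<le> q \<zero> + q \<zero>"
    by (rule sublinearD(2)[OF assms]) simp_all
  then show "0 \<le> q \<zero>" by simp
qed

lemma sublinear_pos_scale:
  assumes q: "sublinear q" and r: "0 \<le> r" and x: "x \<in> carrier X"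
  shows "q (of_real r \<odot> x) = r * q x"
proof (cases "r = 0")
  case True
  then show ?thesis using sublinear_zero[OF q] x by simp
next
  case False
  have "q (of_real (1 / r) \<odot> (of_real r \<odot> x)) \<le> 1 / r * q (of_real r \<odot> x)"
    by (rule sublinearD(3)[OF q]) (use r x in simp_all)
  moreover have "of_real (1 / r) \<odot> (of_real r \<odot> x) = x"
    using x False by (simp add: s_mult)
  ultimately have "r * q x \<le> q (of_real r \<odot> x)"
    using False r by (simp add: field_simps)
  moreover have "q (of_real r \<odot> x) \<le> r * q x"
    by (rule sublinearD(3)[OF q r x])
  ultimately show ?thesis by simp
qed

lemma sublinear_neg:
  assumes q: "sublinear q" and x: "x \<in> carrier X"
  shows "0 \<le> q x + q ((-1) \<odot> x)"
proof -
  have "x \<oplus> (-1) \<odot> x = \<zero>" using s_add[of x 1 "-1"] x by simp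
  then have "q \<zero> \<le> q x + q ((-1) \<odot> x)"
    using sublinearD(2)[OF q x s_closed[OF x], of "-1"] by simp
  then show ?thesis using sublinear_zero[OF q] by simp
qed

text \<open>A lower bound common to all sublinear functionals; it keeps pointwise infima of chains
  finite.\<close>

lemma sublinear_lower:
  assumes q: "sublinear q" and x: "x \<in> carrier X"
  shows "- nnorm X x \<le> q x"
proof -
  have "q ((-1) \<odot> x) \<le> nnorm X ((-1) \<odot> x)"
    by (rule sublinearD(4)[OF q s_closed[OF x]])
  then show ?thesis using sublinear_neg[OF q x] x by (simp add: nnorm_smult)
qed

lemma sublinear_nnorm: "sublinear (\<lambda>x. if x \<in> carrier X then nnorm X x else 0)"
  by (auto simp: sublinear_def nnorm_smult nnorm_triangle)

text \<open>Lowering a sublinear functional in the direction \<open>y\<close>; minimal sublinear functionals are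
  therefore linear.\<close>

lemma sublinear_lowering:
  assumes q: "sublinear q" and y: "y \<in> carrier X"
  obtains q' where "sublinear q'" "\<forall>x. q' x \<le> q x" "q' ((-1) \<odot> y) \<le> - q y"
proof -
  \<comment> \<open>The infimum of \<open>h x\<close> over \<open>t \<ge> 0\<close> lies below
    \<open>q\<close> by \<open>t = 0\<close>, and at the negative of \<open>y\<close> it is at most
    \<open>- q y\<close> by \<open>t = 1\<close>.\<close>
  define h where "h = (\<lambda>x t. q (x \<oplus> of_real t \<odot> y) - t * q y)"
  define q' where "q' = (\<lambda>x. if x \<in> carrier X then INF t\<in>{0..}. h x t else 0)"
  have qadd: "q (x \<oplus> z) \<le> q x + q z" if "x \<in> carrier X" "z \<in> carrier X" for x z
    by (rule sublinearD(2)[OF q that])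
  \<comment> \<open>Subtracting \<open>x\<close> from its translate along \<open>y\<close> bounds
    \<open>h x\<close> from below by a number independent of \<open>t\<close>.\<close>
  have lower: "- q ((-1) \<odot> x) \<le> h x t" if x: "x \<in> carrier X" and t: "0 \<le> t" for x t
  proof -
    have "(x \<oplus> of_real t \<odot> y) \<oplus> (-1) \<odot> x =
        (x \<oplus> (-1) \<odot> x) \<oplus> of_real t \<odot> y"
      using x y by (simp add: M.a_ac)
    also have "x \<oplus> (-1) \<odot> x = \<zero>" using s_add[of x 1 "-1"] x by simp
    finally have "q (of_real t \<odot> y) \<le> q (x \<oplus> of_real t \<odot> y) + q ((-1) \<odot> x)"
      using qadd[of "x \<oplus> of_real t \<odot> y" "(-1) \<odot> x"] x y by simp
    then show ?thesis using sublinear_pos_scale[OF q t y] by (simp add: h_def)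
  qed
  have bdd: "bdd_below (h x ` {0..})" if "x \<in> carrier X" for x
    using lower[OF that] by (intro bdd_belowI[of _ "- q ((-1) \<odot> x)"]) auto
  have le: "q' x \<le> h x t" if "x \<in> carrier X" "0 \<le> t" for x t
    using bdd that by (auto simp: q'_def intro!: cINF_lower)
  have greatest: "c \<le> q' x" if "x \<in> carrier X" "\<And>t. 0 \<le> t \<Longrightarrow> c \<le> h x t" for c x
    using that by (auto simp: q'_def intro!: cINF_greatest)
  have q'q: "q' x \<le> q x" for x
  proof (cases "x \<in> carrier X")
    case True
    then show ?thesis using le[OF True, of 0] y by (simp add: h_def)
  next
    case False
    then show ?thesis using sublinearD(1)[OF q False] by (simp add: q'_def)
  qed
  have "sublinear q'"
    unfolding sublinear_def
  proof (intro conjI allI impI ballI)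
    show "q' x = 0" if "x \<notin> carrier X" for x using that by (simp add: q'_def)
    show "q' x \<le> nnorm X x" if "x \<in> carrier X" for x
      by (rule order_trans[OF q'q sublinearD(4)[OF q that]])
    show "q' (x \<oplus> z) \<le> q' x + q' z" if x: "x \<in> carrier X" and z: "z \<in> carrier X" for x z
    proof -
      have "q' (x \<oplus> z) - q' z \<le> q' x"
      proof (rule greatest[OF x])
        fix t :: real assume t: "0 \<le> t"
        have "q' (x \<oplus> z) - h x t \<le> q' z"
        proof (rule greatest[OF z])
          fix s :: real assume s: "0 \<le> s"
          have "(x \<oplus> z) \<oplus> of_real (t + s) \<odot> y =
              (x \<oplus> of_real t \<odot> y) \<oplus> (z \<oplus> of_real s \<odot> y)"
            using x y z by (simp add: s_add M.a_ac)
          then have "h (x \<oplus> z) (t + s) \<le> h x t + h z s"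
            using qadd[of "x \<oplus> of_real t \<odot> y" "z \<oplus> of_real s \<odot> y"] x y z
            by (simp add: h_def distrib_right)
          moreover have "q' (x \<oplus> z) \<le> h (x \<oplus> z) (t + s)" using x z t s by (intro le) auto
          ultimately show "q' (x \<oplus> z) - h x t \<le> h z s" by linarith
        qed
        then show "q' (x \<oplus> z) - q' z \<le> h x t" by linarith
      qed
      then show ?thesis by linarith
    qed
    show "q' (of_real r \<odot> x) \<le> r * q' x" if r: "0 \<le> r" and x: "x \<in> carrier X" for r x
    proof (cases "r = 0")
      case True
      then show ?thesis using q'q[of "\<zero>"] sublinear_zero[OF q] x by simp
    next
      case False
      then have r: "0 < r" using r by simp
      have "q' (of_real r \<odot> x) / r \<le> q' x"
      proof (rule greatest[OF x])
        fix t :: real assume t: "0 \<le> t"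
        have "of_real r \<odot> (x \<oplus> of_real t \<odot> y) = of_real r \<odot> x \<oplus> of_real (r * t) \<odot> y"
          using x y by (simp add: s_add_right s_mult)
        then have "h (of_real r \<odot> x) (r * t) = r * h x t"
          using sublinear_pos_scale[OF q, of r "x \<oplus> of_real t \<odot> y"] r x y
          by (simp add: h_def right_diff_distrib del: of_real_mult)
        moreover have "q' (of_real r \<odot> x) \<le> h (of_real r \<odot> x) (r * t)"
          using x r t by (intro le) auto
        ultimately show "q' (of_real r \<odot> x) / r \<le> h x t" using r by (simp add: field_simps)
      qed
      then show ?thesis using r by (simp add: field_simps)
    qed
  qed
  moreover have "q' ((-1) \<odot> y) \<le> - q y"
  proof -
    have "(-1) \<odot> y \<oplus> of_real 1 \<odot> y = \<zero>"
      using s_add[of y "-1" 1] y by simp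
    then have "h ((-1) \<odot> y) 1 = - q y" using sublinear_zero[OF q] by (simp add: h_def)
    with le[of "(-1) \<odot> y" 1] y show ?thesis by simp
  qed
  moreover have "\<forall>x. q' x \<le> q x" using q'q by (rule allI)
  ultimately show ?thesis by (intro that)
qed

text \<open>Zorn's lemma for the sublinear functionals with value at most
  \<open>- nnorm X x0\<close> at the negative of \<open>x0\<close>; lowering the norm in the
  direction \<open>x0\<close> shows that there are some. The condition is inherited by everything
  smaller, so a minimal element is minimal among all sublinear functionals, which is what linearity
  needs.\<close>

lemma minimal_sublinear_exists:
  assumes x0: "x0 \<in> carrier X"
  obtains u where "sublinear u" "u ((-1) \<odot> x0) \<le> - nnorm X x0"
    "\<forall>v. sublinear v \<longrightarrow> (\<forall>x. v x \<le> u x) \<longrightarrow> v = u"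
proof -
  define A where "A = {q. sublinear q \<and> q ((-1) \<odot> x0) \<le> - nnorm X x0}"
  define P where "P = (\<lambda>(q::'a \<Rightarrow> real) q'. \<forall>x. q' x \<le> q x)"
  obtain p0 where "sublinear p0" "p0 ((-1) \<odot> x0) \<le> - (if x0 \<in> carrier X then nnorm X x0 else 0)"
    by (rule sublinear_lowering[OF sublinear_nnorm x0])
  then have p0: "p0 \<in> A" using x0 by (simp add: A_def)
  have "\<exists>m\<in>A. \<forall>a\<in>A. P m a \<longrightarrow> a = m"
  proof (rule predicate_Zorn)
    show "partial_order_on A (relation_of P A)"
    proof (rule partial_order_on_relation_ofI)
      show "P a a" for a by (simp add: P_def)
      show "P a c" if "P a b" "P b c" for a b c
        unfolding P_def
      proof
        fix x show "c x \<le> a x"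
          using that(1)[unfolded P_def, rule_format, of x] that(2)[unfolded P_def, rule_format, of x]
          by linarith
      qed
      show "a = b" if "P a b" "P b a" for a b
      proof
        fix x show "a x = b x"
          using that(1)[unfolded P_def, rule_format, of x] that(2)[unfolded P_def, rule_format, of x]
          by linarith
      qed
    qed
    fix C assume C: "C \<in> Chains (relation_of P A)"
    then have CA: "C \<subseteq> A" and tot: "\<And>a b. a \<in> C \<Longrightarrow> b \<in> C \<Longrightarrow> P a b \<or> P b a"
      by (auto simp: Chains_def relation_of_def)
    show "\<exists>u\<in>A. \<forall>a\<in>C. P a u"
    proof (cases "C = {}")
      case True
      then show ?thesis using p0 by auto
    next
      case False
      define u where "u = (\<lambda>x. INF q\<in>C. q x)"
      have Csl: "sublinear q" if "q \<in> C" for q using that CA by (auto simp: A_def)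
      have bdd: "bdd_below ((\<lambda>q. q x) ` C)" for x
      proof (cases "x \<in> carrier X")
        case True
        show ?thesis
        proof (rule bdd_belowI)
          fix y assume "y \<in> (\<lambda>q. q x) ` C"
          then obtain q where q: "y = q x" "q \<in> C" by (rule imageE)
          show "- nnorm X x \<le> y" unfolding q(1) by (rule sublinear_lower[OF Csl[OF q(2)] True])
        qed
      next
        case False
        show ?thesis
        proof (rule bdd_belowI)
          fix y assume "y \<in> (\<lambda>q. q x) ` C"
          then obtain q where q: "y = q x" "q \<in> C" by (rule imageE)
          show "0 \<le> y" using Csl[OF q(2)] False unfolding q(1) by (simp add: sublinear_def)
        qed
      qed
      have le: "u x \<le> q x" if "q \<in> C" for q x
        unfolding u_def using bdd that by (intro cINF_lower)
      have greatest: "c \<le> u x" if "\<And>q. q \<in> C \<Longrightarrow> c \<le> q x" for c x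
        unfolding u_def using False that by (intro cINF_greatest)
      obtain q0 where q0: "q0 \<in> C" using False by blast
      have "sublinear u"
        unfolding sublinear_def
      proof (intro conjI allI impI ballI)
        show "u x = 0" if "x \<notin> carrier X" for x
        proof (rule antisym)
          show "u x \<le> 0" using le[OF q0, of x] Csl[OF q0] that by (simp add: sublinear_def)
          show "0 \<le> u x"
          proof (rule greatest)
            fix q assume "q \<in> C"
            then have "q x = 0" using Csl[of q] that by (simp add: sublinear_def)
            then show "0 \<le> q x" by simp
          qed
        qed
        show "u x \<le> nnorm X x" if "x \<in> carrier X" for x
          by (rule order_trans[OF le[OF q0] sublinearD(4)[OF Csl[OF q0] that]])
        show "u (x \<oplus> y) \<le> u x + u y" if x: "x \<in> carrier X" and y: "y \<in> carrier X" for x y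
        proof -
          have "u (x \<oplus> y) - u y \<le> u x"
          proof (rule greatest)
            fix q assume q: "q \<in> C"
            have "u (x \<oplus> y) - q x \<le> u y"
            proof (rule greatest)
              fix q' assume q': "q' \<in> C"
              \<comment> \<open>Of two comparable functionals the smaller one can be used at both
                points.\<close>
              from tot[OF q q'] obtain r where r: "r \<in> C" "r x \<le> q x" "r y \<le> q' y"
                using q q' unfolding P_def by blast
              have "u (x \<oplus> y) \<le> r (x \<oplus> y)" by (rule le[OF r(1)])
              also have "\<dots> \<le> r x + r y" using Csl[OF r(1)] x y by (simp add: sublinear_def)
              finally show "u (x \<oplus> y) - q x \<le> q' y" using r by linarith
            qed
            then show "u (x \<oplus> y) - u y \<le> q x" by linarith
          qed
          then show ?thesis by linarith
        qed
        show "u (of_real r \<odot> x) \<le> r * u x" if r: "0 \<le> r" and x: "x \<in> carrier X" for r x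
        proof (cases "r = 0")
          case True
          then show ?thesis using le[OF q0, of "\<zero>"] sublinear_zero[OF Csl[OF q0]] x by simp
        next
          case False
          then have r: "0 < r" using r by simp
          have "u (of_real r \<odot> x) / r \<le> u x"
          proof (rule greatest)
            fix q assume q: "q \<in> C"
            have "u (of_real r \<odot> x) \<le> r * q x"
              using le[OF q, of "of_real r \<odot> x"] sublinear_pos_scale[OF Csl[OF q], of r x] r x by simp
            then show "u (of_real r \<odot> x) / r \<le> q x" using r by (simp add: field_simps)
          qed
          then show ?thesis using r by (simp add: field_simps)
        qed
      qed
      moreover have "u ((-1) \<odot> x0) \<le> - nnorm X x0"
        using le[OF q0, of "(-1) \<odot> x0"] q0 CA by (auto simp: A_def)
      ultimately have "u \<in> A" by (simp add: A_def)
      moreover have "\<forall>a\<in>C. P a u" unfolding P_def by (intro ballI allI le)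
      ultimately show ?thesis by (intro bexI[of _ u])
    qed
  qed
  then obtain u where uA: "u \<in> A" and umin: "\<forall>v\<in>A. P u v \<longrightarrow> v = u" by (rule bexE)
  have "v = u" if "sublinear v" "\<forall>x. v x \<le> u x" for v
  proof -
    have "v ((-1) \<odot> x0) \<le> u ((-1) \<odot> x0)" using that(2) by (rule spec)
    then have "v \<in> A" using that(1) uA by (simp add: A_def)
    moreover have "P u v" using that(2) by (simp add: P_def)
    ultimately show ?thesis using umin by simp
  qed
  then have "\<forall>v. sublinear v \<longrightarrow> (\<forall>x. v x \<le> u x) \<longrightarrow> v = u" by simp
  moreover have "sublinear u" "u ((-1) \<odot> x0) \<le> - nnorm X x0" using uA by (simp_all add: A_def)
  ultimately show ?thesis by (intro that)
qed

text \<open>Lowering a minimal \<open>u\<close> in any direction leaves it unchanged, which makes it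
  odd; an odd subadditive function is additive. The bound at the negative of \<open>x0\<close>
  becomes the norming property.\<close>

lemma real_norming_functional:
  assumes x0: "x0 \<in> carrier X"
  obtains u where "\<forall>x\<in>carrier X. \<forall>y\<in>carrier X. u (x \<oplus> y) = u x + u y"
    "\<forall>r. \<forall>x\<in>carrier X. u (of_real r \<odot> x) = r * u x"
    "\<forall>x\<in>carrier X. u x \<le> nnorm X x" "nnorm X x0 \<le> u x0"
proof -
  obtain u where u: "sublinear u" "u ((-1) \<odot> x0) \<le> - nnorm X x0"
    and min: "\<forall>v. sublinear v \<longrightarrow> (\<forall>x. v x \<le> u x) \<longrightarrow> v = u"
    by (rule minimal_sublinear_exists[OF x0])
  have neg: "u ((-1) \<odot> x) = - u x" if x: "x \<in> carrier X" for x
  proof -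
    obtain v where v: "sublinear v" "\<forall>y. v y \<le> u y" "v ((-1) \<odot> x) \<le> - u x"
      by (rule sublinear_lowering[OF u(1) x])
    have "v = u" using min v(1,2) by simp
    then have "u ((-1) \<odot> x) \<le> - u x" using v(3) by simp
    then show ?thesis using sublinear_neg[OF u(1) x] by linarith
  qed
  have sub: "u (x \<oplus> y) \<le> u x + u y" if "x \<in> carrier X" "y \<in> carrier X" for x y
    by (rule sublinearD(2)[OF u(1) that])
  have add: "u (x \<oplus> y) = u x + u y" if x: "x \<in> carrier X" and y: "y \<in> carrier X" for x y
  proof -
    have "- u (x \<oplus> y) = u ((-1) \<odot> (x \<oplus> y))" using x y by (simp add: neg)
    also have "\<dots> \<le> u ((-1) \<odot> x) + u ((-1) \<odot> y)" using x y by (simp add: s_add_right sub)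
    also have "\<dots> = - u x - u y" using x y by (simp add: neg)
    finally show ?thesis using sub[OF x y] by linarith
  qed
  have scale: "u (of_real r \<odot> x) = r * u x" if x: "x \<in> carrier X" for r x
  proof (cases "0 \<le> r")
    case True
    then show ?thesis using sublinear_pos_scale[OF u(1) _ x] by simp
  next
    case False
    have "of_real r \<odot> x = (-1) \<odot> (of_real (- r) \<odot> x)" using x by (simp add: s_mult)
    then show ?thesis using False neg[of "of_real (- r) \<odot> x"] x sublinear_pos_scale[OF u(1) _ x, of "- r"] by simp
  qed
  show ?thesis
  proof (rule that)
    show "\<forall>x\<in>carrier X. u x \<le> nnorm X x" using sublinearD(4)[OF u(1)] by blast
    show "nnorm X x0 \<le> u x0" using u(2) neg[OF x0] by simp
  qed (simp_all add: add scale)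
qed

theorem Hahn_Banach_norming:
  assumes x0: "x0 \<in> carrier X"
  obtains \<phi> where "\<phi> \<in> carrier (conjugate_space X)"
    "\<forall>x\<in>carrier X. norm (\<phi> x) \<le> nnorm X x" "norm (\<phi> x0) = nnorm X x0"
proof -
  obtain u where u: "\<forall>x\<in>carrier X. \<forall>y\<in>carrier X. u (x \<oplus> y) = u x + u y"
    "\<forall>r. \<forall>x\<in>carrier X. u (of_real r \<odot> x) = r * u x"
    "\<forall>x\<in>carrier X. u x \<le> nnorm X x" and u0: "nnorm X x0 \<le> u x0"
    by (rule real_norming_functional[OF x0])
  have u_add: "\<And>x y. x \<in> carrier X \<Longrightarrow> y \<in> carrier X \<Longrightarrow> u (x \<oplus> y) = u x + u y"
    and u_scale: "\<And>r x. x \<in> carrier X \<Longrightarrow> u (of_real r \<odot> x) = r * u x"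
    and u_le: "\<And>x. x \<in> carrier X \<Longrightarrow> u x \<le> nnorm X x"
    using u by simp_all
  \<comment> \<open>\<open>\<psi> x\<close> represents the real-linear map taking \<open>k\<close>
    to \<open>u (k \<odot> x)\<close> through the inner product, and its conjugate is scalar-linear
    in \<open>x\<close>. For the complex field \<open>\<phi> x\<close> is the classical
    \<open>u x - i * u (i \<odot> x)\<close>.\<close>
  define \<psi> where "\<psi> = (\<lambda>x. \<Sum>b\<in>Basis. u (b \<odot> x) *\<^sub>R (b::'k))"
  define \<phi> where "\<phi> = (\<lambda>x\<in>carrier X. field_conj (\<psi> x))"
  have \<psi>: "u (k \<odot> x) = k \<bullet> \<psi> x" if x: "x \<in> carrier X" for k x
  proof -
    have lin: "linear (\<lambda>k. u (k \<odot> x))"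
    proof (rule linearI)
      show "u ((a + b) \<odot> x) = u (a \<odot> x) + u (b \<odot> x)" for a b
        using x by (simp add: s_add u_add)
      show "u ((r *\<^sub>R a) \<odot> x) = r *\<^sub>R u (a \<odot> x)" for r a
        using u_scale[of "a \<odot> x" r] x by (simp add: s_mult scaleR_conv_of_real)
    qed
    have "u (k \<odot> x) = u ((\<Sum>b\<in>Basis. (k \<bullet> b) *\<^sub>R b) \<odot> x)"
      by (simp add: euclidean_representation)
    also have "\<dots> = (\<Sum>b\<in>Basis. (k \<bullet> b) * u (b \<odot> x))"
      by (simp add: linear_sum[OF lin] linear_scale[OF lin])
    also have "\<dots> = k \<bullet> \<psi> x" by (simp add: \<psi>_def inner_sum_right mult.commute)
    finally show ?thesis .
  qed
  have \<phi>: "(k * \<phi> x) \<bullet> 1 = u (k \<odot> x)" if "x \<in> carrier X" for k x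
    using that by (simp add: \<psi> \<phi>_def inner_mult_one)
  have le: "norm (\<phi> x) \<le> nnorm X x" if x: "x \<in> carrier X" for x
  proof -
    \<comment> \<open>Turning \<open>x\<close> by the conjugate phase makes the value of
      \<open>\<phi>\<close> real and nonnegative, where it agrees with \<open>u\<close>.\<close>
    have "norm (\<phi> x) = (unit_of (\<phi> x) * \<phi> x) \<bullet> 1"
      by (simp add: unit_of(1) of_real_def power2_norm_eq_inner[symmetric])
    also have "\<dots> = u (unit_of (\<phi> x) \<odot> x)" by (rule \<phi>[OF x])
    also have "\<dots> \<le> nnorm X (unit_of (\<phi> x) \<odot> x)" using x by (intro u_le) simp
    also have "\<dots> \<le> nnorm X x"
      using mult_right_mono[OF unit_of(2) nnorm_nonneg[OF x]] x by (simp add: nnorm_smult)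
    finally show ?thesis .
  qed
  have add: "\<phi> (x \<oplus> y) = \<phi> x + \<phi> y" if "x \<in> carrier X" "y \<in> carrier X" for x y
    using that by - (rule eq_of_inner_mult_one, simp add: \<phi> distrib_left inner_add_left s_add_right u_add)
  have scale: "\<phi> (c \<odot> x) = c * \<phi> x" if "x \<in> carrier X" for c x
    using that by - (rule eq_of_inner_mult_one, simp add: \<phi> mult.assoc[symmetric] s_mult)
  have "norm (\<phi> x0) \<ge> nnorm X x0"
  proof -
    have "nnorm X x0 \<le> \<phi> x0 \<bullet> 1" using u0 \<phi>[OF x0, of 1] x0 by simp
    also have "\<dots> \<le> norm (\<phi> x0) * norm (1::'k)" by (rule norm_cauchy_schwarz)
    finally show ?thesis by simp
  qed
  moreover have "\<phi> \<in> carrier (conjugate_space X)"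
  proof -
    have "\<exists>C. \<forall>x\<in>carrier X. norm (\<phi> x) \<le> C * nnorm X x"
      by (rule exI[of _ 1]) (use le in simp)
    moreover have "\<phi> \<in> extensional (carrier X)" by (simp add: \<phi>_def)
    ultimately show ?thesis using add scale by (simp add: conjugate_space_def)
  qed
  moreover have "\<forall>x\<in>carrier X. norm (\<phi> x) \<le> nnorm X x" using le by simp
  moreover have "norm (\<phi> x0) = nnorm X x0" using calculation(1) le[OF x0] by (rule antisym[rotated])
  ultimately show ?thesis by (intro that[of \<phi>])
qed

end

section \<open>Duals and biduals\<close>

context normed_space
begin

abbreviation dual where "dual \<equiv> conjugate_space X"

lemma dualI:
  assumes "f \<in> extensional (carrier X)"
    "\<And>x y. x \<in> carrier X \<Longrightarrow> y \<in> carrier X \<Longrightarrow> f (x \<oplus> y) = f x + f y"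
    "\<And>c x. x \<in> carrier X \<Longrightarrow> f (c \<odot> x) = c * f x"
    "\<And>x. x \<in> carrier X \<Longrightarrow> norm (f x) \<le> C * nnorm X x"
  shows "f \<in> carrier dual"
  using assms by (auto simp: conjugate_space_def intro!: exI[of _ C])

lemma dualD:
  assumes "f \<in> carrier dual"
  shows "f \<in> extensional (carrier X)"
    "\<And>x y. x \<in> carrier X \<Longrightarrow> y \<in> carrier X \<Longrightarrow> f (x \<oplus> y) = f x + f y"
    "\<And>c x. x \<in> carrier X \<Longrightarrow> f (c \<odot> x) = c * f x"
  using assms by (auto simp: conjugate_space_def)

lemma dual_simps:
  "add dual = (\<lambda>f g. \<lambda>x\<in>carrier X. f x + g x)" "c \<odot>\<^bsub>dual\<^esub> f = (\<lambda>x\<in>carrier X. c * f x)"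
  by (simp_all add: conjugate_space_def)

lemma nnorm_zero: "nnorm X \<zero> = 0"
  using nnorm_eq_zero_iff by simp

lemma dual_bdd:
  assumes f: "f \<in> carrier dual"
  shows "bdd_above ((\<lambda>x. norm (f x)) ` {x \<in> carrier X. nnorm X x \<le> 1})"
proof -
  obtain C where C: "\<forall>x\<in>carrier X. norm (f x) \<le> C * nnorm X x"
    using f by (auto simp: conjugate_space_def)
  show ?thesis
  proof (rule bdd_aboveI2)
    fix x assume x: "x \<in> {x \<in> carrier X. nnorm X x \<le> 1}"
    then have "norm (f x) \<le> C * nnorm X x" using C by simp
    also have "\<dots> \<le> \<bar>C\<bar> * 1" using x nnorm_nonneg[of x] by (intro mult_mono) auto
    finally show "norm (f x) \<le> \<bar>C\<bar>" by simp
  qed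
qed

lemma dual_norm_upper:
  assumes f: "f \<in> carrier dual" and x: "x \<in> carrier X" "nnorm X x \<le> 1"
  shows "norm (f x) \<le> nnorm dual f"
  using cSUP_upper[OF _ dual_bdd[OF f], of x] x by (simp add: conjugate_space_def)

lemma dual_norm_nonneg:
  assumes f: "f \<in> carrier dual"
  shows "0 \<le> nnorm dual f"
  using dual_norm_upper[OF f M.zero_closed] by (simp add: nnorm_zero) (meson norm_ge_zero order_trans)

lemma dual_norm_le:
  assumes f: "f \<in> carrier dual" and x: "x \<in> carrier X"
  shows "norm (f x) \<le> nnorm dual f * nnorm X x"
proof (cases "nnorm X x = 0")
  case True
  then have "x = 0 \<odot> x" using x nnorm_eq_zero_iff by simp
  then have "f x = 0 * f x" using dualD(3)[OF f x, of 0] by simp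
  then show ?thesis using True by simp
next
  case False
  then have pos: "0 < nnorm X x" using nnorm_nonneg[OF x] by simp
  let ?c = "of_real (1 / nnorm X x) :: 'k"
  have "norm (f (?c \<odot> x)) \<le> nnorm dual f"
    using x pos by (intro dual_norm_upper f) (simp_all add: nnorm_smult norm_divide)
  then have "1 / nnorm X x * norm (f x) \<le> nnorm dual f"
    unfolding dualD(3)[OF f x] norm_mult norm_of_real using pos by simp
  then show ?thesis using pos by (simp add: field_simps)
qed

lemma dual_norm_least:
  assumes C: "0 \<le> C" and le: "\<And>x. x \<in> carrier X \<Longrightarrow> norm (f x) \<le> C * nnorm X x"
  shows "nnorm dual f \<le> C"
proof -
  have "(SUP x\<in>{x \<in> carrier X. nnorm X x \<le> 1}. norm (f x)) \<le> C"
  proof (rule cSUP_least)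
    show "{x \<in> carrier X. nnorm X x \<le> 1} \<noteq> {}" using nnorm_zero M.zero_closed by force
    fix x assume x: "x \<in> {x \<in> carrier X. nnorm X x \<le> 1}"
    have "norm (f x) \<le> C * nnorm X x" using le x by simp
    also have "\<dots> \<le> C * 1" using x C by (intro mult_left_mono) auto
    finally show "norm (f x) \<le> C" by simp
  qed
  then show ?thesis by (simp add: conjugate_space_def)
qed

lemma dual_closed:
  assumes f: "f \<in> carrier dual" and g: "g \<in> carrier dual"
  shows "f \<oplus>\<^bsub>dual\<^esub> g \<in> carrier dual" "c \<odot>\<^bsub>dual\<^esub> f \<in> carrier dual"
proof -
  show "f \<oplus>\<^bsub>dual\<^esub> g \<in> carrier dual"
  proof (rule dualI)
    fix x assume x: "x \<in> carrier X"
    show "norm ((f \<oplus>\<^bsub>dual\<^esub> g) x) \<le> (nnorm dual f + nnorm dual g) * nnorm X x"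
      using dual_norm_le[OF f x] dual_norm_le[OF g x] norm_triangle_ineq[of "f x" "g x"] x
      by (simp add: dual_simps distrib_right)
  qed (use f g in \<open>auto simp: dual_simps dualD distrib_left\<close>)
  show "c \<odot>\<^bsub>dual\<^esub> f \<in> carrier dual"
  proof (rule dualI)
    fix x assume x: "x \<in> carrier X"
    show "norm ((c \<odot>\<^bsub>dual\<^esub> f) x) \<le> (norm c * nnorm dual f) * nnorm X x"
      using dual_norm_le[OF f x] x by (simp add: dual_simps norm_mult mult.assoc mult_left_mono)
  qed (use f in \<open>auto simp: dual_simps dualD distrib_left\<close>)
qed

lemma bidualI:
  assumes "Z \<in> extensional (carrier dual)"
    "\<And>f g. f \<in> carrier dual \<Longrightarrow> g \<in> carrier dual \<Longrightarrow> Z (f \<oplus>\<^bsub>dual\<^esub> g) = Z f + Z g"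
    "\<And>c f. f \<in> carrier dual \<Longrightarrow> Z (c \<odot>\<^bsub>dual\<^esub> f) = c * Z f"
    "\<And>f. f \<in> carrier dual \<Longrightarrow> norm (Z f) \<le> C * nnorm dual f"
  shows "Z \<in> carrier (conjugate_space dual)"
  using assms by (auto simp: conjugate_space_def[of dual] intro!: exI[of _ C])

lemma bidualD:
  assumes "Z \<in> carrier (conjugate_space dual)"
  shows "Z \<in> extensional (carrier dual)"
    "\<And>f g. f \<in> carrier dual \<Longrightarrow> g \<in> carrier dual \<Longrightarrow> Z (f \<oplus>\<^bsub>dual\<^esub> g) = Z f + Z g"
    "\<And>c f. f \<in> carrier dual \<Longrightarrow> Z (c \<odot>\<^bsub>dual\<^esub> f) = c * Z f"
    "\<exists>C\<ge>0. \<forall>f\<in>carrier dual. norm (Z f) \<le> C * nnorm dual f"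
proof -
  show "Z \<in> extensional (carrier dual)"
    "\<And>f g. f \<in> carrier dual \<Longrightarrow> g \<in> carrier dual \<Longrightarrow> Z (f \<oplus>\<^bsub>dual\<^esub> g) = Z f + Z g"
    "\<And>c f. f \<in> carrier dual \<Longrightarrow> Z (c \<odot>\<^bsub>dual\<^esub> f) = c * Z f"
    using assms by (auto simp: conjugate_space_def[of dual])
  obtain C where C: "\<forall>f\<in>carrier dual. norm (Z f) \<le> C * nnorm dual f"
    using assms by (auto simp: conjugate_space_def[of dual])
  have "norm (Z f) \<le> \<bar>C\<bar> * nnorm dual f" if "f \<in> carrier dual" for f
    using C that dual_norm_nonneg[OF that] mult_right_mono[of C "\<bar>C\<bar>" "nnorm dual f"] by fastforce
  then show "\<exists>C\<ge>0. \<forall>f\<in>carrier dual. norm (Z f) \<le> C * nnorm dual f"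
    by (intro exI[of _ "\<bar>C\<bar>"]) auto
qed

lemma canonical_embedding_mem:
  assumes x: "x \<in> carrier X"
  shows "canonical_embedding X x \<in> carrier (conjugate_space dual)"
proof (rule bidualI)
  show "norm (canonical_embedding X x f) \<le> nnorm X x * nnorm dual f" if "f \<in> carrier dual" for f
    using dual_norm_le[OF that x] that by (simp add: canonical_embedding_def mult.commute)
qed (use x dual_closed in \<open>auto simp: canonical_embedding_def\<close>, auto simp: dual_simps)

lemma Metric_space_ndist: "Metric_space (carrier X) (ndist X)"
proof
  show "0 \<le> ndist X x y" for x y
    by (simp add: ndist_def nnorm_nonneg)
  show "ndist X x y = ndist X y x" for x y
  proof (cases "x \<in> carrier X \<and> y \<in> carrier X")
    case True
    then have "x \<ominus> y = (-1) \<odot> (y \<ominus> x)"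
      by (simp add: minus_eq s_add_right s_mult M.a_comm)
    then show ?thesis using True by (simp add: ndist_def nnorm_smult)
  qed (auto simp: ndist_def)
  show "ndist X x y = 0 \<longleftrightarrow> x = y" if "x \<in> carrier X" "y \<in> carrier X" for x y
  proof -
    have "x = (x \<ominus> y) \<oplus> y" using that unfolding a_minus_def by (simp add: M.a_assoc M.l_neg)
    then have "x \<ominus> y = \<zero> \<longleftrightarrow> x = y"
      using that by (metis M.l_zero M.r_neg a_minus_def)
    then show ?thesis using that by (simp add: ndist_def nnorm_eq_zero_iff)
  qed
  show "ndist X x z \<le> ndist X x y + ndist X y z"
    if "x \<in> carrier X" "y \<in> carrier X" "z \<in> carrier X" for x y z
  proof -
    have "x \<ominus> z = (x \<ominus> y) \<oplus> (y \<ominus> z)"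
      using that unfolding a_minus_def by (simp add: M.a_assoc M.r_neg1)
    then show ?thesis using that by (simp add: ndist_def nnorm_triangle)
  qed
qed

text \<open>A Cauchy sequence has a limit against every functional, and these limits form an element
  of the bidual, hence come from a point \<open>x\<close>. Convergence in norm follows because the
  distance from \<open>s n\<close> to \<open>x\<close> is seen by a norming functional, for which
  \<open>f (s n) - f (s m)\<close> is small uniformly in \<open>m\<close>.\<close>

lemma banach_of_reflexive:
  assumes refl: "canonical_embedding X ` carrier X = carrier (conjugate_space dual)"
  shows "banach_space X"
proof
  interpret MS: Metric_space "carrier X" "ndist X" by (rule Metric_space_ndist)
  show "MS.mcomplete"
    unfolding MS.mcomplete_def
  proof (intro allI impI)
    fix s assume "MS.MCauchy s"
    then have sX: "s n \<in> carrier X" and cau: "\<And>e. e > 0 \<Longrightarrow> \<exists>K. \<forall>n n'. K \<le> n \<longrightarrow> K \<le> n' \<longrightarrow> ndist X (s n) (s n') < e" for n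
      by (auto simp: MS.MCauchy_def)
    have dist: "ndist X (s n) (s m) = nnorm X (s n \<ominus> s m)" for n m using sX by (simp add: ndist_def)
    have fdiff: "f (x \<ominus> y) = f x - f y" if "f \<in> carrier dual" "x \<in> carrier X" "y \<in> carrier X" for f x y
      using that by (simp add: minus_eq dualD)
    have conv: "(\<lambda>n. f (s n)) \<longlonglongrightarrow> lim (\<lambda>n. f (s n))" if f: "f \<in> carrier dual" for f
    proof -
      have "Cauchy (\<lambda>n. f (s n))"
      proof (rule metric_CauchyI)
        fix e :: real assume e: "e > 0"
        define d where "d = e / (nnorm dual f + 1)"
        have B: "0 \<le> nnorm dual f" by (rule dual_norm_nonneg[OF f])
        then have "d > 0" using e by (simp add: d_def)
        then obtain K where K: "\<forall>n n'. K \<le> n \<longrightarrow> K \<le> n' \<longrightarrow> ndist X (s n) (s n') < d" using cau by blast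
        have "dist (f (s m)) (f (s n)) < e" if "m \<ge> K" "n \<ge> K" for m n
        proof -
          have "dist (f (s m)) (f (s n)) = norm (f (s m \<ominus> s n))"
            using fdiff[OF f sX sX] by (simp add: dist_norm)
          also have "\<dots> \<le> nnorm dual f * nnorm X (s m \<ominus> s n)"
            using sX by (intro dual_norm_le[OF f]) simp
          also have "\<dots> \<le> nnorm dual f * d"
            using K that B unfolding dist[symmetric] by (intro mult_left_mono) (auto simp: less_imp_le)
          also have "\<dots> < (nnorm dual f + 1) * d" using \<open>d > 0\<close> by simp
          also have "\<dots> = e" using B by (simp add: d_def)
          finally show ?thesis .
        qed
        then show "\<exists>M. \<forall>m\<ge>M. \<forall>n\<ge>M. dist (f (s m)) (f (s n)) < e" by blast
      qed
      then show ?thesis by (simp add: Cauchy_convergent_iff convergent_LIMSEQ_iff)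
    qed
    define Z where "Z = (\<lambda>f\<in>carrier dual. lim (\<lambda>n. f (s n)))"
    have Z: "(\<lambda>n. f (s n)) \<longlonglongrightarrow> Z f" if "f \<in> carrier dual" for f
      using conv[OF that] that by (simp add: Z_def)
    \<comment> \<open>Beyond this index all terms are within 1 of \<open>s K\<close>, which bounds
      their norms and with them \<open>Z\<close>.\<close>
    obtain K where K: "\<forall>n n'. K \<le> n \<longrightarrow> K \<le> n' \<longrightarrow> ndist X (s n) (s n') < 1" using cau[of 1] by auto
    have "Z \<in> carrier (conjugate_space dual)"
    proof (rule bidualI)
      show "Z \<in> extensional (carrier dual)" by (simp add: Z_def)
      show "Z (f \<oplus>\<^bsub>dual\<^esub> g) = Z f + Z g" if f: "f \<in> carrier dual" and g: "g \<in> carrier dual" for f g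
      proof (rule LIMSEQ_unique)
        show "(\<lambda>n. (f \<oplus>\<^bsub>dual\<^esub> g) (s n)) \<longlonglongrightarrow> Z (f \<oplus>\<^bsub>dual\<^esub> g)" using f g by (intro Z dual_closed)
        show "(\<lambda>n. (f \<oplus>\<^bsub>dual\<^esub> g) (s n)) \<longlonglongrightarrow> Z f + Z g"
          using tendsto_add[OF Z[OF f] Z[OF g]] sX by (simp add: dual_simps)
      qed
      show "Z (c \<odot>\<^bsub>dual\<^esub> f) = c * Z f" if f: "f \<in> carrier dual" for c f
      proof (rule LIMSEQ_unique)
        show "(\<lambda>n. (c \<odot>\<^bsub>dual\<^esub> f) (s n)) \<longlonglongrightarrow> Z (c \<odot>\<^bsub>dual\<^esub> f)" using f by (intro Z dual_closed)
        show "(\<lambda>n. (c \<odot>\<^bsub>dual\<^esub> f) (s n)) \<longlonglongrightarrow> c * Z f"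
          using tendsto_mult[OF tendsto_const Z[OF f]] sX by (simp add: dual_simps)
      qed
      show "norm (Z f) \<le> (nnorm X (s K) + 1) * nnorm dual f" if f: "f \<in> carrier dual" for f
      proof (rule LIMSEQ_le_const2[OF tendsto_norm[OF Z[OF f]]])
        have "norm (f (s n)) \<le> (nnorm X (s K) + 1) * nnorm dual f" if n: "n \<ge> K" for n
        proof -
          have "s n = (s n \<ominus> s K) \<oplus> s K" using sX unfolding a_minus_def by (simp add: M.a_assoc M.l_neg)
          then have "nnorm X (s n) \<le> nnorm X (s n \<ominus> s K) + nnorm X (s K)"
            using nnorm_triangle[of "s n \<ominus> s K" "s K"] sX by simp
          moreover have "nnorm X (s n \<ominus> s K) < 1" using K n dist by auto
          ultimately have "nnorm X (s n) \<le> nnorm X (s K) + 1" by linarith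
          from mult_left_mono[OF this dual_norm_nonneg[OF f]] dual_norm_le[OF f sX, of n]
          show ?thesis by (simp add: mult.commute)
        qed
        then show "\<exists>N. \<forall>n\<ge>N. norm (f (s n)) \<le> (nnorm X (s K) + 1) * nnorm dual f" by blast
      qed
    qed
    then obtain x where x: "x \<in> carrier X" and Zx: "Z = canonical_embedding X x"
      unfolding refl[symmetric] by blast
    have Zf: "Z f = f x" if "f \<in> carrier dual" for f using that by (simp add: Zx canonical_embedding_def)
    have "limitin MS.mtopology s x sequentially"
      unfolding MS.limitin_metric
    proof (intro conjI allI impI x)
      fix e :: real assume e: "e > 0"
      then obtain K where K: "\<forall>n n'. K \<le> n \<longrightarrow> K \<le> n' \<longrightarrow> ndist X (s n) (s n') < e / 2"
        using cau[of "e / 2"] by auto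
      have "ndist X (s n) x < e" if n: "n \<ge> K" for n
      proof -
        have snx: "s n \<ominus> x \<in> carrier X" using sX x by simp
        obtain f where f: "f \<in> carrier dual" "\<forall>y\<in>carrier X. norm (f y) \<le> nnorm X y"
          "norm (f (s n \<ominus> x)) = nnorm X (s n \<ominus> x)"
          by (rule Hahn_Banach_norming[OF snx])
        have "(\<lambda>m. norm (f (s n) - f (s m))) \<longlonglongrightarrow> norm (f (s n) - f x)"
          using Z[OF f(1)] unfolding Zf[OF f(1)] by (intro tendsto_intros)
        moreover have "norm (f (s n) - f (s m)) \<le> e / 2" if "m \<ge> K" for m
        proof -
          have "norm (f (s n) - f (s m)) = norm (f (s n \<ominus> s m))" using fdiff[OF f(1) sX sX] by simp
          also have "\<dots> \<le> ndist X (s n) (s m)" unfolding dist using f(2) sX by simp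
          also have "\<dots> \<le> e / 2" using K n that by (simp add: less_imp_le)
          finally show ?thesis .
        qed
        ultimately have "norm (f (s n) - f x) \<le> e / 2"
          by (intro LIMSEQ_le_const2[of "\<lambda>m. norm (f (s n) - f (s m))"]) auto
        then have "nnorm X (s n \<ominus> x) \<le> e / 2"
          using f(3) fdiff[OF f(1) sX x] by simp
        then show ?thesis using e sX x by (simp add: ndist_def)
      qed
      then show "\<forall>\<^sub>F n in sequentially. s n \<in> carrier X \<and> ndist X (s n) x < e"
        using sX by (auto simp: eventually_sequentially)
    qed
    then show "\<exists>x. limitin MS.mtopology s x sequentially" by blast
  qed
qed

end

section \<open>Normed structure of \<open>L^p(S)\<close>\<close>

context random_normed_module
begin

lemma normed_space_Lp:
  assumes p: "1 < p"
  shows "normed_space (Lp p)"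
proof -
  have const: "sm (\<lambda>_. c) x \<in> carrier (Lp p)" "nnorm (Lp p) (sm (\<lambda>_. c) x) \<le> norm c * nnorm (Lp p) x"
    if "x \<in> carrier (Lp p)" for c x
    using Lp_sm[OF _ that p, of "\<lambda>_. c" "norm c"] by simp_all
  note S = Lp_carrierD
  have zero: "\<zero> \<in> carrier (Lp p)"
  proof (rule bounded_in_Lp[OF _ p])
    show "AE w in G. N \<zero> w \<le> 0"
      using AE_N_eq_0_iff[of "\<zero>"] by (auto elim!: eventually_mono)
  qed auto
  show ?thesis
  proof (intro normed_space.intro normed_space_axioms.intro)
    show "Module.module scalar_ring (Lp p)"
    proof (rule moduleI)
      show "cring (scalar_ring :: 'k ring)" by (rule cring_scalar_ring)
      show "abelian_group (Lp p)"
      proof (rule abelian_groupI)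
        fix x assume x: "x \<in> carrier (Lp p)"
        have "sm (\<lambda>_. -1) x \<oplus> x = \<zero>"
          using sm_add[of "\<lambda>_. -1" "\<lambda>_. 1" x] S[OF x] by simp
        then show "\<exists>y\<in>carrier (Lp p). y \<oplus>\<^bsub>Lp p\<^esub> x = \<zero>\<^bsub>Lp p\<^esub>"
          using const(1)[OF x, of "-1"] by (intro bexI[of _ "sm (\<lambda>_. -1) x"]) simp_all
        show "\<zero>\<^bsub>Lp p\<^esub> \<oplus>\<^bsub>Lp p\<^esub> x = x" using S[OF x] by simp
        fix y assume y: "y \<in> carrier (Lp p)"
        show "x \<oplus>\<^bsub>Lp p\<^esub> y \<in> carrier (Lp p)" using Lp_add(1)[OF x y p] by simp
        show "x \<oplus>\<^bsub>Lp p\<^esub> y = y \<oplus>\<^bsub>Lp p\<^esub> x" using S[OF x] S[OF y] by (simp add: M.a_comm)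
        fix z assume z: "z \<in> carrier (Lp p)"
        show "x \<oplus>\<^bsub>Lp p\<^esub> y \<oplus>\<^bsub>Lp p\<^esub> z = x \<oplus>\<^bsub>Lp p\<^esub> (y \<oplus>\<^bsub>Lp p\<^esub> z)"
          using S[OF x] S[OF y] S[OF z] by (simp add: M.a_assoc)
      qed (simp add: zero)
    qed (use const in \<open>auto simp: sm_add sm_mult sm_add_right dest!: S\<close>)
    fix x assume x: "x \<in> carrier (Lp p)"
    show "0 \<le> nnorm (Lp p) x" by (rule nnorm_Lp_nonneg)
    show "nnorm (Lp p) (c \<odot>\<^bsub>Lp p\<^esub> x) = norm c * nnorm (Lp p) x" for c
    proof (rule antisym)
      show "nnorm (Lp p) (c \<odot>\<^bsub>Lp p\<^esub> x) \<le> norm c * nnorm (Lp p) x" using const(2)[OF x] by simp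
      \<comment> \<open>The upper estimate applied to \<open>1 / c\<close> gives the lower estimate
        for \<open>c\<close>.\<close>
      show "norm c * nnorm (Lp p) x \<le> nnorm (Lp p) (c \<odot>\<^bsub>Lp p\<^esub> x)"
      proof (cases "c = 0")
        case False
        have "nnorm (Lp p) x = nnorm (Lp p) (sm (\<lambda>_. 1 / c) (sm (\<lambda>_. c) x))"
          using S[OF x] False by (simp add: sm_mult)
        also have "\<dots> \<le> norm (1 / c) * nnorm (Lp p) (sm (\<lambda>_. c) x)"
          by (rule const(2)[OF const(1)[OF x]])
        finally show ?thesis using False by (simp add: norm_divide field_simps)
      qed (simp add: nnorm_Lp_nonneg)
    qed
    show "nnorm (Lp p) x = 0 \<longleftrightarrow> x = \<zero>\<^bsub>Lp p\<^esub>"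
    proof
      assume "nnorm (Lp p) x = 0"
      then have "AE w in G. N x w = 0"
        using Lp_integral[OF x p] S[OF x] p by (intro AE_zero_of_nn_integral_powr[of _ _ p]) simp_all
      then show "x = \<zero>\<^bsub>Lp p\<^esub>" using AE_N_eq_0_iff[OF S[OF x]] by simp
    next
      assume "x = \<zero>\<^bsub>Lp p\<^esub>"
      then have "x = sm (\<lambda>_. 0) x" using S[OF x] by simp
      then show "nnorm (Lp p) x = 0" using const(2)[OF x, of 0] nnorm_Lp_nonneg[of p x] by simp
    qed
    fix y assume y: "y \<in> carrier (Lp p)"
    show "nnorm (Lp p) (x \<oplus>\<^bsub>Lp p\<^esub> y) \<le> nnorm (Lp p) x + nnorm (Lp p) y"
      using Lp_add(2)[OF x y p] by simp
  qed
qed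

end

section \<open>Random reflexivity and reflexivity\<close>

context random_normed_module
begin

interpretation C: random_normed_module G conj_module
  by (rule random_normed_module_conj)

lemma C_N: "C.N f = Nc f"
  by (simp add: C.N_def Nc_def)

lemma C_sm_rep:
  assumes f: "f \<in> carrier conj_module" and a: "a \<in> borel_measurable G" and x: "x \<in> carrier S"
  shows "AE w in G. L0_rep (C.sm a f x) w = a w * L0_rep (f x) w"
  using conj_smult_rep(2)[OF f L0_class_in_L0[OF a] x] AE_L0_rep_class[OF a]
  unfolding C.sm_def by eventually_elim simp

text \<open>Hoelder's inequality applied to the pointwise bound
  \<open>Nc f w * N x w\<close>.\<close>

lemma pairing:
  assumes p: "1 < p" "1 < q" "1 / p + 1 / q = 1"
    and f: "f \<in> carrier (C.Lp q)" and x: "x \<in> carrier (Lp p)"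
  shows "integrable G (L0_rep (f x))"
    and "norm (\<integral>w. L0_rep (f x) w \<partial>G) \<le> nnorm (C.Lp q) f * nnorm (Lp p) x"
proof -
  have fS: "f \<in> carrier conj_module" and xS: "x \<in> carrier S"
    using f x by (simp_all add: C.Lp_carrierD Lp_carrierD)
  have m [measurable]: "L0_rep (f x) \<in> borel_measurable G" using fS xS by simp
  have "(\<integral>\<^sup>+ w. ennreal (norm (L0_rep (f x) w)) \<partial>G) \<le> (\<integral>\<^sup>+ w. ennreal (C.N f w * N x w) \<partial>G)"
    using AE_conj_le[OF fS xS]
    by (intro nn_integral_mono_AE, eventually_elim) (simp add: C_N ennreal_leI)
  also have "\<dots> \<le> ennreal (nnorm (C.Lp q) f * nnorm (Lp p) x)"
    using p C.AE_N_nonneg[OF fS] AE_N_nonneg[OF xS] fS xS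
    by (intro nn_integral_Hoelder[of _ _ _ q p])
      (simp_all add: C.nnorm_Lp_nonneg nnorm_Lp_nonneg C.Lp_integral[OF f] Lp_integral[OF x] add.commute)
  finally have le: "(\<integral>\<^sup>+ w. ennreal (norm (L0_rep (f x) w)) \<partial>G) \<le> ennreal (nnorm (C.Lp q) f * nnorm (Lp p) x)" .
  then show i: "integrable G (L0_rep (f x))"
    using m by (intro integrableI_bounded) (auto intro: le_less_trans)
  have "norm (\<integral>w. L0_rep (f x) w \<partial>G) \<le> (\<integral>w. norm (L0_rep (f x) w) \<partial>G)"
    by (rule integral_norm_bound)
  also have "ennreal \<dots> \<le> ennreal (nnorm (C.Lp q) f * nnorm (Lp p) x)"
    using le i by (subst nn_integral_eq_integral[symmetric]) auto
  then have "(\<integral>w. norm (L0_rep (f x) w) \<partial>G) \<le> nnorm (C.Lp q) f * nnorm (Lp p) x"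
    by (subst (asm) ennreal_le_iff) (simp_all add: C.nnorm_Lp_nonneg nnorm_Lp_nonneg)
  finally show "norm (\<integral>w. L0_rep (f x) w \<partial>G) \<le> nnorm (C.Lp q) f * nnorm (Lp p) x" .
qed

text \<open>The identification of the \<open>L^q\<close> space of the conjugate module with the dual
  of \<open>L^p(S)\<close>. The restriction to the carrier makes the values extensional, as members
  of \<open>conjugate_space\<close> are.\<close>

definition dual_map :: "real \<Rightarrow> ('a \<Rightarrow> ('w \<Rightarrow> 'k) set) \<Rightarrow> 'a \<Rightarrow> 'k" where
  "dual_map p f = (\<lambda>x\<in>carrier (Lp p). \<integral>w. L0_rep (f x) w \<partial>G)"

section \<open>The dual of \<open>L^p(S)\<close> and the two implications\<close>

context
  fixes p q :: real
  assumes p: "1 < p" and q: "1 < q" and pq: "1 / p + 1 / q = 1"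
begin

interpretation X: normed_space "Lp p"
  by (rule normed_space_Lp[OF p])

lemma X_closed:
  "x \<in> carrier (Lp p) \<Longrightarrow> y \<in> carrier (Lp p) \<Longrightarrow> x \<oplus> y \<in> carrier (Lp p)"
  "x \<in> carrier (Lp p) \<Longrightarrow> sm (\<lambda>_. c) x \<in> carrier (Lp p)"
  using X.M.a_closed[of x y] X.s_closed[of x c] by simp_all

lemma dual_map_mem:
  assumes f: "f \<in> carrier (C.Lp q)"
  shows "dual_map p f \<in> carrier X.dual" "nnorm X.dual (dual_map p f) \<le> nnorm (C.Lp q) f"
proof -
  note pr = pairing[OF p q pq f]
  have fS: "f \<in> carrier conj_module" using f by (simp add: C.Lp_carrierD)
  have le: "norm (dual_map p f x) \<le> nnorm (C.Lp q) f * nnorm (Lp p) x" if "x \<in> carrier (Lp p)" for x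
    using pr(2)[OF that] that by (simp add: dual_map_def)
  show "dual_map p f \<in> carrier X.dual"
  proof (rule X.dualI)
    fix x y assume x: "x \<in> carrier (Lp p)" and y: "y \<in> carrier (Lp p)"
    note xS = Lp_carrierD[OF x] and yS = Lp_carrierD[OF y]
    have "(\<integral>w. L0_rep (f (x \<oplus> y)) w \<partial>G) = (\<integral>w. L0_rep (f x) w + L0_rep (f y) w \<partial>G)"
      using AE_conj_add[OF fS xS yS] fS xS yS
      by (intro integral_cong_AE borel_measurable_add) simp_all
    then show "dual_map p f (x \<oplus>\<^bsub>Lp p\<^esub> y) = dual_map p f x + dual_map p f y"
      using pr(1)[OF x] pr(1)[OF y] x y by (simp add: dual_map_def X_closed)
  next
    fix c x assume x: "x \<in> carrier (Lp p)"
    note xS = Lp_carrierD[OF x]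
    have "(\<integral>w. L0_rep (f (sm (\<lambda>_. c) x)) w \<partial>G) = (\<integral>w. c * L0_rep (f x) w \<partial>G)"
      using AE_conj_sm[OF fS xS, of "\<lambda>_. c"] fS xS
      by (intro integral_cong_AE borel_measurable_times) simp_all
    then show "dual_map p f (c \<odot>\<^bsub>Lp p\<^esub> x) = c * dual_map p f x"
      using pr(1)[OF x] x by (simp add: dual_map_def X_closed)
  qed (use le in \<open>auto simp: dual_map_def\<close>)
  show "nnorm X.dual (dual_map p f) \<le> nnorm (C.Lp q) f"
    using le by (rule X.dual_norm_least[OF C.nnorm_Lp_nonneg])
qed

lemma dual_map_add:
  assumes f: "f \<in> carrier (C.Lp q)" and g: "g \<in> carrier (C.Lp q)"
  shows "dual_map p (f \<oplus>\<^bsub>conj_module\<^esub> g) = dual_map p f \<oplus>\<^bsub>X.dual\<^esub> dual_map p g"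
proof
  fix x
  have fS: "f \<in> carrier conj_module" "g \<in> carrier conj_module" using f g by (simp_all add: C.Lp_carrierD)
  show "dual_map p (f \<oplus>\<^bsub>conj_module\<^esub> g) x = (dual_map p f \<oplus>\<^bsub>X.dual\<^esub> dual_map p g) x"
  proof (cases "x \<in> carrier (Lp p)")
    case x: True
    note xS = Lp_carrierD[OF x]
    have "(\<integral>w. L0_rep ((f \<oplus>\<^bsub>conj_module\<^esub> g) x) w \<partial>G) = (\<integral>w. L0_rep (f x) w + L0_rep (g x) w \<partial>G)"
      using conj_add_rep(2)[OF fS xS] fS xS conj_add_rep(1)[OF fS]
      by (intro integral_cong_AE borel_measurable_add) simp_all
    then show ?thesis
      using pairing(1)[OF p q pq f x] pairing(1)[OF p q pq g x] x by (simp add: dual_map_def X.dual_simps)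
  qed (simp add: dual_map_def X.dual_simps)
qed

lemma dual_map_smult:
  assumes f: "f \<in> carrier (C.Lp q)"
  shows "dual_map p (C.sm (\<lambda>_. c) f) = c \<odot>\<^bsub>X.dual\<^esub> dual_map p f"
proof
  fix x
  have fS: "f \<in> carrier conj_module" using f by (simp add: C.Lp_carrierD)
  show "dual_map p (C.sm (\<lambda>_. c) f) x = (c \<odot>\<^bsub>X.dual\<^esub> dual_map p f) x"
  proof (cases "x \<in> carrier (Lp p)")
    case x: True
    note xS = Lp_carrierD[OF x]
    have "(\<integral>w. L0_rep (C.sm (\<lambda>_. c) f x) w \<partial>G) = (\<integral>w. c * L0_rep (f x) w \<partial>G)"
      using C_sm_rep[OF fS _ xS, of "\<lambda>_. c"] fS xS
      by (intro integral_cong_AE borel_measurable_times) simp_all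
    then show ?thesis
      using pairing(1)[OF p q pq f x] x by (simp add: dual_map_def X.dual_simps)
  qed (simp add: dual_map_def X.dual_simps)
qed

text \<open>The Riesz representation with the dual norm of \<open>\<phi>\<close> as the constant.
  With the opposite estimate in \<open>dual_map_mem\<close> the map is isometric once injectivity is
  known.\<close>

lemma dual_map_surj:
  assumes \<phi>: "\<phi> \<in> carrier X.dual"
  obtains f where "f \<in> carrier (C.Lp q)" "nnorm (C.Lp q) f \<le> nnorm X.dual \<phi>" "dual_map p f = \<phi>"
proof -
  obtain f where f: "f \<in> carrier conj_module"
    "(\<integral>\<^sup>+ w. ennreal (Nc f w powr q) \<partial>G) \<le> ennreal (nnorm X.dual \<phi> powr q)"
    "\<forall>x\<in>carrier (Lp p). integrable G (L0_rep (f x)) \<and> \<phi> x = (\<integral>w. L0_rep (f x) w \<partial>G)"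
  proof (rule Riesz_representation[OF p q pq X.dual_norm_nonneg[OF \<phi>], of \<phi>])
    show "\<phi> (x \<oplus> y) = \<phi> x + \<phi> y" if "x \<in> carrier (Lp p)" "y \<in> carrier (Lp p)" for x y
      using X.dualD(2)[OF \<phi> that] by simp
    show "\<phi> (sm (\<lambda>_. c) x) = c * \<phi> x" if "x \<in> carrier (Lp p)" for c x
      using X.dualD(3)[OF \<phi> that, of c] by simp
  qed (rule X.dual_norm_le[OF \<phi>])
  note fL = C.LpI[OF f(1) q X.dual_norm_nonneg[OF \<phi>], unfolded C_N, OF f(2)]
  have "dual_map p f = \<phi>"
  proof
    fix x show "dual_map p f x = \<phi> x"
      using f(3) X.dualD(1)[OF \<phi>] by (cases "x \<in> carrier (Lp p)") (auto simp: dual_map_def extensional_def)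
  qed
  with fL show ?thesis by (intro that)
qed

text \<open>Equality of functionals has to be shown on all of \<open>S\<close>, although
  \<open>dual_map\<close> sees only \<open>L^p(S)\<close>. For \<open>x\<close> in \<open>S\<close>
  the multiples \<open>sm a x\<close> with \<open>norm (a w)\<close> at most
  \<open>1 / (1 + \<bar>N x w\<bar>)\<close> lie in \<open>L^p(S)\<close>, and their integrals
  determine the values at \<open>x\<close>.\<close>

lemma dual_map_inj:
  assumes f: "f \<in> carrier (C.Lp q)" and g: "g \<in> carrier (C.Lp q)" and eq: "dual_map p f = dual_map p g"
  shows "f = g"
proof -
  have fS: "f \<in> carrier conj_module" and gS: "g \<in> carrier conj_module"
    using f g by (simp_all add: C.Lp_carrierD)
  show ?thesis
  proof (rule conj_eqI[OF fS gS])
    fix x assume x: "x \<in> carrier S"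
    note [measurable] = N_measurable[OF x]
    show "AE w in G. L0_rep (f x) w = L0_rep (g x) w"
    proof (rule AE_eq_of_test_integrals)
      show "L0_rep (f x) \<in> borel_measurable G" "L0_rep (g x) \<in> borel_measurable G" using fS gS x by simp_all
      show "(\<lambda>w. 1 / (1 + \<bar>N x w\<bar>)) \<in> borel_measurable G" by measurable
      show "0 < 1 / (1 + \<bar>N x w\<bar>)" for w by (simp add: add_pos_nonneg)
      fix a :: "'w \<Rightarrow> 'k" assume a: "a \<in> borel_measurable G" and le: "\<And>w. norm (a w) \<le> 1 / (1 + \<bar>N x w\<bar>)"
      have ax: "sm a x \<in> carrier (Lp p)"
      proof (rule bounded_in_Lp[OF sm_closed[OF a x] p, of 1])
        show "AE w in G. N (sm a x) w \<le> 1"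
          using AE_N_sm[OF a x] AE_N_nonneg[OF x]
        proof eventually_elim
          case (elim w)
          have "norm (a w) * N x w \<le> 1 / (1 + \<bar>N x w\<bar>) * N x w" using elim le by (intro mult_right_mono)
          also have "\<dots> \<le> 1" using elim by simp
          finally show ?case using elim by simp
        qed
      qed simp
      have *: "integrable G (\<lambda>w. a w * L0_rep (h x) w) \<and>
          (\<integral>w. a w * L0_rep (h x) w \<partial>G) = dual_map p h (sm a x)" if h: "h \<in> carrier (C.Lp q)" for h
      proof -
        have hS: "h \<in> carrier conj_module" using h by (simp add: C.Lp_carrierD)
        note [measurable] = a rep_conj_measurable[OF hS x] rep_conj_measurable[OF hS sm_closed[OF a x]]
        have AE: "AE w in G. L0_rep (h (sm a x)) w = a w * L0_rep (h x) w" by (rule AE_conj_sm[OF hS x a])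
        have "integrable G (L0_rep (h (sm a x))) \<longleftrightarrow> integrable G (\<lambda>w. a w * L0_rep (h x) w)"
          using AE by (intro integrable_cong_AE) measurable
        moreover have "(\<integral>w. L0_rep (h (sm a x)) w \<partial>G) = (\<integral>w. a w * L0_rep (h x) w \<partial>G)"
          using AE by (intro integral_cong_AE) measurable
        ultimately show ?thesis
          using pairing(1)[OF p q pq h ax] ax by (simp add: dual_map_def)
      qed
      show "integrable G (\<lambda>w. a w * L0_rep (f x) w) \<and> integrable G (\<lambda>w. a w * L0_rep (g x) w) \<and>
          (\<integral>w. a w * L0_rep (f x) w \<partial>G) = (\<integral>w. a w * L0_rep (g x) w \<partial>G)"
        using *[OF f] *[OF g] eq by simp
    qed
  qed
qed

text \<open>Evaluation at \<open>x\<close> has \<open>N x\<close> as a random bound.\<close>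

lemma embedding_mem:
  assumes x: "x \<in> carrier S"
  shows "random_embedding G S x \<in> carrier C.conj_module"
proof -
  define u where "u = (\<lambda>f :: 'a \<Rightarrow> ('w \<Rightarrow> 'k) set. L0_rep (f x))"
  have eq: "random_embedding G S x = C.conj_of u"
    unfolding random_embedding_def C.conj_of_def u_def
    using x by (intro restrict_ext) (simp add: L0_class_rep[OF conj_L0])
  show ?thesis
    unfolding eq
  proof (rule C.conj_of(1))
    show "AE w in G. u (f \<oplus>\<^bsub>conj_module\<^esub> g) w = u f w + u g w"
      if "f \<in> carrier conj_module" "g \<in> carrier conj_module" for f g
      unfolding u_def by (rule conj_add_rep(2)[OF that x])
    show "AE w in G. u (C.sm a f) w = a w * u f w"
      if "a \<in> borel_measurable G" "f \<in> carrier conj_module" for a f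
      unfolding u_def by (rule C_sm_rep[OF that(2,1) x])
    show "AE w in G. norm (u f w) \<le> N x w * C.N f w" if "f \<in> carrier conj_module" for f
      using AE_conj_le[OF that x] unfolding u_def C_N by (simp add: mult.commute)
  qed (use x AE_N_nonneg[OF x] in \<open>simp_all add: u_def\<close>)
qed

lemma reflexive_of_random_reflexive:
  assumes refl: "random_embedding G S ` carrier S = carrier C.conj_module"
  shows "reflexive_banach_space (Lp p)"
proof -
  have surj: "\<exists>x\<in>carrier (Lp p). Z = canonical_embedding (Lp p) x"
    if Z: "Z \<in> carrier (conjugate_space X.dual)" for Z
  proof -
    obtain B where B: "0 \<le> B" "\<forall>\<phi>\<in>carrier X.dual. norm (Z \<phi>) \<le> B * nnorm X.dual \<phi>"
      using X.bidualD(4)[OF Z] by blast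
    have Zle: "norm (Z (dual_map p f)) \<le> B * nnorm (C.Lp q) f" if f: "f \<in> carrier (C.Lp q)" for f
    proof -
      have "norm (Z (dual_map p f)) \<le> B * nnorm X.dual (dual_map p f)"
        using B(2) dual_map_mem(1)[OF f] by simp
      also have "\<dots> \<le> B * nnorm (C.Lp q) f"
        using B(1) dual_map_mem(2)[OF f] by (intro mult_left_mono)
      finally show ?thesis .
    qed
    have qp: "1 / q + 1 / p = 1" using pq by simp
    obtain F where F: "F \<in> carrier C.conj_module"
      and ZF: "\<forall>f\<in>carrier (C.Lp q). integrable G (L0_rep (F f)) \<and>
        Z (dual_map p f) = (\<integral>w. L0_rep (F f) w \<partial>G)"
    proof (rule C.Riesz_representation[OF q p qp B(1), of "\<lambda>f. Z (dual_map p f)"])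
      show "Z (dual_map p (f \<oplus>\<^bsub>conj_module\<^esub> g)) = Z (dual_map p f) + Z (dual_map p g)"
        if "f \<in> carrier (C.Lp q)" "g \<in> carrier (C.Lp q)" for f g
        using that by (simp add: dual_map_add X.bidualD(2)[OF Z] dual_map_mem)
      show "Z (dual_map p (C.sm (\<lambda>_. c) f)) = c * Z (dual_map p f)" if "f \<in> carrier (C.Lp q)" for c f
        using that by (simp add: dual_map_smult X.bidualD(3)[OF Z] dual_map_mem)
    qed (use Zle in simp_all)
    obtain x where x: "x \<in> carrier S" and Fx: "F = random_embedding G S x"
      using F unfolding refl[symmetric] by blast
    have Ff: "F f = f x" if "f \<in> carrier conj_module" for f
      using that by (simp add: Fx random_embedding_def)
    have Zx: "Z (dual_map p f) = (\<integral>w. L0_rep (f x) w \<partial>G)" if f: "f \<in> carrier (C.Lp q)" for f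
      using ZF f Ff C.Lp_carrierD[OF f] by simp
    note [measurable] = N_measurable[OF x]
    define a where "a = (\<lambda>(i::nat) w. if N x w \<le> real i then 1 else 0 :: 'k)"
    have a [measurable]: "a i \<in> borel_measurable G" for i unfolding a_def by measurable
    have ax: "sm (a i) x \<in> carrier (Lp p)" for i
    proof (rule bounded_in_Lp[OF sm_closed[OF a x] p, of "real i"])
      show "AE w in G. N (sm (a i) x) w \<le> real i"
        using AE_N_sm[OF a x, of i] by eventually_elim (simp add: a_def)
    qed simp
    \<comment> \<open>A functional norming the truncation is represented by some \<open>f\<close> of
      \<open>L^q\<close> norm at most 1. The indicator \<open>a i\<close> can be moved from
      \<open>x\<close> to \<open>f\<close>, so the norm of the truncation is the modulus of a value
      of \<open>Z\<close> on a functional of norm at most 1, whatever \<open>i\<close> is.\<close>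
    have axB: "nnorm (Lp p) (sm (a i) x) \<le> B" for i
    proof -
      obtain \<phi> where \<phi>: "\<phi> \<in> carrier X.dual" "\<forall>y\<in>carrier (Lp p). norm (\<phi> y) \<le> nnorm (Lp p) y"
        "norm (\<phi> (sm (a i) x)) = nnorm (Lp p) (sm (a i) x)"
        by (rule X.Hahn_Banach_norming[OF ax])
      have "nnorm X.dual \<phi> \<le> 1" using \<phi>(2) by (intro X.dual_norm_least) simp_all
      moreover obtain f where f: "f \<in> carrier (C.Lp q)" "nnorm (C.Lp q) f \<le> nnorm X.dual \<phi>" "dual_map p f = \<phi>"
        by (rule dual_map_surj[OF \<phi>(1)])
      ultimately have f1: "nnorm (C.Lp q) f \<le> 1" by simp
      have fS: "f \<in> carrier conj_module" by (rule C.Lp_carrierD[OF f(1)])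
      have g: "C.sm (a i) f \<in> carrier (C.Lp q)" "nnorm (C.Lp q) (C.sm (a i) f) \<le> 1 * nnorm (C.Lp q) f"
        using C.Lp_sm[OF a f(1) q zero_le_one, of i] by (simp_all add: a_def)
      have gS: "C.sm (a i) f \<in> carrier conj_module" by (rule C.Lp_carrierD[OF g(1)])
      have "AE w in G. L0_rep (f (sm (a i) x)) w = L0_rep (C.sm (a i) f x) w"
        using AE_conj_sm[OF fS x a, of i] C_sm_rep[OF fS a x, of i] by eventually_elim simp
      then have "\<phi> (sm (a i) x) = Z (dual_map p (C.sm (a i) f))"
        unfolding Zx[OF g(1)] f(3)[symmetric] using ax fS gS x a
        by (simp add: dual_map_def) (intro integral_cong_AE, simp_all)
      then have "nnorm (Lp p) (sm (a i) x) \<le> B * nnorm (C.Lp q) (C.sm (a i) f)"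
        using Zle[OF g(1)] \<phi>(3) by simp
      also have "\<dots> \<le> B * 1" using g(2) f1 B(1) by (intro mult_left_mono) auto
      finally show ?thesis by simp
    qed
    \<comment> \<open>Fatou's lemma turns the uniform bound on the truncations into a bound for
      \<open>x\<close>.\<close>
    have "(\<integral>\<^sup>+ w. ennreal (N x w powr p) \<partial>G) \<le> ennreal (B powr p)"
    proof -
      have "AE w in G. \<forall>i. N (sm (a i) x) w = norm (a i w) * N x w"
        using AE_N_sm[OF a x] by (simp add: AE_all_countable)
      then have AE: "AE w in G. ennreal (N x w powr p) = liminf (\<lambda>i. ennreal (N (sm (a i) x) w powr p))"
      proof eventually_elim
        case (elim w)
        obtain K :: nat where "N x w \<le> real K" using real_arch_simple by blast
        then have "eventually (\<lambda>i. ennreal (N (sm (a i) x) w powr p) = ennreal (N x w powr p)) sequentially"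
        proof (intro eventually_sequentiallyI[of K])
          fix i assume "K \<le> i"
          then have "norm (a i w) = 1" using \<open>N x w \<le> real K\<close> by (simp add: a_def)
          then show "ennreal (N (sm (a i) x) w powr p) = ennreal (N x w powr p)" using elim by simp
        qed
        from lim_imp_Liminf[OF trivial_limit_sequentially tendsto_eventually[OF this]] show ?case by simp
      qed
      have "(\<integral>\<^sup>+ w. ennreal (N x w powr p) \<partial>G) = (\<integral>\<^sup>+ w. liminf (\<lambda>i. ennreal (N (sm (a i) x) w powr p)) \<partial>G)"
        by (rule nn_integral_cong_AE[OF AE])
      also have "\<dots> \<le> liminf (\<lambda>i. \<integral>\<^sup>+ w. ennreal (N (sm (a i) x) w powr p) \<partial>G)"
      proof (rule nn_integral_liminf)
        fix i
        have [measurable]: "N (sm (a i) x) \<in> borel_measurable G" by (rule N_measurable[OF sm_closed[OF a x]])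
        show "(\<lambda>w. ennreal (N (sm (a i) x) w powr p)) \<in> borel_measurable G" by measurable
      qed
      also have "\<dots> \<le> liminf (\<lambda>i::nat. ennreal (B powr p))"
        using axB p nnorm_Lp_nonneg unfolding Lp_integral[OF ax p]
        by (intro Liminf_mono always_eventually allI ennreal_leI powr_mono2) auto
      also have "\<dots> = ennreal (B powr p)" by (simp add: Liminf_const)
      finally show ?thesis .
    qed
    then have xL: "x \<in> carrier (Lp p)" by (rule LpI(1)[OF x p B(1)])
    have "Z = canonical_embedding (Lp p) x"
    proof
      fix \<phi>
      show "Z \<phi> = canonical_embedding (Lp p) x \<phi>"
      proof (cases "\<phi> \<in> carrier X.dual")
        case True
        then obtain f where f: "f \<in> carrier (C.Lp q)" "dual_map p f = \<phi>"
          by (rule dual_map_surj)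
        have "Z \<phi> = \<phi> x" using Zx[OF f(1)] xL unfolding f(2)[symmetric] by (simp add: dual_map_def)
        then show ?thesis using True by (simp add: canonical_embedding_def)
      next
        case False
        then show ?thesis using X.bidualD(1)[OF Z] by (simp add: canonical_embedding_def extensional_def)
      qed
    qed
    with xL show ?thesis by blast
  qed
  have eq: "canonical_embedding (Lp p) ` carrier (Lp p) = carrier (conjugate_space X.dual)"
  proof (rule antisym)
    show "canonical_embedding (Lp p) ` carrier (Lp p) \<subseteq> carrier (conjugate_space X.dual)"
      using X.canonical_embedding_mem by (rule image_subsetI)
    show "carrier (conjugate_space X.dual) \<subseteq> canonical_embedding (Lp p) ` carrier (Lp p)"
      using surj by blast
  qed
  then show ?thesis
    unfolding reflexive_banach_space_def using X.banach_of_reflexive by simp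
qed

lemma random_reflexive_of_reflexive:
  assumes refl: "canonical_embedding (Lp p) ` carrier (Lp p) = carrier (conjugate_space X.dual)"
  shows "random_embedding G S ` carrier S = carrier C.conj_module"
proof (rule antisym)
  show "random_embedding G S ` carrier S \<subseteq> carrier C.conj_module"
    using embedding_mem by (rule image_subsetI)
  show "carrier C.conj_module \<subseteq> random_embedding G S ` carrier S"
  proof
    fix F assume F: "F \<in> carrier C.conj_module"
    note [measurable] = C.Nc_measurable[OF F]
    \<comment> \<open>The factor reduces the random bound of \<open>F\<close> to 1, so that only
      \<open>Nc f\<close> remains to be integrated.\<close>
    define c where "c = (\<lambda>w. of_real (1 / (1 + \<bar>C.Nc F w\<bar>)) :: 'k)"
    have c [measurable]: "c \<in> borel_measurable G" by (simp add: c_def)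
    have nc: "norm (c w) = 1 / (1 + \<bar>C.Nc F w\<bar>)" for w
      unfolding c_def norm_of_real by simp
    have bound: "AE w in G. norm (c w * L0_rep (F f) w) \<le> Nc f w" if f: "f \<in> carrier conj_module" for f
      using C.AE_conj_le[OF F f] C.AE_Nc_nonneg[OF F] AE_Nc_nonneg[OF f]
    proof eventually_elim
      case (elim w)
      have "norm (c w * L0_rep (F f) w) \<le> 1 / (1 + \<bar>C.Nc F w\<bar>) * (C.Nc F w * Nc f w)"
        unfolding norm_mult nc using elim(1) by (intro mult_left_mono) (simp_all add: C_N)
      also have "\<dots> \<le> Nc f w" using elim by (simp add: field_simps)
      finally show ?case .
    qed
    have m: "(\<lambda>w. c w * L0_rep (F f) w) \<in> borel_measurable G" if "f \<in> carrier conj_module" for f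
      using F that by (intro borel_measurable_times c) simp
    have int: "integrable G (\<lambda>w. c w * L0_rep (F f) w)"
      and int_le: "norm (\<integral>w. c w * L0_rep (F f) w \<partial>G) \<le> nnorm (C.Lp q) f"
      if f: "f \<in> carrier (C.Lp q)" for f
    proof -
      have fS: "f \<in> carrier conj_module" by (rule C.Lp_carrierD[OF f])
      have "(\<integral>\<^sup>+ w. ennreal (norm (c w * L0_rep (F f) w)) \<partial>G) \<le> (\<integral>\<^sup>+ w. ennreal (C.N f w * 1) \<partial>G)"
        using bound[OF fS] by (intro nn_integral_mono_AE, eventually_elim) (simp add: C_N ennreal_leI)
      \<comment> \<open>The second factor is the constant 1, of \<open>p\<close>-norm 1 on a
        probability space.\<close>
      also have "\<dots> \<le> ennreal (nnorm (C.Lp q) f * 1)"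
        using p q pq C.AE_N_nonneg[OF fS] fS
        by (intro nn_integral_Hoelder[of _ _ _ q p])
          (simp_all add: C.nnorm_Lp_nonneg C.Lp_integral[OF f] add.commute emeasure_space_1)
      finally have le: "(\<integral>\<^sup>+ w. ennreal (norm (c w * L0_rep (F f) w)) \<partial>G) \<le> ennreal (nnorm (C.Lp q) f)"
        by simp
      then show i: "integrable G (\<lambda>w. c w * L0_rep (F f) w)"
        using m[OF fS] by (intro integrableI_bounded) (auto intro: le_less_trans)
      have "norm (\<integral>w. c w * L0_rep (F f) w \<partial>G) \<le> (\<integral>w. norm (c w * L0_rep (F f) w) \<partial>G)"
        by (rule integral_norm_bound)
      also have "ennreal \<dots> \<le> ennreal (nnorm (C.Lp q) f)"
        using le i by (subst nn_integral_eq_integral[symmetric]) auto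
      then have "(\<integral>w. norm (c w * L0_rep (F f) w) \<partial>G) \<le> nnorm (C.Lp q) f"
        by (subst (asm) ennreal_le_iff) (simp_all add: C.nnorm_Lp_nonneg)
      finally show "norm (\<integral>w. c w * L0_rep (F f) w \<partial>G) \<le> nnorm (C.Lp q) f" .
    qed
    define V where "V = (\<lambda>f. \<integral>w. c w * L0_rep (F f) w \<partial>G)"
    \<comment> \<open>An inverse \<open>R\<close> of \<open>dual_map\<close> by choice. It is
      additive and homogeneous because \<open>dual_map\<close> is injective, which makes
      \<open>Z\<close> linear.\<close>
    have "\<forall>\<phi>\<in>carrier X.dual. \<exists>f. f \<in> carrier (C.Lp q) \<and> nnorm (C.Lp q) f \<le> nnorm X.dual \<phi> \<and> dual_map p f = \<phi>"
    proof
      fix \<phi> assume "\<phi> \<in> carrier X.dual"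
      then obtain f where "f \<in> carrier (C.Lp q)" "nnorm (C.Lp q) f \<le> nnorm X.dual \<phi>" "dual_map p f = \<phi>"
        by (rule dual_map_surj)
      then show "\<exists>f. f \<in> carrier (C.Lp q) \<and> nnorm (C.Lp q) f \<le> nnorm X.dual \<phi> \<and> dual_map p f = \<phi>"
        by (intro exI conjI)
    qed
    from bchoice[OF this] obtain R where
      "\<forall>\<phi>\<in>carrier X.dual. R \<phi> \<in> carrier (C.Lp q) \<and> nnorm (C.Lp q) (R \<phi>) \<le> nnorm X.dual \<phi> \<and> dual_map p (R \<phi>) = \<phi>" ..
    then have RL: "R \<phi> \<in> carrier (C.Lp q)" and Rn: "nnorm (C.Lp q) (R \<phi>) \<le> nnorm X.dual \<phi>"
      and Rd: "dual_map p (R \<phi>) = \<phi>" if "\<phi> \<in> carrier X.dual" for \<phi> using that by simp_all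
    have V_add: "V (f \<oplus>\<^bsub>conj_module\<^esub> g) = V f + V g"
      if f: "f \<in> carrier (C.Lp q)" and g: "g \<in> carrier (C.Lp q)" for f g
    proof -
      have fS: "f \<in> carrier conj_module" "g \<in> carrier conj_module" using f g by (simp_all add: C.Lp_carrierD)
      have "AE w in G. c w * L0_rep (F (f \<oplus>\<^bsub>conj_module\<^esub> g)) w = c w * L0_rep (F f) w + c w * L0_rep (F g) w"
        using C.AE_conj_add[OF F fS] by eventually_elim (simp add: distrib_left)
      then have "V (f \<oplus>\<^bsub>conj_module\<^esub> g) = (\<integral>w. c w * L0_rep (F f) w + c w * L0_rep (F g) w \<partial>G)"
        unfolding V_def using fS by (intro integral_cong_AE borel_measurable_add m C.M.a_closed)
      then show ?thesis using int[OF f] int[OF g] by (simp add: V_def)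
    qed
    have V_sm: "V (C.sm a f) = (\<integral>w. a w * (c w * L0_rep (F f) w) \<partial>G)"
      "integrable G (\<lambda>w. a w * (c w * L0_rep (F f) w))"
      if f: "f \<in> carrier conj_module" and a: "a \<in> borel_measurable G" and af: "C.sm a f \<in> carrier (C.Lp q)" for f a
    proof -
      have AE: "AE w in G. c w * L0_rep (F (C.sm a f)) w = a w * (c w * L0_rep (F f) w)"
        using C.AE_conj_sm[OF F f a] by eventually_elim simp
      have m': "(\<lambda>w. a w * (c w * L0_rep (F f) w)) \<in> borel_measurable G"
        by (intro borel_measurable_times a m f)
      show "V (C.sm a f) = (\<integral>w. a w * (c w * L0_rep (F f) w) \<partial>G)"
        unfolding V_def using AE by (intro integral_cong_AE m m' C.sm_closed a f)
      show "integrable G (\<lambda>w. a w * (c w * L0_rep (F f) w))"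
        using int[OF af] integrable_cong_AE[OF m[OF C.sm_closed[OF a f]] m' AE] by simp
    qed
    have const: "C.sm (\<lambda>_. k) f \<in> carrier (C.Lp q)" if "f \<in> carrier (C.Lp q)" for k f
      using C.Lp_sm(1)[OF _ that q, of "\<lambda>_. k" "norm k"] by simp
    define Z where "Z = (\<lambda>\<phi>\<in>carrier X.dual. V (R \<phi>))"
    have "Z \<in> carrier (conjugate_space X.dual)"
    proof (rule X.bidualI)
      show "Z \<in> extensional (carrier X.dual)" by (simp add: Z_def)
      fix \<phi> assume \<phi>: "\<phi> \<in> carrier X.dual"
      show "Z (\<phi> \<oplus>\<^bsub>X.dual\<^esub> \<psi>) = Z \<phi> + Z \<psi>" if \<psi>: "\<psi> \<in> carrier X.dual" for \<psi>
      proof -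
        have cl: "\<phi> \<oplus>\<^bsub>X.dual\<^esub> \<psi> \<in> carrier X.dual" by (rule X.dual_closed(1)[OF \<phi> \<psi>])
        have "R (\<phi> \<oplus>\<^bsub>X.dual\<^esub> \<psi>) = R \<phi> \<oplus>\<^bsub>conj_module\<^esub> R \<psi>"
          using C.Lp_add(1)[OF RL[OF \<phi>] RL[OF \<psi>] q]
          by - (rule dual_map_inj[OF RL[OF cl]], simp_all add: Rd cl \<phi> \<psi> dual_map_add RL)
        then show ?thesis using \<phi> \<psi> cl by (simp add: Z_def V_add RL)
      qed
      show "Z (k \<odot>\<^bsub>X.dual\<^esub> \<phi>) = k * Z \<phi>" for k
      proof -
        have cl: "k \<odot>\<^bsub>X.dual\<^esub> \<phi> \<in> carrier X.dual" by (rule X.dual_closed(2)[OF \<phi> \<phi>])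
        have "R (k \<odot>\<^bsub>X.dual\<^esub> \<phi>) = C.sm (\<lambda>_. k) (R \<phi>)"
          using const[OF RL[OF \<phi>], of k]
          by - (rule dual_map_inj[OF RL[OF cl]], simp_all add: Rd cl \<phi> dual_map_smult RL)
        then have "Z (k \<odot>\<^bsub>X.dual\<^esub> \<phi>) = (\<integral>w. k * (c w * L0_rep (F (R \<phi>)) w) \<partial>G)"
          using V_sm(1)[OF C.Lp_carrierD[OF RL[OF \<phi>]] _ const[OF RL[OF \<phi>]], of k] cl by (simp add: Z_def)
        then show ?thesis using \<phi> int[OF RL[OF \<phi>]] by (simp add: Z_def V_def)
      qed
      show "norm (Z \<phi>) \<le> 1 * nnorm X.dual \<phi>"
        using int_le[OF RL[OF \<phi>]] Rn[OF \<phi>] \<phi> by (simp add: Z_def V_def)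
    qed
    then obtain x where x: "x \<in> carrier (Lp p)" and Zx: "Z = canonical_embedding (Lp p) x"
      unfolding refl[symmetric] by blast
    have xS: "x \<in> carrier S" by (rule Lp_carrierD[OF x])
    have Vx: "V f = (\<integral>w. L0_rep (f x) w \<partial>G)" if f: "f \<in> carrier (C.Lp q)" for f
    proof -
      have d: "dual_map p f \<in> carrier X.dual" by (rule dual_map_mem(1)[OF f])
      have "R (dual_map p f) = f" by (rule dual_map_inj[OF RL[OF d] f Rd[OF d]])
      then have "V f = Z (dual_map p f)" using d by (simp add: Z_def)
      also have "\<dots> = (\<integral>w. L0_rep (f x) w \<partial>G)"
        using d x by (simp add: Zx canonical_embedding_def dual_map_def)
      finally show ?thesis .
    qed
    \<comment> \<open>The identity \<open>Vx\<close> is known for \<open>f\<close> in the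
      \<open>L^q\<close> space only. A general \<open>f\<close> in the conjugate module is
      multiplied by small test functions to land there, and the almost-sure identity is then read
      off.\<close>
    have key: "AE w in G. c w * L0_rep (F f) w = L0_rep (f x) w" if f: "f \<in> carrier conj_module" for f
    proof (rule AE_eq_of_test_integrals)
      note [measurable] = Nc_measurable[OF f]
      show "(\<lambda>w. c w * L0_rep (F f) w) \<in> borel_measurable G" by (rule m[OF f])
      show "L0_rep (f x) \<in> borel_measurable G" using f xS by simp
      show "(\<lambda>w. 1 / (1 + \<bar>Nc f w\<bar>)) \<in> borel_measurable G" by measurable
      show "0 < 1 / (1 + \<bar>Nc f w\<bar>)" for w by (simp add: add_pos_nonneg)
      fix a :: "'w \<Rightarrow> 'k" assume a: "a \<in> borel_measurable G" and le: "\<And>w. norm (a w) \<le> 1 / (1 + \<bar>Nc f w\<bar>)"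
      have af: "C.sm a f \<in> carrier (C.Lp q)"
      proof (rule C.bounded_in_Lp[OF C.sm_closed[OF a f] q, of 1])
        show "AE w in G. C.N (C.sm a f) w \<le> 1"
          using C.AE_N_sm[OF a f] C.AE_N_nonneg[OF f]
        proof eventually_elim
          case (elim w)
          have "norm (a w) * C.N f w \<le> 1 / (1 + \<bar>Nc f w\<bar>) * C.N f w" using elim le by (intro mult_right_mono)
          also have "\<dots> \<le> 1" using elim by (simp add: C_N)
          finally show ?case using elim by simp
        qed
      qed simp
      note afS = C.sm_closed[OF a f]
      have AE: "AE w in G. L0_rep (C.sm a f x) w = a w * L0_rep (f x) w" by (rule C_sm_rep[OF f a xS])
      have m1: "L0_rep (C.sm a f x) \<in> borel_measurable G" using afS xS by simp
      have m2: "(\<lambda>w. a w * L0_rep (f x) w) \<in> borel_measurable G"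
        using f xS by (intro borel_measurable_times a) simp
      have "(\<integral>w. a w * (c w * L0_rep (F f) w) \<partial>G) = (\<integral>w. a w * L0_rep (f x) w \<partial>G)"
        unfolding V_sm(1)[OF f a af, symmetric] Vx[OF af] by (rule integral_cong_AE[OF m1 m2 AE])
      then show "integrable G (\<lambda>w. a w * (c w * L0_rep (F f) w)) \<and> integrable G (\<lambda>w. a w * L0_rep (f x) w) \<and>
          (\<integral>w. a w * (c w * L0_rep (F f) w) \<partial>G) = (\<integral>w. a w * L0_rep (f x) w \<partial>G)"
        using V_sm(2)[OF f a af] pairing(1)[OF p q pq af x] integrable_cong_AE[OF m1 m2 AE] by simp
    qed
    \<comment> \<open>The reciprocal of \<open>c\<close>: multiplying \<open>x\<close> by it undoes
      the scaling, at the price that the point need no longer lie in \<open>L^p(S)\<close>.\<close>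
    define b where "b = (\<lambda>w. of_real (1 + \<bar>C.Nc F w\<bar>) :: 'k)"
    have b: "b \<in> borel_measurable G" by (simp add: b_def)
    have bc: "b w * c w = 1" for w
    proof -
      have "(of_real (1 + \<bar>C.Nc F w\<bar>) :: 'k) \<noteq> 0" unfolding of_real_eq_0_iff by linarith
      then show ?thesis by (simp add: b_def c_def del: of_real_add)
    qed
    have y: "sm b x \<in> carrier S" by (rule sm_closed[OF b xS])
    have "F = random_embedding G S (sm b x)"
    proof (rule C.conj_eqI[OF F embedding_mem[OF y]])
      fix f assume f: "f \<in> carrier conj_module"
      have "random_embedding G S (sm b x) f = f (sm b x)" using f by (simp add: random_embedding_def)
      moreover have "AE w in G. L0_rep (F f) w = L0_rep (f (sm b x)) w"
        using key[OF f] AE_conj_sm[OF f xS b]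
      proof eventually_elim
        case (elim w)
        have "L0_rep (F f) w = (b w * c w) * L0_rep (F f) w" by (simp add: bc)
        also have "\<dots> = b w * L0_rep (f x) w" unfolding mult.assoc elim(1) ..
        finally show ?case using elim(2) by simp
      qed
      ultimately show "AE w in G. L0_rep (F f) w = L0_rep (random_embedding G S (sm b x) f) w" by simp
    qed
    then show "F \<in> random_embedding G S ` carrier S" using y by blast
  qed
qed

end

theorem random_reflexive_iff_Lp_reflexive:
  assumes p: "1 < p"
  shows "random_reflexive G S \<longleftrightarrow> reflexive_banach_space (Lp_space G p S)"
proof -
  define q where "q = p / (p - 1)"
  have q: "1 < q" "1 / p + 1 / q = 1" using p by (auto simp: q_def field_simps)
  have "random_normed_module G S" by unfold_locales
  then show ?thesis
    using reflexive_of_random_reflexive[OF p q] random_reflexive_of_reflexive[OF p q]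
    unfolding random_reflexive_def reflexive_banach_space_def by blast
qed

end

section \<open>The conditional module\<close>

text \<open>The two spaces to be compared need not be equal as records, since their norms may differ
  off the carrier. Dual, metric and canonical embedding depend only on the data listed; subtraction
  is covered because it is addition of a multiple by -1.\<close>

lemma reflexive_banach_space_cong:
  fixes X Y :: "('k::{real_normed_field, euclidean_space}, 'a) n_space"
  assumes X: "normed_space X" and Y: "normed_space Y"
    and eq: "carrier X = carrier Y" "add X = add Y" "\<And>c x. c \<odot>\<^bsub>X\<^esub> x = c \<odot>\<^bsub>Y\<^esub> x"
    and n: "\<And>x. x \<in> carrier Y \<Longrightarrow> nnorm X x = nnorm Y x"
  shows "reflexive_banach_space X \<longleftrightarrow> reflexive_banach_space Y"
proof -
  interpret X: normed_space X by (rule X)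
  interpret Y: normed_space Y by (rule Y)
  have conj: "conjugate_space X = conjugate_space Y"
  proof -
    have "{x \<in> carrier X. nnorm X x \<le> 1} = {x \<in> carrier Y. nnorm Y x \<le> 1}"
      using eq n by auto
    then show ?thesis unfolding conjugate_space_def using eq n by (simp cong: conj_cong)
  qed
  have "ndist X x y = ndist Y x y" for x y
  proof (cases "x \<in> carrier Y \<and> y \<in> carrier Y")
    case True
    then have xX: "x \<in> carrier X" "y \<in> carrier X" using eq by simp_all
    have "x \<ominus>\<^bsub>X\<^esub> y = x \<ominus>\<^bsub>Y\<^esub> y"
      unfolding X.minus_eq[OF xX] Y.minus_eq[OF conjunct1[OF True] conjunct2[OF True]] by (simp add: eq)
    then show ?thesis using True eq n by (simp add: ndist_def)
  qed (auto simp: ndist_def eq)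
  then have "ndist X = ndist Y" by blast
  then have "banach_space X \<longleftrightarrow> banach_space Y"
    unfolding banach_space_def banach_space_axioms_def using X Y eq by simp
  moreover have "canonical_embedding X = canonical_embedding Y"
    by (simp add: canonical_embedding_def conj fun_eq_iff)
  ultimately show ?thesis
    unfolding reflexive_banach_space_def conj eq(1) by simp
qed

context random_normed_module
begin

section \<open>Conditional norms\<close>

context
  fixes F :: "'w measure" and p :: real
  assumes sub: "subalgebra G F" and p: "1 < p"
begin

abbreviation F' where "F' \<equiv> restr_to_subalg G F"
abbreviation L where "L \<equiv> cond_Lp_module G F p S"

interpretation P': prob_space F'
  by (rule prob_space_restr_to_subalg[OF sub]) unfold_locales

interpretation sigma_finite_subalgebra G F
proof -
  have "finite_measure_subalgebra G F"
    using sub by (intro finite_measure_subalgebra.intro finite_measure_subalgebra_axioms.intro) unfold_locales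
  then show "sigma_finite_subalgebra G F" by (rule finite_measure_subalgebra_is_sigma_finite)
qed

definition E :: "'a \<Rightarrow> 'w \<Rightarrow> ennreal" where
  "E x = nn_cond_exp G F (\<lambda>v. ennreal (N x v powr p))"

text \<open>The conditional norm as a real function, \<open>F\<close>-measurable and nonnegative at
  every point. Where \<open>E x w\<close> is infinite \<open>enn2real\<close> gives 0, which for
  members of \<open>L\<close> concerns a null set only.\<close>

definition K :: "'a \<Rightarrow> 'w \<Rightarrow> real" where
  "K x w = enn2real (E x w) powr (1 / p)"

lemma E_measurable [measurable]: "E x \<in> borel_measurable F"
  by (simp add: E_def)

lemma K_measurable [measurable]: "K x \<in> borel_measurable F"
  unfolding K_def by measurable

lemma K_measurable' [simp]: "K x \<in> borel_measurable F'"
  by (rule measurable_in_subalg[OF sub K_measurable])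

lemma F'_measurableD [simp]: "f \<in> borel_measurable F' \<Longrightarrow> f \<in> borel_measurable G"
  by (rule measurable_from_subalg[OF sub measurable_in_subalg'[OF sub]])

lemma K_nonneg: "0 \<le> K x w"
  by (simp add: K_def)

lemma K_powr: "E x w < \<top> \<Longrightarrow> ennreal (K x w powr p) = E x w"
  using p by (simp add: K_def powr_powr)

lemma L_simps [simp]:
  "add L = add S" "zero L = zero S" "\<xi> \<odot>\<^bsub>L\<^esub> x = sm (L0_rep \<xi>) x"
  by (simp_all add: cond_Lp_module_def sm_def)

lemma AE_F'I: "AE w in G. Q w \<Longrightarrow> Measurable.pred F Q \<Longrightarrow> AE w in F'. Q w"
  by (rule AE_restr_to_subalg2[OF sub])

lemma L_carrier_iff: "x \<in> carrier L \<longleftrightarrow> x \<in> carrier S \<and> (AE w in G. E x w < \<top>)"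
proof -
  have "cond_Lp_norm G F p S x w < \<top> \<longleftrightarrow> E x w < \<top>" for w
    by (auto simp: cond_Lp_norm_def ennreal_powr_def E_def N_def less_top)
  then have "x \<in> carrier L \<longleftrightarrow> x \<in> carrier S \<and> (AE w in F'. E x w < \<top>)"
    by (simp add: cond_Lp_module_def)
  also have "(AE w in F'. E x w < \<top>) \<longleftrightarrow> (AE w in G. E x w < \<top>)"
    using AE_restr_to_subalg[OF sub] AE_F'I[of "\<lambda>w. E x w < \<top>"] by auto
  finally show ?thesis .
qed

lemma L_rnorm: "x \<in> carrier L \<Longrightarrow> rnorm L x = L0_class F' (K x)"
proof -
  assume "x \<in> carrier L"
  then have "AE w in G. E x w < \<top>" by (simp add: L_carrier_iff)
  then have AE: "AE w in F'. E x w < \<top>" by (rule AE_F'I) measurable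
  have eq: "enn2real (cond_Lp_norm G F p S x w) = K x w" if "E x w < \<top>" for w
    using that by (auto simp: cond_Lp_norm_def ennreal_powr_def K_def E_def N_def)
  have "(\<lambda>w. cond_Lp_norm G F p S x w) \<in> borel_measurable F"
    unfolding cond_Lp_norm_def ennreal_powr_def by measurable
  then have m: "(\<lambda>w. enn2real (cond_Lp_norm G F p S x w)) \<in> borel_measurable F'"
    by (intro measurable_in_subalg[OF sub]) simp
  have "rnorm L x = L0_class F' (\<lambda>w. enn2real (cond_Lp_norm G F p S x w))"
    by (simp add: cond_Lp_module_def)
  also have "\<dots> = L0_class F' (K x)"
    using AE by (intro L0_class_cong m K_measurable') (auto elim!: eventually_mono simp: eq)
  finally show ?thesis .
qed

lemma integral_E: "x \<in> carrier S \<Longrightarrow> (\<integral>\<^sup>+w. E x w \<partial>G) = (\<integral>\<^sup>+w. ennreal (N x w powr p) \<partial>G)"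
  using nn_cond_exp_intg[of "\<lambda>_. 1" "\<lambda>w. ennreal (N x w powr p)"] by (simp add: E_def)

text \<open>The factor \<open>norm (a w) powr p\<close> is \<open>F\<close>-measurable and can be
  taken out of the conditional expectation.\<close>

lemma E_sm:
  assumes a: "a \<in> borel_measurable F" and x: "x \<in> carrier S"
  shows "AE w in G. E (sm a x) w = ennreal (norm (a w) powr p) * E x w"
proof -
  note [measurable] = a
  have aG: "a \<in> borel_measurable G" by (rule measurable_from_subalg[OF sub a])
  have ax: "sm a x \<in> carrier S" using aG x by simp
  have "AE w in G. E (sm a x) w = nn_cond_exp G F (\<lambda>w. ennreal (norm (a w) powr p) * ennreal (N x w powr p)) w"
    unfolding E_def
  proof (rule nn_cond_exp_cong)
    show "AE w in G. ennreal (N (sm a x) w powr p) = ennreal (norm (a w) powr p) * ennreal (N x w powr p)"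
      using AE_N_sm[OF aG x] AE_N_nonneg[OF x] by eventually_elim (simp add: powr_mult ennreal_mult)
    show "(\<lambda>w. ennreal (norm (a w) powr p) * ennreal (N x w powr p)) \<in> borel_measurable G"
      using aG x by (intro borel_measurable_times_ennreal) simp_all
  qed (use ax in simp)
  moreover have "AE w in G. ennreal (norm (a w) powr p) * E x w =
      nn_cond_exp G F (\<lambda>w. ennreal (norm (a w) powr p) * ennreal (N x w powr p)) w"
    unfolding E_def by (rule nn_cond_exp_prod) (use x in simp_all)
  ultimately show ?thesis by eventually_elim simp
qed

lemma L_sm:
  assumes a: "a \<in> borel_measurable F" and x: "x \<in> carrier L"
  shows "sm a x \<in> carrier L" "AE w in G. K (sm a x) w = norm (a w) * K x w"
proof -
  have xS: "x \<in> carrier S" and fin: "AE w in G. E x w < \<top>" using x by (simp_all add: L_carrier_iff)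
  have "AE w in G. E (sm a x) w < \<top>"
    using E_sm[OF a xS] fin by eventually_elim (simp add: ennreal_mult_less_top)
  then show "sm a x \<in> carrier L"
    using xS measurable_from_subalg[OF sub a] by (simp add: L_carrier_iff)
  show "AE w in G. K (sm a x) w = norm (a w) * K x w"
    using E_sm[OF a xS]
  proof eventually_elim
    case (elim w)
    have "enn2real (E (sm a x) w) = norm (a w) powr p * enn2real (E x w)"
      unfolding elim enn2real_mult by simp
    then show ?case using p by (simp add: K_def powr_mult powr_powr)
  qed
qed

text \<open>Conditional Minkowski inequality. In the weighted inequality the weights are now the
  \<open>F\<close>-measurable functions \<open>K x w + e\<close> and \<open>K y w + e\<close>, which
  can be taken out of the conditional expectation. The summand \<open>e\<close> makes them positive;
  it runs through a sequence tending to 0, so that countably many null sets are discarded.\<close>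

lemma E_add:
  assumes x: "x \<in> carrier L" and y: "y \<in> carrier L"
  shows "AE w in G. E (x \<oplus> y) w \<le> ennreal ((K x w + K y w) powr p)"
proof -
  have xS: "x \<in> carrier S" and xf: "AE w in G. E x w < \<top>" using x by (simp_all add: L_carrier_iff)
  have yS: "y \<in> carrier S" and yf: "AE w in G. E y w < \<top>" using y by (simp_all add: L_carrier_iff)
  have zS: "x \<oplus> y \<in> carrier S" using xS yS by simp
  \<comment> \<open>The summand \<open>2 / real (Suc n)\<close> is \<open>e + e\<close>, one for
    each weight.\<close>
  have step: "AE w in G. E (x \<oplus> y) w \<le> ennreal ((K x w + K y w + 2 / real (Suc n)) powr p)" for n
  proof -
    define e where "e = 1 / real (Suc n)"
    have e: "0 < e" by (simp add: e_def)
    define A B where "A = (\<lambda>w. K x w + e)" and "B = (\<lambda>w. K y w + e)"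
    have [measurable]: "A \<in> borel_measurable F" "B \<in> borel_measurable F" by (simp_all add: A_def B_def)
    have Apos: "0 < A w" and Bpos: "0 < B w" for w using K_nonneg[of x w] K_nonneg[of y w] e by (simp_all add: A_def B_def)
    define c a b where "c = (\<lambda>w. ennreal ((A w + B w) powr (p - 1)))"
      and "a = (\<lambda>w. c w * ennreal (A w powr (1 - p)))" and "b = (\<lambda>w. c w * ennreal (B w powr (1 - p)))"
    have [measurable]: "c \<in> borel_measurable F" by (simp add: c_def)
    have a [measurable]: "a \<in> borel_measurable F" and b [measurable]: "b \<in> borel_measurable F"
      by (simp_all add: a_def b_def)
    let ?x = "\<lambda>w. ennreal (N x w powr p)" and ?y = "\<lambda>w. ennreal (N y w powr p)"
    have xm: "?x \<in> borel_measurable G" and ym: "?y \<in> borel_measurable G" using xS yS by simp_all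
    have axm: "(\<lambda>w. a w * ?x w) \<in> borel_measurable G" and bym: "(\<lambda>w. b w * ?y w) \<in> borel_measurable G"
      using xm ym measurable_from_subalg[OF sub a] measurable_from_subalg[OF sub b]
      by (intro borel_measurable_times_ennreal; simp)+
    have "AE w in G. ennreal (N (x \<oplus> y) w powr p) \<le> a w * ?x w + b w * ?y w"
      using AE_N_add[OF xS yS] AE_N_nonneg[OF xS] AE_N_nonneg[OF yS] AE_N_nonneg[OF zS]
    proof eventually_elim
      case (elim w)
      have "N (x \<oplus> y) w powr p \<le> (N x w + N y w) powr p"
        using elim p by (intro powr_mono2) auto
      also have "\<dots> \<le> (A w + B w) powr (p - 1) * (A w powr (1 - p) * N x w powr p + B w powr (1 - p) * N y w powr p)"
        by (rule powr_add_le_weighted[OF p elim(2,3) Apos Bpos])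
      finally have "ennreal (N (x \<oplus> y) w powr p) \<le> ennreal
          ((A w + B w) powr (p - 1) * (A w powr (1 - p) * N x w powr p + B w powr (1 - p) * N y w powr p))"
        by (rule ennreal_leI)
      also have "\<dots> = a w * ?x w + b w * ?y w"
        by (simp add: a_def b_def c_def ennreal_mult ennreal_plus distrib_left mult.assoc)
      finally show ?case .
    qed
    then have "AE w in G. E (x \<oplus> y) w \<le> nn_cond_exp G F (\<lambda>w. a w * ?x w + b w * ?y w) w"
      unfolding E_def by (rule nn_cond_exp_mono) (use zS axm bym in \<open>simp_all add: borel_measurable_add\<close>)
    moreover have "AE w in G. nn_cond_exp G F (\<lambda>w. a w * ?x w) w + nn_cond_exp G F (\<lambda>w. b w * ?y w) w =
        nn_cond_exp G F (\<lambda>w. a w * ?x w + b w * ?y w) w"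
      by (rule nn_cond_exp_sum[OF axm bym])
    moreover have "AE w in G. a w * E x w = nn_cond_exp G F (\<lambda>w. a w * ?x w) w"
      unfolding E_def by (rule nn_cond_exp_prod[OF a xm])
    moreover have "AE w in G. b w * E y w = nn_cond_exp G F (\<lambda>w. b w * ?y w) w"
      unfolding E_def by (rule nn_cond_exp_prod[OF b ym])
    ultimately show ?thesis
      using xf yf
    proof eventually_elim
      case (elim w)
      have "E (x \<oplus> y) w \<le> a w * E x w + b w * E y w" using elim(1-4) by simp
      also have "\<dots> \<le> a w * ennreal (A w powr p) + b w * ennreal (B w powr p)"
        unfolding K_powr[OF elim(5), symmetric] K_powr[OF elim(6), symmetric]
        using p e K_nonneg by (intro add_mono mult_left_mono ennreal_leI powr_mono2) (auto simp: A_def B_def)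
      also have "\<dots> = ennreal ((A w + B w) powr (p - 1) *
          (A w powr (1 - p) * A w powr p + B w powr (1 - p) * B w powr p))"
        by (simp add: a_def b_def c_def ennreal_mult ennreal_plus distrib_left mult.assoc)
      also have "A w powr (1 - p) * A w powr p = A w" using Apos[of w] by (simp add: powr_add[symmetric])
      also have "B w powr (1 - p) * B w powr p = B w" using Bpos[of w] by (simp add: powr_add[symmetric])
      also have "(A w + B w) powr (p - 1) * (A w + B w) = (A w + B w) powr p"
        using Apos[of w] Bpos[of w] powr_add[of "A w + B w" "p - 1" 1] by simp
      also have "A w + B w = K x w + K y w + 2 / real (Suc n)" by (simp add: A_def B_def e_def)
      finally show ?case .
    qed
  qed
  have "AE w in G. \<forall>n. E (x \<oplus> y) w \<le> ennreal ((K x w + K y w + 2 / real (Suc n)) powr p)"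
    using step by (simp only: AE_all_countable) simp
  then show ?thesis
  proof eventually_elim
    case (elim w)
    have "(\<lambda>n. 2 / real (Suc n)) \<longlonglongrightarrow> 0"
      using tendsto_mult_right_zero[OF LIMSEQ_inverse_real_of_nat, of 2] by (simp add: divide_inverse)
    then have "(\<lambda>n. K x w + K y w + 2 / real (Suc n)) \<longlonglongrightarrow> K x w + K y w + 0"
      by (intro tendsto_add tendsto_const)
    then have "(\<lambda>n. (K x w + K y w + 2 / real (Suc n)) powr p) \<longlonglongrightarrow> (K x w + K y w) powr p"
      using p K_nonneg by (intro tendsto_powr') (auto intro!: always_eventually add_nonneg_nonneg)
    then have "(\<lambda>n. ennreal ((K x w + K y w + 2 / real (Suc n)) powr p)) \<longlonglongrightarrow> ennreal ((K x w + K y w) powr p)"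
      by (rule tendsto_ennrealI)
    from LIMSEQ_le_const[OF this] show ?case using elim by blast
  qed
qed

lemma L_add:
  assumes x: "x \<in> carrier L" and y: "y \<in> carrier L"
  shows "x \<oplus> y \<in> carrier L" "AE w in G. K (x \<oplus> y) w \<le> K x w + K y w"
proof -
  have fin: "AE w in G. E (x \<oplus> y) w < \<top>"
    using E_add[OF x y] by eventually_elim (rule le_less_trans[OF _ ennreal_less_top])
  then show "x \<oplus> y \<in> carrier L" using x y by (simp add: L_carrier_iff)
  show "AE w in G. K (x \<oplus> y) w \<le> K x w + K y w"
    using E_add[OF x y]
  proof eventually_elim
    case (elim w)
    have "enn2real (E (x \<oplus> y) w) \<le> (K x w + K y w) powr p"
      using enn2real_mono[OF elim] by simp
    then have "K (x \<oplus> y) w \<le> ((K x w + K y w) powr p) powr (1 / p)"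
      unfolding K_def[of "x \<oplus> y"] using p by (intro powr_mono2) auto
    then show ?case using p K_nonneg by (simp add: powr_powr)
  qed
qed

lemma L_carrierD: "x \<in> carrier L \<Longrightarrow> x \<in> carrier S"
  by (simp add: L_carrier_iff)

text \<open>\<open>E x\<close> and the \<open>p\<close>-th power of \<open>N x\<close> have the same
  integral, so if the first vanishes almost surely then so does the second.\<close>

lemma AE_K_eq_0_iff:
  assumes x: "x \<in> carrier L"
  shows "(AE w in G. K x w = 0) \<longleftrightarrow> x = \<zero>"
proof
  have xS: "x \<in> carrier S" and xf: "AE w in G. E x w < \<top>" using x by (simp_all add: L_carrier_iff)
  assume "AE w in G. K x w = 0"
  then have "AE w in G. E x w = 0"
    using xf
  proof eventually_elim
    case (elim w)
    then show ?case using K_powr[OF elim(2)] p by simp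
  qed
  then have "(\<integral>\<^sup>+w. E x w \<partial>G) = 0"
    by (subst nn_integral_0_iff_AE) (simp_all add: measurable_from_subalg[OF sub])
  then have "AE w in G. N x w = 0"
    using xS unfolding integral_E[OF xS] by (intro AE_zero_of_nn_integral_powr[of _ _ p]) simp_all
  then show "x = \<zero>" using AE_N_eq_0_iff[OF xS] by simp
next
  assume "x = \<zero>"
  then have "x = sm (\<lambda>_. 0) x" using L_carrierD[OF x] by simp
  then show "AE w in G. K x w = 0" using L_sm(2)[OF _ x, of "\<lambda>_. 0"] by simp
qed

lemma rep_F [simp]: "\<xi> \<in> L0 F' \<Longrightarrow> L0_rep \<xi> \<in> borel_measurable F"
  by (rule measurable_in_subalg'[OF sub L0_rep_measurable])

lemma rep_G [simp]: "\<xi> \<in> L0 F' \<Longrightarrow> L0_rep \<xi> \<in> borel_measurable G"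
  by (rule F'_measurableD[OF L0_rep_measurable])

lemma random_normed_module_cond_Lp: "random_normed_module F' L"
proof (intro random_normed_module.intro random_normed_module_axioms.intro)
  show "prob_space F'" by unfold_locales
  have zero: "\<zero> \<in> carrier L"
  proof -
    have "(\<integral>\<^sup>+w. E \<zero> w \<partial>G) = (\<integral>\<^sup>+w. ennreal (N \<zero> w powr p) \<partial>G)" by (rule integral_E) simp
    also have "\<dots> = (\<integral>\<^sup>+w. 0 \<partial>G)"
      using AE_N_eq_0_iff[of "\<zero>"] by (intro nn_integral_cong_AE) (auto elim!: eventually_mono)
    finally have "AE w in G. E \<zero> w \<noteq> \<infinity>"
      by (intro nn_integral_PInf_AE) (simp_all add: measurable_from_subalg[OF sub])
    then show ?thesis by (simp add: L_carrier_iff less_top)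
  qed
  show "Module.module (L0_ring F') L"
  proof (rule moduleI)
    show "cring (L0_ring F' :: ('w \<Rightarrow> 'k) set ring)" by (rule cring_L0_ring)
    show "abelian_group L"
    proof (rule abelian_groupI)
      fix x assume x: "x \<in> carrier L"
      have "sm (\<lambda>_. -1) x \<oplus> x = \<zero>"
        using sm_add[of "\<lambda>_. -1" "\<lambda>_. 1" x] L_carrierD[OF x] by simp
      then show "\<exists>y\<in>carrier L. y \<oplus>\<^bsub>L\<^esub> x = \<zero>\<^bsub>L\<^esub>"
        using L_sm(1)[OF _ x, of "\<lambda>_. -1"] by (intro bexI[of _ "sm (\<lambda>_. -1) x"]) simp_all
      show "\<zero>\<^bsub>L\<^esub> \<oplus>\<^bsub>L\<^esub> x = x" using L_carrierD[OF x] by simp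
      fix y assume y: "y \<in> carrier L"
      show "x \<oplus>\<^bsub>L\<^esub> y \<in> carrier L" using L_add(1)[OF x y] by simp
      show "x \<oplus>\<^bsub>L\<^esub> y = y \<oplus>\<^bsub>L\<^esub> x" using L_carrierD[OF x] L_carrierD[OF y] by (simp add: M.a_comm)
      fix z assume z: "z \<in> carrier L"
      show "x \<oplus>\<^bsub>L\<^esub> y \<oplus>\<^bsub>L\<^esub> z = x \<oplus>\<^bsub>L\<^esub> (y \<oplus>\<^bsub>L\<^esub> z)"
        using L_carrierD[OF x] L_carrierD[OF y] L_carrierD[OF z] by (simp add: M.a_assoc)
    qed (simp add: zero)
    fix x assume x: "x \<in> carrier L"
    have xS: "x \<in> carrier S" by (rule L_carrierD[OF x])
    \<comment> \<open>The chosen representative is known up to a null set of the restricted measure,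
      which is also a null set of \<open>G\<close>. The module laws that involve the ring operations
      are all carried over in this way.\<close>
    have "sm (L0_rep \<one>\<^bsub>L0_ring F'\<^esub>) x = sm (\<lambda>_. 1) x"
      using AE_restr_to_subalg[OF sub AE_L0_rep_class[of "\<lambda>w. 1::'k" F']]
      by (intro sm_cong) (simp_all add: one_L0_ring)
    then show "\<one>\<^bsub>L0_ring F'\<^esub> \<odot>\<^bsub>L\<^esub> x = x" using xS by simp
    fix a :: "('w \<Rightarrow> 'k) set" assume "a \<in> carrier (L0_ring F')"
    then have a: "a \<in> L0 F'" by simp
    show "a \<odot>\<^bsub>L\<^esub> x \<in> carrier L" using L_sm(1)[OF rep_F[OF a] x] by simp
    show "a \<odot>\<^bsub>L\<^esub> (x \<oplus>\<^bsub>L\<^esub> y) = a \<odot>\<^bsub>L\<^esub> x \<oplus>\<^bsub>L\<^esub> a \<odot>\<^bsub>L\<^esub> y" if "y \<in> carrier L" for y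
      using sm_add_right[OF rep_G[OF a] xS L_carrierD[OF that]] by simp
    fix b :: "('w \<Rightarrow> 'k) set" assume "b \<in> carrier (L0_ring F')"
    then have b: "b \<in> L0 F'" by simp
    note ab = L0_add_closed[OF a b]
    have "sm (L0_rep (a \<oplus>\<^bsub>L0_ring F'\<^esub> b)) x = sm (\<lambda>w. L0_rep a w + L0_rep b w) x"
      using AE_restr_to_subalg[OF sub AE_L0_rep_add[OF a b]] a b ab
      by (intro sm_cong borel_measurable_add) simp_all
    then show "(a \<oplus>\<^bsub>L0_ring F'\<^esub> b) \<odot>\<^bsub>L\<^esub> x = a \<odot>\<^bsub>L\<^esub> x \<oplus>\<^bsub>L\<^esub> b \<odot>\<^bsub>L\<^esub> x"
      using sm_add[OF rep_G[OF a] rep_G[OF b] xS] by simp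
    have "sm (L0_rep (a \<otimes>\<^bsub>L0_ring F'\<^esub> b)) x = sm (\<lambda>w. L0_rep a w * L0_rep b w) x"
      using AE_restr_to_subalg[OF sub AE_L0_rep_mult[OF a b]] a b ab
      by (intro sm_cong borel_measurable_times) simp_all
    then show "(a \<otimes>\<^bsub>L0_ring F'\<^esub> b) \<odot>\<^bsub>L\<^esub> x = a \<odot>\<^bsub>L\<^esub> (b \<odot>\<^bsub>L\<^esub> x)"
      using sm_mult[OF rep_G[OF a] rep_G[OF b] xS] by simp
  qed
  fix x assume x: "x \<in> carrier L"
  have xS: "x \<in> carrier S" by (rule L_carrierD[OF x])
  show "rnorm L x \<in> L0_nonneg F'"
    unfolding L_rnorm[OF x] by (simp add: L0_class_nonneg_iff K_nonneg)
  show "rnorm L (\<xi> \<odot>\<^bsub>L\<^esub> x) = L0_abs F' \<xi> \<otimes>\<^bsub>L0_ring F'\<^esub> rnorm L x" if \<xi>: "\<xi> \<in> L0 F'" for \<xi>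
  proof -
    have m: "(\<lambda>w. norm (L0_rep \<xi> w)) \<in> borel_measurable F'" using \<xi> by simp
    note [measurable] = rep_F[OF \<xi>]
    have "L0_abs F' \<xi> \<otimes>\<^bsub>L0_ring F'\<^esub> rnorm L x = L0_class F' (\<lambda>w. norm (L0_rep \<xi> w) * K x w)"
      unfolding L_rnorm[OF x] L0_abs_def by (rule L0_mult_class[OF m K_measurable'])
    also have "\<dots> = L0_class F' (K (sm (L0_rep \<xi>) x))"
    proof (rule L0_class_cong)
      have "AE w in G. norm (L0_rep \<xi> w) * K x w = K (sm (L0_rep \<xi>) x) w"
        using L_sm(2)[OF rep_F[OF \<xi>] x] by eventually_elim simp
      then show "AE w in F'. norm (L0_rep \<xi> w) * K x w = K (sm (L0_rep \<xi>) x) w"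
        by (rule AE_F'I) measurable
    qed (use m in \<open>simp_all add: borel_measurable_times\<close>)
    finally show ?thesis using L_rnorm[OF L_sm(1)[OF rep_F[OF \<xi>] x]] by simp
  qed
  show "L0_le F' (rnorm L (x \<oplus>\<^bsub>L\<^esub> y)) (rnorm L x \<oplus>\<^bsub>L0_ring F'\<^esub> rnorm L y)"
    if y: "y \<in> carrier L" for y
  proof -
    have "AE w in F'. K (x \<oplus> y) w \<le> K x w + K y w"
      using L_add(2)[OF x y] by (rule AE_F'I) measurable
    moreover have "(\<lambda>w. K x w + K y w) \<in> borel_measurable F'"
      by (intro borel_measurable_add K_measurable')
    ultimately show ?thesis
      using L_rnorm[OF L_add(1)[OF x y]] L0_le_class_iff[OF K_measurable', of "\<lambda>w. K x w + K y w" "x \<oplus> y"]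
      by (simp add: L_rnorm x y L0_add_class)
  qed
  show "rnorm L x = \<zero>\<^bsub>L0_ring F'\<^esub> \<longleftrightarrow> x = \<zero>\<^bsub>L\<^esub>"
  proof -
    have "rnorm L x = \<zero>\<^bsub>L0_ring F'\<^esub> \<longleftrightarrow> (AE w in F'. K x w = 0)"
      by (simp add: L_rnorm[OF x] zero_L0_ring L0_class_eq_iff)
    also have "\<dots> \<longleftrightarrow> (AE w in G. K x w = 0)"
      using AE_restr_to_subalg[OF sub] AE_F'I[of "\<lambda>w. K x w = 0"] by auto
    finally show ?thesis using AE_K_eq_0_iff[OF x] by simp
  qed
qed

lemma reflexive_Lp_cond_Lp_iff:
  "reflexive_banach_space (Lp_space F' p L) \<longleftrightarrow> reflexive_banach_space (Lp p)"
proof -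
  interpret L: random_normed_module F' L by (rule random_normed_module_cond_Lp)
  have int: "(\<integral>\<^sup>+w. ennreal (L.N x w powr p) \<partial>F') = (\<integral>\<^sup>+w. ennreal (N x w powr p) \<partial>G)"
    if x: "x \<in> carrier L" for x
  proof -
    have "AE w in F'. L.N x w = K x w"
      unfolding L.N_def L_rnorm[OF x] by (rule AE_L0_rep_class) simp
    then have "(\<integral>\<^sup>+w. ennreal (L.N x w powr p) \<partial>F') = (\<integral>\<^sup>+w. ennreal (K x w powr p) \<partial>F')"
      by (intro nn_integral_cong_AE) (auto elim!: eventually_mono)
    also have "\<dots> = (\<integral>\<^sup>+w. ennreal (K x w powr p) \<partial>G)"
      by (rule nn_integral_subalgebra2[OF sub]) measurable
    also have "\<dots> = (\<integral>\<^sup>+w. E x w \<partial>G)"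
      using x by (intro nn_integral_cong_AE) (auto simp: L_carrier_iff K_powr elim!: eventually_mono)
    finally show ?thesis using integral_E[OF L_carrierD[OF x]] by simp
  qed
  \<comment> \<open>A finite integral of \<open>E x\<close> makes \<open>E x\<close> finite almost
    surely, so \<open>L^p(S)\<close> lies inside the conditional module.\<close>
  have LpL: "x \<in> carrier L" if x: "x \<in> carrier (Lp p)" for x
  proof -
    have xS: "x \<in> carrier S" by (rule Lp_carrierD[OF x])
    have "(\<integral>\<^sup>+w. E x w \<partial>G) < \<top>" unfolding integral_E[OF xS] using x by (simp add: Lp_carrier_iff)
    then have "AE w in G. E x w \<noteq> \<infinity>"
      by (intro nn_integral_PInf_AE) (simp_all add: measurable_from_subalg[OF sub])
    then show ?thesis using xS by (simp add: L_carrier_iff less_top)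
  qed
  show ?thesis
  proof (rule reflexive_banach_space_cong)
    show "normed_space (Lp_space F' p L)" by (rule L.normed_space_Lp[OF p])
    show "normed_space (Lp p)" by (rule normed_space_Lp[OF p])
    show "carrier (Lp_space F' p L) = carrier (Lp p)"
      using LpL by (auto simp: L.Lp_carrier_iff Lp_carrier_iff int L_carrierD)
    show "add (Lp_space F' p L) = add (Lp p)" by simp
    show "nnorm (Lp_space F' p L) x = nnorm (Lp p) x" if "x \<in> carrier (Lp p)" for x
      using int[OF LpL[OF that]] by (simp add: L.nnorm_Lp nnorm_Lp)
    \<comment> \<open>On the left the constant acts through a representative of its class over the
      smaller algebra, which equals \<open>c\<close> only almost surely.\<close>
    show "c \<odot>\<^bsub>Lp_space F' p L\<^esub> x = c \<odot>\<^bsub>Lp p\<^esub> x" for c x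
      unfolding L.Lp_simps Lp_simps L.sm_def L_simps
      using AE_restr_to_subalg[OF sub AE_L0_rep_class[of "\<lambda>w. c" F']] by (intro sm_cong) simp_all
  qed
qed

end
end

theorem theorem4p13:
  fixes M F :: "'w measure"
    and S :: "('w, 'k::{real_normed_field, euclidean_space}, 'a) rn_module"
    and p :: real
  assumes "random_normed_module M S"
    and "subalgebra M F"
    and "1 < p"
  shows "(random_reflexive M S \<longleftrightarrow> reflexive_banach_space (Lp_space M p S)) \<and>
    (reflexive_banach_space (Lp_space M p S) \<longleftrightarrow>
      random_reflexive (restr_to_subalg M F) (cond_Lp_module M F p S))"
proof -
  interpret S: random_normed_module M S by fact
  interpret L: random_normed_module "restr_to_subalg M F" "cond_Lp_module M F p S"
    by (rule S.random_normed_module_cond_Lp[OF assms(2,3)])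
  show ?thesis
    using S.random_reflexive_iff_Lp_reflexive[OF assms(3)] L.random_reflexive_iff_Lp_reflexive[OF assms(3)]
      S.reflexive_Lp_cond_Lp_iff[OF assms(2,3)] by simp
qed

end
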